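(* Let $(\lambda^{(d)}\in\mathbb{Y}_d)_{d\ge1}$ be a sequence of random Young diagrams distributed by the Jack--Plancherel measures $\mathbb{P}^{(\alpha)}_d$. Assume $g<0$ and let $$\{l_1^{(-g)}<l_2^{(-g)}<\cdots\}=\{z\in\mathbb{R}: J_{z\cdot g^{-1}}(-2g^{-1})=0\}$$ be the set of zeroes, in the label parameter, of the Bessel function of the first kind. In the regime $d,\alpha^{-1}\to\infty$, $\sqrt{\alpha d}\to-g^{-1}$, $$\frac{\lambda^{(d)}_i}{-g\cdot d}\longrightarrow-l_i^{(-g)}-ig\quad\text{in probability, for all } i=1,2,\dots,$$ and moreover the limit shape $\omega_{\Lambda_{g;\mathbf{v}}}$, $\mathbf{v}=(1,0,0,\dots)$, is $$\omega_{\Lambda_{g;\mathbf{v}}}(x)=\begin{cases} x,&\text{if } x>-l_1^{(-g)}-g,\\ -2\big(l_i^{(-g)}+ig\big)-x,&\text{if } x\in\big[-l_i^{(-g)},\,-l_i^{(-g)}-g\big]\text{ for some }i\ge1,\\ x-2ig,&\text{if } x\in\big[-l_{i+1}^{(-g)}-g,\,-l_i^{(-g)}\big]\text{ for some }i\ge1.\end{cases}$$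
   Context: $\mathbb{Y}_d$ is the set of partitions (Young diagrams) of size $d$; $\alpha=\alpha(d)>0$ is a sequence. Jack--Plancherel measure: $\mathbb{P}^{(\alpha)}_d(\lambda):=\dfrac{d!\,\alpha^d}{\prod_{(i,j)\in\lambda}(\alpha(\lambda_i-j)+(\lambda'_j-i)+1)(\alpha(\lambda_i-j)+(\lambda'_j-i)+\alpha)}$, $\lambda\in\mathbb{Y}_d$, where $\lambda'$ is the conjugate partition. Bessel function: $J_\nu(x)=\sum_{m\ge0}\frac{(-1)^m}{m!\,\Gamma(m+\nu+1)}\big(\frac x2\big)^{2m+\nu}$ (with $1/\Gamma=0$ at the poles of $\Gamma$). Limit shape: $T_{w,h}\lambda$ is the diagram $\lambda$ (French convention, in $x,y\ge0$) with each $1\times1$ box replaced by a box of width $w$ and height $h$; its profile is the function whose graph in the coordinates $(x-y,x+y)$ is the boundary of $T_{w,h}\lambda$ extended by the coordinate half-axes. The limit shape is the deterministic function which is the limit, in supremum norm in probability, of the profiles of $T_{\sqrt{\alpha/d},\,1/\sqrt{\alpha d}}\,\lambda^{(d)}$ in the regime considered. *)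

theory Defs
  imports "HOL-Probability.Probability"
begin

section \<open>Young diagrams\<close>

text \<open>
  A Young diagram is the weakly decreasing list of its positive row lengths.  Rows and
  columns are numbered from 1.
\<close>

definition young_diagrams :: "nat \<Rightarrow> nat list set" where
  "young_diagrams d = {\<mu>. sorted_wrt (\<ge>) \<mu> \<and> (\<forall>r\<in>set \<mu>. 0 < r) \<and> sum_list \<mu> = d}"

definition row_length :: "nat list \<Rightarrow> nat \<Rightarrow> nat" where
  "row_length \<mu> i = (if 1 \<le> i \<and> i \<le> length \<mu> then \<mu> ! (i - 1) else 0)"

definition col_length :: "nat list \<Rightarrow> nat \<Rightarrow> nat" where
  "col_length \<mu> j = card {i. 1 \<le> i \<and> i \<le> length \<mu> \<and> j \<le> row_length \<mu> i}"

definition boxes :: "nat list \<Rightarrow> (nat \<times> nat) set" where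
  "boxes \<mu> = {(i, j). 1 \<le> i \<and> i \<le> length \<mu> \<and> 1 \<le> j \<and> j \<le> row_length \<mu> i}"

section \<open>The Jack--Plancherel measure\<close>

definition jack_plancherel :: "real \<Rightarrow> nat \<Rightarrow> nat list \<Rightarrow> real" where
  "jack_plancherel \<alpha> d \<mu> = fact d * \<alpha> ^ d /
     (\<Prod>(i, j)\<in>boxes \<mu>.
        (\<alpha> * (real (row_length \<mu> i) - real j) + (real (col_length \<mu> j) - real i) + 1) *
        (\<alpha> * (real (row_length \<mu> i) - real j) + (real (col_length \<mu> j) - real i) + \<alpha>))"

section \<open>Bessel functions of real order\<close>

text \<open>
  \<open>rGamma\<close> is the entire function extending \<open>1 / Gamma\<close>, so it vanishes at the poles of
  \<open>Gamma\<close>.  Because of \<open>powr\<close>, the definition is meaningful for \<open>x > 0\<close> only.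
\<close>

definition bessel_J :: "real \<Rightarrow> real \<Rightarrow> real" where
  "bessel_J \<nu> x =
     (\<Sum>m. (- 1) ^ m / fact m * rGamma (real m + \<nu> + 1) * (x / 2) powr (2 * real m + \<nu>))"

section \<open>Profiles\<close>

definition scaled_diagram :: "real \<Rightarrow> real \<Rightarrow> nat list \<Rightarrow> (real \<times> real) set" where
  "scaled_diagram w h \<mu> =
     (\<Union>(i, j)\<in>boxes \<mu>. {(real j - 1) * w .. real j * w} \<times> {(real i - 1) * h .. real i * h})"

text \<open>
  The frontier of the part of the quadrant not covered by the diagram consists of the outer
  boundary of the diagram (not its sides lying on the axes) and of the remaining parts of
  the two half-axes.
\<close>

definition boundary_curve :: "real \<Rightarrow> real \<Rightarrow> nat list \<Rightarrow> (real \<times> real) set" where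
  "boundary_curve w h \<mu> = frontier (({0..} \<times> {0..}) - scaled_diagram w h \<mu>)"

definition profile :: "real \<Rightarrow> real \<Rightarrow> nat list \<Rightarrow> real \<Rightarrow> real" where
  "profile w h \<mu> = (THE f. boundary_curve w h \<mu> = {(x, y). x + y = f (x - y)})"

section \<open>Modes of convergence\<close>

definition tendsto_in_prob :: "(nat \<Rightarrow> 'a measure) \<Rightarrow> (nat \<Rightarrow> 'a \<Rightarrow> real) \<Rightarrow> real \<Rightarrow> bool" where
  "tendsto_in_prob M X c \<longleftrightarrow>
     (\<forall>\<epsilon>>0. (\<lambda>d. measure (M d) {s \<in> space (M d). \<bar>X d s - c\<bar> > \<epsilon>}) \<longlonglongrightarrow> 0)"

text \<open>The supremum is taken in \<open>ereal\<close>, so that it is meaningful for unbounded differences.\<close>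

definition sup_tendsto_in_prob ::
  "(nat \<Rightarrow> 'a measure) \<Rightarrow> (nat \<Rightarrow> 'a \<Rightarrow> real \<Rightarrow> real) \<Rightarrow> (real \<Rightarrow> real) \<Rightarrow> bool" where
  "sup_tendsto_in_prob M F f \<longleftrightarrow>
     (\<forall>\<epsilon>>0. (\<lambda>d. measure (M d)
        {s \<in> space (M d). (SUP x. ereal \<bar>F d s x - f x\<bar>) > ereal \<epsilon>}) \<longlonglongrightarrow> 0)"

definition is_limit_shape ::
  "(nat \<Rightarrow> real) \<Rightarrow> (nat \<Rightarrow> 'a measure) \<Rightarrow> (nat \<Rightarrow> 'a \<Rightarrow> nat list) \<Rightarrow> (real \<Rightarrow> real) \<Rightarrow> bool" where
  "is_limit_shape \<alpha> M L \<omega> \<longleftrightarrow>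
     sup_tendsto_in_prob M
       (\<lambda>d s. profile (sqrt (\<alpha> d / real d)) (1 / sqrt (\<alpha> d * real d)) (L d s)) \<omega>"

section \<open>Profiles are well defined\<close>

lemma row_length_antimono:
  assumes "\<mu> \<in> young_diagrams d" "1 \<le> i'" "i' \<le> i"
  shows "row_length \<mu> i \<le> row_length \<mu> i'"
proof (cases "i \<le> length \<mu>")
  case True
  have s: "sorted_wrt (\<ge>) \<mu>" using assms(1) by (simp add: young_diagrams_def)
  show ?thesis
  proof (cases "i' = i")
    case False
    then have "\<mu> ! (i' - 1) \<ge> \<mu> ! (i - 1)"
      using True assms(2,3) by (intro sorted_wrt_nth_less[OF s]) auto
    then show ?thesis using True assms(2,3) by (simp add: row_length_def)
  qed simp
qed (simp add: row_length_def)

lemma finite_boxes: "finite (boxes \<mu>)"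
proof (rule finite_subset)
  show "boxes \<mu> \<subseteq> {..length \<mu>} \<times> (\<Union>i\<le>length \<mu>. {..row_length \<mu> i})"
    by (auto simp: boxes_def)
qed auto

lemma box_of_coord:
  assumes "(w::real) > 0" "0 \<le> x" "x \<le> real j * w" "1 \<le> j"
  obtains j' where "1 \<le> j'" "j' \<le> j" "(real j' - 1) * w \<le> x" "x \<le> real j' * w"
proof -
  define j' where "j' = (LEAST k. 1 \<le> k \<and> x \<le> real k * w)"
  have j': "1 \<le> j' \<and> x \<le> real j' * w"
    unfolding j'_def by (rule LeastI[of _ j]) (use assms in auto)
  have le: "j' \<le> j"
    unfolding j'_def by (rule Least_le) (use assms in auto)
  have "(real j' - 1) * w \<le> x"
  proof (cases "j' = 1")
    case False
    then have "\<not> (1 \<le> j' - 1 \<and> x \<le> real (j' - 1) * w)"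
      using j' unfolding j'_def by (intro not_less_Least) (auto simp: j'_def)
    then show ?thesis using False j' by (auto simp: of_nat_diff)
  qed (use assms in auto)
  with j' le that show thesis by blast
qed

lemma scaled_diagram_lower:
  assumes "\<mu> \<in> young_diagrams d" "w > 0" "h > 0"
    and "(x, y) \<in> scaled_diagram w h \<mu>" "0 \<le> x'" "x' \<le> x" "0 \<le> y'" "y' \<le> y"
  shows "(x', y') \<in> scaled_diagram w h \<mu>"
proof -
  from assms(4) obtain i j where ij: "(i, j) \<in> boxes \<mu>" "x \<le> real j * w" "y \<le> real i * h"
    by (auto simp: scaled_diagram_def)
  from ij(1) have b: "1 \<le> i" "i \<le> length \<mu>" "1 \<le> j" "j \<le> row_length \<mu> i" by (auto simp: boxes_def)
  obtain j' where j': "1 \<le> j'" "j' \<le> j" "(real j' - 1) * w \<le> x'" "x' \<le> real j' * w"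
    using box_of_coord[of w x' j] assms ij b by (metis order_trans)
  obtain i' where i': "1 \<le> i'" "i' \<le> i" "(real i' - 1) * h \<le> y'" "y' \<le> real i' * h"
    using box_of_coord[of h y' i] assms ij b by (metis order_trans)
  have "(i', j') \<in> boxes \<mu>"
    using row_length_antimono[OF assms(1) i'(1,2)] b i' j' by (auto simp: boxes_def)
  with i' j' show ?thesis by (force simp: scaled_diagram_def)
qed

lemma scaled_diagram_bounded: "bounded (scaled_diagram w h \<mu>)"
  unfolding scaled_diagram_def
  by (rule bounded_UN) (auto simp: finite_boxes intro!: bounded_Times)

lemma frontier_upper_set_is_graph:
  fixes A :: "(real \<times> real) set"
  assumes up: "\<And>x y x' y'. (x, y) \<in> A \<Longrightarrow> x \<le> x' \<Longrightarrow> y \<le> y' \<Longrightarrow> (x', y') \<in> A"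
    and pos: "A \<subseteq> {0..} \<times> {0..}"
    and far: "\<And>u. \<exists>t. ((t + u) / 2, (t - u) / 2) \<in> A"
  shows "\<exists>!f. frontier A = {(x, y). x + y = f (x - y)}"
proof -
  define P where "P = (\<lambda>u t. ((t + u) / 2, (t - u) / 2) :: real \<times> real)"
  define S where "S = (\<lambda>u. {t. P u t \<in> closure A})"
  define f where "f = (\<lambda>u. Inf (S u))"
  have ne: "S u \<noteq> {}" for u
    using far[of u] closure_subset by (auto simp: S_def P_def)
  have clpos: "closure A \<subseteq> {0..} \<times> {0..}"
    using pos by (intro closure_minimal) (auto intro: closed_Times)
  have bdd: "bdd_below (S u)" for u
    by (rule bdd_belowI[of _ "- \<bar>u\<bar>"]) (use clpos in \<open>auto simp: S_def P_def\<close>)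
  have cont: "continuous_on UNIV (P u)" for u
    unfolding P_def by (intro continuous_intros) auto
  have closedS: "closed (S u)" for u
    using closed_vimage[OF closed_closure cont] by (simp add: S_def vimage_def)
  have inS: "f u \<in> S u" for u
    unfolding f_def by (rule closed_contains_Inf[OF ne bdd closedS])
  have int: "(x', y') \<in> interior A" if "(x, y) \<in> closure A" "x < x'" "y < y'" for x y x' y'
  proof -
    have "open ({..<x'} \<times> {..<y'})" by (intro open_Times) auto
    from open_Int_closure_eq_empty[OF this, of A] that
    have "{..<x'} \<times> {..<y'} \<inter> A \<noteq> {}" by blast
    then obtain a b where ab: "(a, b) \<in> A" "a < x'" "b < y'" by auto
    have "{a<..} \<times> {b<..} \<subseteq> A"
    proof
      fix p assume "p \<in> {a<..} \<times> {b<..}"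
      then show "p \<in> A" using up[OF ab(1), of "fst p" "snd p"] by (cases p) simp
    qed
    then have "{a<..} \<times> {b<..} \<subseteq> interior A"
      by (intro interior_maximal open_Times) auto
    with ab show ?thesis by auto
  qed
  have key: "P u t \<in> frontier A \<longleftrightarrow> t = f u" for u t
  proof
    assume fr: "P u t \<in> frontier A"
    then have "t \<in> S u" by (simp add: S_def frontier_def)
    then have "f u \<le> t" unfolding f_def by (rule cInf_lower[OF _ bdd])
    moreover have "\<not> f u < t"
      using int[of "(f u + u) / 2" "(f u - u) / 2" "(t + u) / 2" "(t - u) / 2"] inS[of u] fr
      by (auto simp: S_def P_def frontier_def)
    ultimately show "t = f u" by simp
  next
    assume t: "t = f u"
    have "P u t \<notin> interior A"
    proof
      assume "P u t \<in> interior A"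
      moreover have "open (P u -` interior A)" by (rule open_vimage[OF open_interior cont])
      ultimately obtain e where e: "e > 0" "ball t e \<subseteq> P u -` interior A"
        by (meson open_contains_ball vimageI2)
      have "t - e / 2 \<in> ball t e" using e(1) by (simp add: dist_real_def)
      with e(2) have "P u (t - e / 2) \<in> interior A" by blast
      then have "t - e / 2 \<in> S u"
        unfolding S_def using interior_subset[of A] closure_subset[of A] by blast
      then have "f u \<le> t - e / 2" unfolding f_def by (rule cInf_lower[OF _ bdd])
      with e(1) t show False by simp
    qed
    with inS[of u] t show "P u t \<in> frontier A" by (auto simp: S_def frontier_def)
  qed
  have PP: "(x, y) = P (x - y) (x + y)" for x y by (simp add: P_def)
  show ?thesis
  proof (rule ex1I[of _ f])
    show "frontier A = {(x, y). x + y = f (x - y)}"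
    proof (rule set_eqI)
      fix p :: "real \<times> real"
      show "p \<in> frontier A \<longleftrightarrow> p \<in> {(x, y). x + y = f (x - y)}"
        using key[of "fst p - snd p" "fst p + snd p"]
        unfolding PP[of "fst p" "snd p", symmetric] by (cases p) simp
    qed
  next
    fix k assume k: "frontier A = {(x, y). x + y = k (x - y)}"
    show "k = f"
    proof
      fix u
      have "P u (k u) \<in> frontier A" unfolding k by (simp add: P_def field_simps flip: diff_divide_distrib add_divide_distrib)
      with key show "k u = f u" by simp
    qed
  qed
qed

lemma profile_well_defined:
  assumes "\<mu> \<in> young_diagrams d" "w > 0" "h > 0"
  shows "\<exists>!f. boundary_curve w h \<mu> = {(x, y). x + y = f (x - y)}"
  unfolding boundary_curve_def
proof (rule frontier_upper_set_is_graph)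
  fix x y x' y' :: real
  assume "(x, y) \<in> {0..} \<times> {0..} - scaled_diagram w h \<mu>" "x \<le> x'" "y \<le> y'"
  then show "(x', y') \<in> {0..} \<times> {0..} - scaled_diagram w h \<mu>"
    using scaled_diagram_lower[OF assms, of x' y' x y] by auto
next
  fix u :: real
  obtain B where B: "\<And>p. p \<in> scaled_diagram w h \<mu> \<Longrightarrow> norm p \<le> B"
    using scaled_diagram_bounded[of w h \<mu>] by (auto simp: bounded_iff)
  define t where "t = 2 * \<bar>B\<bar> + \<bar>u\<bar> + 2"
  have "norm ((t + u) / 2, (t - u) / 2) \<ge> \<bar>(t + u) / 2\<bar>"
    using norm_fst_le[of "(t + u) / 2" "(t - u) / 2"] by simp
  moreover have "\<bar>(t + u) / 2\<bar> > B" by (auto simp: t_def)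
  ultimately have "((t + u) / 2, (t - u) / 2) \<notin> scaled_diagram w h \<mu>" using B by fastforce
  then show "\<exists>t. ((t + u) / 2, (t - u) / 2) \<in> {0..} \<times> {0..} - scaled_diagram w h \<mu>"
    by (intro exI[of _ t]) (auto simp: t_def)
qed auto

end

theory Submission
  imports Defs
begin

text \<open>
  Number the rows \<open>r 0, r 1, \<dots>\<close> from 0, let \<open>x k = \<alpha> * r k - k\<close> be the content of the box that can be
  added to row \<open>k\<close>, and put \<open>f y = \<Prod>k. (y - x k) / (y + k)\<close>.  The Jack--Plancherel measures are the
  marginals of a growth process whose transition probabilities are the residues of
  \<open>\<Prod>k. (z - x k + 1) / (z - x k)\<close>.  Hence one growth step replaces the mean of \<open>f y\<close> by that of
  \<open>f y - \<alpha> / y * f (y + 1)\<close>, exactly, so that the mean of \<open>f y\<close> after \<open>d\<close> steps is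
  \<open>\<Sum>m. (d choose m) * (- \<alpha>) ^ m / pochhammer y m\<close>, which tends to a Bessel series.  The covariances of
  \<open>f y\<close> and \<open>f z\<close> obey the same recursion up to an error \<open>O(\<alpha>\<^sup>2)\<close> per step and are therefore \<open>O(\<alpha>)\<close>,
  so \<open>f y\<close> concentrates at each non-integer \<open>y\<close>.  The points \<open>x k\<close> are the zeros of the entire function
  \<open>rGamma y * f y\<close>; two-sided product bounds show that along subsequences they converge exactly to the
  zeros of the limiting Bessel function, which determines the limits of all the rows.
\<close>

subsection \<open>Lagrange interpolation and power sums of roots\<close>

text \<open>\<open>f y\<close> is affine in each content, and a box added to row \<open>k\<close>
  moves \<open>x k\<close> by \<alpha>; so \<open>f y\<close> loses exactly \<alpha> / (y + k) times
  the product of the other factors. Averaged over \<open>k\<close>, these losses form a Lagrange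
  interpolation of the numerator of the transition function. That is why the recursion for the mean
  closes on \<open>f\<close> itself. Its price is the shift from \<open>y\<close> to
  \<open>y + 1\<close>: all estimates are made uniform along \<open>y, y + 1, ...\<close> through
  one lower bound \<delta> for the distances \<open>\<bar>y + k\<bar>\<close>, hence the restriction
  to non-integers.

  The obstacle is the passage from values to zeros: concentration speaks of one point at a time,
  while the rows are all the zeros together. Therefore events of non-vanishing mass are traded for
  deterministic sequences of diagrams whose values are nearly right at more and more points and
  whose rescaled rows converge. In the limit the modulus is comparable to a finite product times a
  positive factor, which does on the real line the work of Hurwitz' theorem. Contents have gaps of
  at least 1, so no multiplicities occur and the set of zeros determines the rows.\<close>

lemma degree_prod_linear:
  fixes x :: "'i \<Rightarrow> 'a::field"
  shows "degree (\<Prod>k\<in>I. [:- x k, 1:]) = card I"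
  by (subst degree_prod_eq_sum_degree) auto

lemma coeff_prod_linear_card:
  fixes x :: "'i \<Rightarrow> 'a::field"
  shows "coeff (\<Prod>k\<in>I. [:- x k, 1:]) (card I) = 1"
  using lead_coeff_prod[of "\<lambda>k. [:- x k, 1:]" I] by (simp add: degree_prod_linear)

text \<open>Both sides have degree below \<open>card I\<close> and agree at the
  \<open>card I\<close> distinct nodes. The weights are the residues of \<open>Q\<close> over the
  product of the \<open>z - x k\<close>, so this is a partial fraction expansion with denominators
  cleared.\<close>

lemma lagrange_interpolation:
  fixes x :: "'i \<Rightarrow> 'a::field"
  assumes fin: "finite I" and inj: "inj_on x I" and deg: "degree Q < card I"
  shows "Q = (\<Sum>i\<in>I. smult (poly Q (x i) / (\<Prod>k\<in>I-{i}. x i - x k))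
               (\<Prod>k\<in>I-{i}. [:- x k, 1:]))" (is "_ = ?L")
proof (rule poly_eqI_degree[where A = "x ` I"])
  show "poly Q a = poly ?L a" if "a \<in> x ` I" for a
  proof -
    from that obtain j where j: "j \<in> I" "a = x j" by blast
    have ne: "(\<Prod>k\<in>I-{j}. x j - x k) \<noteq> 0"
      using inj j fin by (auto simp: inj_on_def)
    have "poly ?L a = (\<Sum>i\<in>I. poly Q (x i) / (\<Prod>k\<in>I-{i}. x i - x k) * (\<Prod>k\<in>I-{i}. x j - x k))"
      by (simp add: poly_sum poly_prod j)
    also have "\<dots> = (\<Sum>i\<in>I. if i = j then poly Q (x j) else 0)"
    proof (rule sum.cong)
      fix i assume "i \<in> I"
      show "poly Q (x i) / (\<Prod>k\<in>I-{i}. x i - x k) * (\<Prod>k\<in>I-{i}. x j - x k) =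
            (if i = j then poly Q (x j) else 0)"
      proof (cases "i = j")
        case False
        then have "(\<Prod>k\<in>I-{i}. x j - x k) = 0" using fin j by (intro prod_zero) auto
        with False show ?thesis by simp
      qed (use ne in simp)
    qed simp
    finally show ?thesis using fin j by simp
  qed
  show "degree Q < card (x ` I)" using deg inj by (simp add: card_image)
  have "degree ?L \<le> card I - 1"
    by (intro degree_sum_le fin order.trans[OF degree_smult_le])
       (simp add: degree_prod_linear fin)
  then show "degree ?L < card (x ` I)" using deg inj by (simp add: card_image)
qed

text \<open>The basis polynomials in Lagrange's formula are all monic of degree
  \<open>card I - 1\<close>, so comparing coefficients in that degree suffices. In residue language,
  the finite residues balance the one at infinity.\<close>

lemma sum_divided_difference:
  fixes x :: "'i \<Rightarrow> 'a::field"
  assumes fin: "finite I" and inj: "inj_on x I" and deg: "degree Q < card I"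
  shows "(\<Sum>i\<in>I. poly Q (x i) / (\<Prod>k\<in>I-{i}. x i - x k)) = coeff Q (card I - 1)"
proof -
  have "coeff (\<Prod>k\<in>I-{i}. [:- x k, 1:]) (card I - 1) = 1" if "i \<in> I" for i
    using coeff_prod_linear_card[of x "I - {i}"] that fin by simp
  then show ?thesis
    by (subst (2) lagrange_interpolation[OF assms]) (simp add: coeff_sum)
qed

text \<open>With reversed linear factors the relevant coefficients stay at positions 0, 1, 2 while
  \<open>n\<close> grows, so a plain induction applies. The last one is the second elementary
  symmetric function in Newton's form.\<close>

lemma coeff_reversed_prod:
  fixes a :: "nat \<Rightarrow> 'a::field_char_0"
  defines "p \<equiv> \<lambda>n. \<Prod>k<n. [:1, - a k:]"
  shows "coeff (p n) 0 = 1" and "coeff (p n) 1 = - (\<Sum>k<n. a k)"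
    and "coeff (p n) 2 = ((\<Sum>k<n. a k)\<^sup>2 - (\<Sum>k<n. (a k)\<^sup>2)) / 2"
proof -
  have S: "p (Suc n) = p n * [:1, - a n:]" for n by (simp add: p_def)
  have c: "coeff (q * [:1, - b:]) (Suc j) = coeff q (Suc j) - b * coeff q j"
    "coeff (q * [:1, - b:]) 0 = coeff q 0" for q and b :: 'a and j
    by (simp_all add: coeff_pCons)
  show c0: "coeff (p n) 0 = 1" for n
    by (induction n) (simp_all add: S c p_def)
  show c1: "coeff (p n) 1 = - (\<Sum>k<n. a k)" for n
    by (induction n) (simp_all add: S c c0, simp add: p_def)
  show "coeff (p n) 2 = ((\<Sum>k<n. a k)\<^sup>2 - (\<Sum>k<n. (a k)\<^sup>2)) / 2"
  proof (induction n)
    case (Suc n)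
    show ?case using Suc c1[of n]
      by (simp add: S c numeral_2_eq_2) (simp add: field_simps power2_eq_square)
  qed (simp add: p_def)
qed

lemma coeff_prod_linear_top:
  fixes a :: "nat \<Rightarrow> 'a::field_char_0"
  defines "p \<equiv> \<lambda>n. \<Prod>k<n. [:- a k, 1:]"
  shows "n \<ge> 1 \<Longrightarrow> coeff (p n) (n - 1) = - (\<Sum>k<n. a k)"
    and "n \<ge> 2 \<Longrightarrow> coeff (p n) (n - 2) = ((\<Sum>k<n. a k)\<^sup>2 - (\<Sum>k<n. (a k)\<^sup>2)) / 2"
proof -
  have d: "degree (p n) = n" using degree_prod_linear[of a "{..<n}"] by (simp add: p_def)
  have "reflect_poly [:- b, 1:] = [:1, - b:]" for b :: 'a
    by (rule poly_eqI) (auto simp: coeff_reflect_poly coeff_pCons split: nat.splits)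
  then have r: "reflect_poly (p n) = (\<Prod>k<n. [:1, - a k:])"
    by (simp add: p_def reflect_poly_prod)
  have "coeff (p n) (n - j) = coeff (\<Prod>k<n. [:1, - a k:]) j" if "j \<le> n" for j
    using that by (simp add: r[symmetric] coeff_reflect_poly d)
  then show "n \<ge> 1 \<Longrightarrow> coeff (p n) (n - 1) = - (\<Sum>k<n. a k)"
    and "n \<ge> 2 \<Longrightarrow> coeff (p n) (n - 2) = ((\<Sum>k<n. a k)\<^sup>2 - (\<Sum>k<n. (a k)\<^sup>2)) / 2"
    by (simp_all only: coeff_reversed_prod)
qed

subsection \<open>Transition probabilities\<close>

definition jcontent :: "real \<Rightarrow> (nat \<Rightarrow> nat) \<Rightarrow> nat \<Rightarrow> real" where
  "jcontent \<alpha> r i = \<alpha> * real (r i) - real i"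

text \<open>\<open>N\<close> is any bound on the number of rows.  A row that cannot be lengthened is as long as the one above
  it, so its content is smaller by one and the numerator of \<open>up_prob\<close> vanishes; no separate treatment
  of equal rows is needed.\<close>

definition up_prob :: "real \<Rightarrow> nat \<Rightarrow> (nat \<Rightarrow> nat) \<Rightarrow> nat \<Rightarrow> real" where
  "up_prob \<alpha> N r i = (\<Prod>k<N. jcontent \<alpha> r i - jcontent \<alpha> r k + 1) /
     (\<Prod>k\<in>{..N}-{i}. jcontent \<alpha> r i - jcontent \<alpha> r k)"

text \<open>Up to sign, the residue at \<open>z = jcontent \<alpha> r i\<close> of the product of
  \<open>z - jcontent \<alpha> r k - 1\<close> over \<open>k \<le> N\<close>, divided by the product
  of \<open>z - jcontent \<alpha> r k\<close> over \<open>k < N\<close>. Divided by \<alpha> times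
  the number of boxes, it turns out to be the probability that row \<open>i\<close> received the
  last box. The products have different lengths, as in \<open>up_prob\<close>, so that one more
  empty row multiplies numerator and denominator by the same factor.\<close>

definition down_weight :: "real \<Rightarrow> nat \<Rightarrow> (nat \<Rightarrow> nat) \<Rightarrow> nat \<Rightarrow> real" where
  "down_weight \<alpha> N r i = (\<Prod>k\<in>{..N}-{i}. jcontent \<alpha> r i - jcontent \<alpha> r k - 1) /
     (\<Prod>k\<in>{..<N}-{i}. jcontent \<alpha> r i - jcontent \<alpha> r k)"

definition add_box :: "(nat \<Rightarrow> nat) \<Rightarrow> nat \<Rightarrow> nat \<Rightarrow> nat" where
  "add_box r i = r(i := Suc (r i))"

text \<open>The denominator is the numerator for the empty diagram: away from the points
  \<open>- k\<close>, empty rows contribute the factor 1 and the value does not depend on the row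
  bound.\<close>

definition char_ratio :: "real \<Rightarrow> nat \<Rightarrow> (nat \<Rightarrow> nat) \<Rightarrow> real \<Rightarrow> real" where
  "char_ratio \<alpha> N r y = (\<Prod>k\<le>N. y - jcontent \<alpha> r k) / (\<Prod>k\<le>N. y + real k)"

text \<open>The quotient of \<open>char_ratio\<close> by \<open>y - jcontent \<alpha> r i\<close>,
  in a form that makes sense when this factor vanishes.\<close>

definition char_ratio_omit :: "real \<Rightarrow> nat \<Rightarrow> (nat \<Rightarrow> nat) \<Rightarrow> nat \<Rightarrow> real \<Rightarrow> real" where
  "char_ratio_omit \<alpha> N r i y = (\<Prod>k\<in>{..N}-{i}. y - jcontent \<alpha> r k) / (\<Prod>k\<le>N. y + real k)"

lemma jcontent_gap:
  assumes "\<alpha> > 0" "antimono r" "i \<le> j"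
  shows "jcontent \<alpha> r i - jcontent \<alpha> r j \<ge> real j - real i"
proof -
  have "\<alpha> * real (r j) \<le> \<alpha> * real (r i)"
    using assms by (intro mult_left_mono) (auto simp: antimono_def)
  then show ?thesis by (simp add: jcontent_def)
qed

lemma jcontent_less:
  assumes "\<alpha> > 0" "antimono r" "i < j"
  shows "jcontent \<alpha> r j < jcontent \<alpha> r i"
  using jcontent_gap[of \<alpha> r i j] assms by simp

lemma inj_on_jcontent:
  assumes "\<alpha> > 0" "antimono r"
  shows "inj_on (jcontent \<alpha> r) A"
  by (rule linorder_inj_onI') (use jcontent_less[OF assms] in force)

lemma up_prob_eq_divided_difference:
  "up_prob \<alpha> N r i = poly (\<Prod>k<N. [:- (jcontent \<alpha> r k - 1), 1:]) (jcontent \<alpha> r i) /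
     (\<Prod>k\<in>{..N}-{i}. jcontent \<alpha> r i - jcontent \<alpha> r k)"
  by (simp add: up_prob_def poly_prod algebra_simps)

lemma sum_up_prob:
  assumes "\<alpha> > 0" "antimono r"
  shows "(\<Sum>i\<le>N. up_prob \<alpha> N r i) = 1"
  unfolding up_prob_eq_divided_difference
  by (subst sum_divided_difference[OF _ inj_on_jcontent[OF assms]])
     (use degree_prod_linear[of "\<lambda>k. jcontent \<alpha> r k - 1" "{..<N}"]
          coeff_prod_linear_card[of "\<lambda>k. jcontent \<alpha> r k - 1" "{..<N}"] in simp_all)

text \<open>Factors with the same \<open>k\<close> are paired. For \<open>k < i\<close> the gap of
  at least 1 makes numerator and denominator nonpositive, for \<open>k > i\<close> both are
  positive; the unpaired denominator factor \<open>k = N\<close> is positive if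
  \<open>i < N\<close>.\<close>

lemma up_prob_nonneg:
  assumes "\<alpha> > 0" "antimono r" "i \<le> N"
  shows "up_prob \<alpha> N r i \<ge> 0"
proof -
  let ?c = "jcontent \<alpha> r"
  have neg: "?c i - ?c k + 1 \<le> 0" "?c i - ?c k < 0" if "k < i" for k
    using jcontent_gap[OF assms(1,2), of k i] that by auto
  have pos: "?c i - ?c k + 1 > 0" "?c i - ?c k > 0" if "k > i" for k
    using jcontent_less[OF assms(1,2) that] by auto
  have "0 \<le> (\<Prod>k\<in>{..<N}-{i}. (?c i - ?c k + 1) / (?c i - ?c k))"
  proof (rule prod_nonneg)
    fix k assume "k \<in> {..<N} - {i}"
    then show "0 \<le> (?c i - ?c k + 1) / (?c i - ?c k)"
      using neg[of k] pos[of k] by (cases "k < i") (auto simp: divide_nonpos_neg)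
  qed
  also have "\<dots> = (\<Prod>k\<in>{..<N}-{i}. ?c i - ?c k + 1) / (\<Prod>k\<in>{..<N}-{i}. ?c i - ?c k)"
    by (rule prod_dividef)
  finally have *: "0 \<le> \<dots>" .
  show ?thesis
  proof (cases "i = N")
    case True
    then have "{..N} - {i} = {..<N} - {i}" "{..<N} - {i} = {..<N}" by auto
    with * show ?thesis by (simp add: up_prob_def)
  next
    case False
    then have "i < N" using assms by simp
    have n: "(\<Prod>k<N. ?c i - ?c k + 1) = (\<Prod>k\<in>{..<N}-{i}. ?c i - ?c k + 1)"
      using \<open>i < N\<close> by (subst prod.remove[of _ i]) auto
    have "{..N} - {i} = insert N ({..<N} - {i})" using \<open>i < N\<close> by auto
    then have d: "(\<Prod>k\<in>{..N}-{i}. ?c i - ?c k) = (?c i - ?c N) * (\<Prod>k\<in>{..<N}-{i}. ?c i - ?c k)"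
      by simp
    have "up_prob \<alpha> N r i = (\<Prod>k\<in>{..<N}-{i}. ?c i - ?c k + 1) / (\<Prod>k\<in>{..<N}-{i}. ?c i - ?c k) / (?c i - ?c N)"
      by (simp add: up_prob_def n d)
    then show ?thesis
      using * pos(2)[OF \<open>i < N\<close>] by (simp only: divide_nonneg_pos)
  qed
qed

text \<open>The numerator is affine in each content, and only the content of row \<open>i\<close>
  moves, by \<alpha>; hence an exact identity without higher order terms.\<close>

lemma char_ratio_add_box:
  assumes "i \<le> N"
  shows "char_ratio \<alpha> N (add_box r i) y = char_ratio \<alpha> N r y - \<alpha> * char_ratio_omit \<alpha> N r i y"
proof -
  have c: "jcontent \<alpha> (add_box r i) k = (if k = i then jcontent \<alpha> r i + \<alpha> else jcontent \<alpha> r k)" for k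
    by (simp add: jcontent_def add_box_def algebra_simps)
  have s: "(\<Prod>k\<le>N. h k) = h i * (\<Prod>k\<in>{..N}-{i}. h k)" for h :: "nat \<Rightarrow> real"
    using assms by (subst prod.remove[of _ i]) auto
  have "(\<Prod>k\<in>{..N}-{i}. y - jcontent \<alpha> (add_box r i) k) = (\<Prod>k\<in>{..N}-{i}. y - jcontent \<alpha> r k)"
    by (rule prod.cong) (auto simp: c)
  then have "(\<Prod>k\<le>N. y - jcontent \<alpha> (add_box r i) k) =
      (\<Prod>k\<le>N. y - jcontent \<alpha> r k) - \<alpha> * (\<Prod>k\<in>{..N}-{i}. y - jcontent \<alpha> r k)"
    unfolding s[of "\<lambda>k. y - jcontent \<alpha> _ k"] by (simp add: c algebra_simps)
  then show ?thesis by (simp add: char_ratio_def char_ratio_omit_def diff_divide_distrib)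
qed

text \<open>Lagrange interpolation of the numerator of \<open>up_prob\<close>, evaluated at
  \<open>y\<close> instead of at a content. That numerator is a product of factors
  \<open>y + 1 - jcontent \<alpha> r k\<close>, which is the origin of the shift to
  \<open>y + 1\<close>.\<close>

lemma sum_up_prob_omit:
  assumes "\<alpha> > 0" "antimono r" "r N = 0" and y: "y + 1 + real N \<noteq> 0"
  shows "(\<Sum>i\<le>N. up_prob \<alpha> N r i * char_ratio_omit \<alpha> N r i y) = char_ratio \<alpha> N r (y + 1) / y"
proof -
  let ?c = "jcontent \<alpha> r"
  let ?Q = "\<Prod>k<N. [:- (?c k - 1), 1:]"
  have "poly ?Q y = (\<Sum>i\<le>N. up_prob \<alpha> N r i * (\<Prod>k\<in>{..N}-{i}. y - ?c k))"
    unfolding up_prob_eq_divided_difference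
    by (subst lagrange_interpolation[OF _ inj_on_jcontent[OF assms(1,2)], of "{..N}" ?Q])
       (use degree_prod_linear[of "\<lambda>k. ?c k - 1" "{..<N}"] in \<open>simp_all add: poly_sum poly_prod\<close>)
  then have "(\<Sum>i\<le>N. up_prob \<alpha> N r i * char_ratio_omit \<alpha> N r i y) = poly ?Q y / (\<Prod>k\<le>N. y + real k)"
    by (simp add: char_ratio_omit_def sum_divide_distrib)
  also have "poly ?Q y = (\<Prod>k<N. y + 1 - ?c k)" by (simp add: poly_prod algebra_simps)
  also have "(\<Prod>k\<le>N. y + real k) = y * (\<Prod>k<N. y + 1 + real k)"
    by (subst lessThan_Suc_atMost[symmetric], subst prod.lessThan_Suc_shift) (simp add: algebra_simps)
  \<comment> \<open>The factor \<open>k = N\<close> absent on the left is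
    \<open>(y + 1 + N) / (y + 1 + N)\<close>, because row \<open>N\<close> is empty.\<close>
  also have "(\<Prod>k<N. y + 1 - ?c k) / (y * (\<Prod>k<N. y + 1 + real k)) = char_ratio \<alpha> N r (y + 1) / y"
    using y assms(3) by (simp add: char_ratio_def lessThan_Suc_atMost[symmetric] jcontent_def)
  finally show ?thesis .
qed

text \<open>Up to sign a sum of divided differences of \<open>R\<close>, whose degree
  \<open>N + 1\<close> is too large for \<open>N\<close> nodes. Subtracting a multiple of
  \<open>T\<close>, which vanishes at the nodes, leaves \<open>D\<close> of degree below
  \<open>N\<close>. In its coefficient of degree \<open>N - 1\<close> the quadratic terms cancel and
  only the total content is left.\<close>

lemma sum_down_weight:
  assumes "\<alpha> > 0" "antimono r" "r N = 0" and N: "N \<ge> 2"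
  shows "(\<Sum>i<N. down_weight \<alpha> N r i) = \<alpha> * (\<Sum>k<N. real (r k))"
proof -
  let ?c = "jcontent \<alpha> r"
  define T where "T = (\<Prod>k<N. [:- ?c k, 1:])"
  define R where "R = (\<Prod>k<Suc N. [:- (?c k + 1), 1:])"
  \<comment> \<open>\<open>[:-1, 1:]\<close> is the polynomial part of \<open>R / T\<close>: both
    are monic, and their roots sum to \<open>b + 1\<close> and to \<open>b\<close>.\<close>
  define D where "D = R - [:-1, 1:] * T"
  have cN: "?c N = - real N" by (simp add: jcontent_def assms)
  define b where "b = (\<Sum>k<N. ?c k)"
  define b2 where "b2 = (\<Sum>k<N. (?c k)\<^sup>2)"
  have sA: "(\<Sum>k<Suc N. ?c k + 1) = b + 1"
    by (simp add: sum.distrib cN b_def)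
  have sA2: "(\<Sum>k<Suc N. (?c k + 1)\<^sup>2) = b2 + 2 * b + N + (1 - real N)\<^sup>2"
    by (simp add: power2_eq_square sum.distrib cN b_def b2_def algebra_simps sum_distrib_left)
  have dT: "degree T = N" using degree_prod_linear[of ?c "{..<N}"] by (simp add: T_def)
  have dR: "degree R = Suc N"
    using degree_prod_linear[of "\<lambda>k. ?c k + 1" "{..<Suc N}"] by (simp add: R_def del: prod.lessThan_Suc)
  have TN: "coeff T N = 1" using coeff_prod_linear_card[of ?c "{..<N}"] by (simp add: T_def)
  have RN: "coeff R (Suc N) = 1"
    using coeff_prod_linear_card[of "\<lambda>k. ?c k + 1" "{..<Suc N}"]
    by (simp add: R_def del: prod.lessThan_Suc)
  have T1: "coeff T (N - 1) = - b" and T2: "coeff T (N - 2) = (b\<^sup>2 - b2) / 2"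
    unfolding T_def b_def b2_def using N by (intro coeff_prod_linear_top; simp)+
  have R1: "coeff R N = - (b + 1)"
    using coeff_prod_linear_top(1)[of "Suc N" "\<lambda>k. ?c k + 1"] by (simp only: R_def sA) simp
  have R2: "coeff R (N - 1) = ((b + 1)\<^sup>2 - (b2 + 2 * b + N + (1 - real N)\<^sup>2)) / 2"
    using coeff_prod_linear_top(2)[of "Suc N" "\<lambda>k. ?c k + 1"] N
    by (simp only: R_def sA sA2) (simp add: numeral_2_eq_2)
  have cS: "coeff ([:-1, 1:] * T) (Suc j) = coeff T j - coeff T (Suc j)" for j
    by (simp add: coeff_pCons)
  have "coeff D k = 0" if "k \<ge> N" for k
  proof -
    from that have "k = N \<or> k = Suc N \<or> k > Suc N" by arith
    then consider "k = N" | "k = Suc N" | "k > Suc N" by blast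
    then show ?thesis
    proof cases
      case 1
      have "coeff ([:-1, 1:] * T) N = - b - 1" using cS[of "N - 1"] N T1 TN by simp
      with 1 R1 show ?thesis by (simp add: D_def)
    next
      case 2
      have "coeff ([:-1, 1:] * T) (Suc N) = 1" using cS[of N] TN dT by (simp add: coeff_eq_0)
      with 2 RN show ?thesis by (simp add: D_def)
    next
      case 3
      then have "coeff ([:-1, 1:] * T) k = 0" using cS[of "k - 1"] dT by (simp add: coeff_eq_0)
      with 3 dR show ?thesis by (simp add: D_def coeff_eq_0)
    qed
  qed
  then have degD: "degree D < N" using N by (intro degree_lessI) auto
  have e: "down_weight \<alpha> N r i = - (poly D (?c i) / (\<Prod>k\<in>{..<N}-{i}. ?c i - ?c k))" if "i < N" for i
  proof -
    have "poly T (?c i) = 0" using that by (auto simp: T_def poly_prod)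
    then have "poly D (?c i) = (\<Prod>k\<le>N. ?c i - ?c k - 1)"
      by (simp add: D_def R_def poly_prod lessThan_Suc_atMost algebra_simps del: prod.lessThan_Suc)
    \<comment> \<open>The factor \<open>k = i\<close> equals \<open>- 1\<close>.\<close>
    also have "\<dots> = - (\<Prod>k\<in>{..N}-{i}. ?c i - ?c k - 1)"
      using that by (subst prod.remove[of _ i]) auto
    finally show ?thesis by (simp add: down_weight_def)
  qed
  have "(\<Sum>i<N. down_weight \<alpha> N r i) = - (\<Sum>i<N. poly D (?c i) / (\<Prod>k\<in>{..<N}-{i}. ?c i - ?c k))"
    by (simp add: e sum_negf)
  also have "\<dots> = - coeff D (N - 1)"
    by (subst sum_divided_difference[OF _ inj_on_jcontent[OF assms(1,2)]]) (use degD in auto)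
  finally have sD: "(\<Sum>i<N. down_weight \<alpha> N r i) = - coeff D (N - 1)" .
  have cT: "coeff ([:-1, 1:] * T) (N - 1) = (b\<^sup>2 - b2) / 2 + b"
    using cS[of "N - 2"] N T1 T2 by (simp add: numeral_2_eq_2 Suc_diff_Suc)
  have cD: "- coeff D (N - 1) = b + real N * (real N - 1) / 2"
    unfolding D_def coeff_diff R2 cT by (simp add: field_simps power2_eq_square)
  have "(\<Sum>k<n. real k) = real n * (real n - 1) / 2" for n
    by (induction n) (auto simp: field_simps)
  then have "b = \<alpha> * (\<Sum>k<N. real (r k)) - real N * (real N - 1) / 2"
    by (simp add: b_def jcontent_def sum_subtractf sum_distrib_left)
  with sD cD show ?thesis by simp
qed

subsection \<open>Hook products\<close>

text \<open>Diagrams as functions on all row indices: adding a box is a point update, and row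
  \<open>N\<close> exists for every \<open>N\<close>. A diagram with \<open>n\<close> boxes has at
  most \<open>n\<close> rows, hence the support condition.\<close>

definition row_functions :: "nat \<Rightarrow> (nat \<Rightarrow> nat) set" where
  "row_functions n = {r. antimono r \<and> (\<forall>i\<ge>n. r i = 0) \<and> sum r {..<n} = n}"

definition col_height :: "(nat \<Rightarrow> nat) \<Rightarrow> nat \<Rightarrow> nat" where
  "col_height r j = card {k. j \<le> r k}"

definition hook_weight :: "real \<Rightarrow> (nat \<Rightarrow> nat) \<Rightarrow> nat \<Rightarrow> nat \<Rightarrow> real" where
  "hook_weight \<alpha> r i j =
     (\<alpha> * (real (r i) - real j) + (real (col_height r j) - real (Suc i)) + 1) *
     (\<alpha> * (real (r i) - real j) + (real (col_height r j) - real (Suc i)) + \<alpha>)"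

definition hook_product :: "real \<Rightarrow> nat \<Rightarrow> (nat \<Rightarrow> nat) \<Rightarrow> real" where
  "hook_product \<alpha> N r = (\<Prod>i<N. \<Prod>j\<in>{1..r i}. hook_weight \<alpha> r i j)"

lemma col_height_eq:
  assumes "antimono r" "r k < j" "\<And>i. i < k \<Longrightarrow> j \<le> r i"
  shows "col_height r j = k"
proof -
  have "{i. j \<le> r i} = {..<k}"
  proof (intro set_eqI iffI)
    fix i assume "i \<in> {i. j \<le> r i}"
    then show "i \<in> {..<k}" using assms(2) antimonoD[OF assms(1), of k i] by (cases "i < k") auto
  qed (use assms(3) in auto)
  then show ?thesis by (simp add: col_height_def)
qed

lemma col_height_ge:
  assumes "antimono r" "j \<le> r i" "r N = 0" "1 \<le> j"
  shows "Suc i \<le> col_height r j"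
proof -
  have sub: "{k. j \<le> r k} \<subseteq> {..<N}"
    using assms antimonoD[OF assms(1), of N] by (force simp: not_less[symmetric])
  have "{..i} \<subseteq> {k. j \<le> r k}"
    using assms antimonoD[OF assms(1), of _ i] by (force intro: order_trans)
  then have "card {..i} \<le> card {k. j \<le> r k}"
    using sub by (intro card_mono) (auto intro: finite_subset)
  then show ?thesis by (simp add: col_height_def)
qed

lemma hook_weight_pos:
  assumes "\<alpha> > 0" "antimono r" "j \<le> r i" "r N = 0" "1 \<le> j"
  shows "hook_weight \<alpha> r i j > 0"
proof -
  have "\<alpha> * (real (r i) - real j) \<ge> 0" using assms by simp
  moreover have "real (col_height r j) \<ge> real (Suc i)"
    using col_height_ge[OF assms(2-5)] by (simp only: of_nat_le_iff)
  ultimately have "\<alpha> * (real (r i) - real j) + (real (col_height r j) - real (Suc i)) \<ge> 0"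
    by linarith
  then show ?thesis using assms(1) unfolding hook_weight_def by (intro mult_pos_pos) linarith+
qed

lemma hook_product_pos:
  assumes "\<alpha> > 0" "antimono r" "r N = 0"
  shows "hook_product \<alpha> N r > 0"
  unfolding hook_product_def by (intro prod_pos hook_weight_pos[OF assms(1,2) _ assms(3)]) auto

lemma hook_product_extend:
  assumes "\<And>i. i \<ge> n \<Longrightarrow> r i = 0" "n \<le> N"
  shows "hook_product \<alpha> N r = hook_product \<alpha> n r"
  unfolding hook_product_def
  by (rule prod.mono_neutral_right) (use assms in auto)

section \<open>Change of the hook weights when one box is added\<close>

lemma antimono_add_box:
  assumes anti: "antimono r" and addable: "\<And>k. k < i \<Longrightarrow> r i < r k"
  shows "antimono (add_box r i)"
  unfolding antimono_def add_box_def using anti addable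
  by (auto simp: antimono_def le_Suc_eq) (metis Suc_leI le_neq_implies_less not_less_eq_eq)+

lemma col_height_add_box:
  assumes anti: "antimono r" and addable: "\<And>k. k < i \<Longrightarrow> r i < r k"
  shows "col_height (add_box r i) j = (if j = Suc (r i) then Suc i else col_height r j)"
  and "col_height r (Suc (r i)) = i"
proof -
  show "col_height r (Suc (r i)) = i"
    using addable by (intro col_height_eq[OF anti]) (auto simp: Suc_le_eq)
  show "col_height (add_box r i) j = (if j = Suc (r i) then Suc i else col_height r j)"
  proof (cases "j = Suc (r i)")
    case True
    have "r (Suc i) \<le> r i" using anti by (simp add: antimono_def)
    with True show ?thesis
      using addable
      by (subst col_height_eq[OF antimono_add_box[OF anti addable], of "Suc i"]) (auto simp: add_box_def Suc_le_eq less_Suc_eq)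
  next
    case False
    have "{k. j \<le> add_box r i k} = {k. j \<le> r k}" using False by (auto simp: add_box_def)
    with False show ?thesis by (simp add: col_height_def)
  qed
qed

context
  fixes \<alpha> :: real and r :: "nat \<Rightarrow> nat" and i N :: nat
  assumes pos: "\<alpha> > 0" and anti: "antimono r" and i: "i < N" and N: "r N = 0"
    and addable: "\<And>k. k < i \<Longrightarrow> r i < r k"
begin

private lemmas col_height_simps = col_height_add_box[OF anti addable]

private abbreviation (input) "E \<equiv> \<lambda>k. jcontent \<alpha> r i - jcontent \<alpha> r k"
private abbreviation (input) "gE \<equiv> \<lambda>k. E k * (E k + \<alpha> - 1)"
private abbreviation (input) "fE \<equiv> \<lambda>k. (E k + 1) * (E k + \<alpha>)"

lemma E_low: assumes "k < i" shows "E k + 1 < 0" "E k + \<alpha> < 0"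
proof -
  have "\<alpha> * (real (r k) - real (r i)) \<ge> \<alpha> * 1"
    using addable[OF assms] pos by (intro mult_left_mono) auto
  then have "E k \<le> - \<alpha> - 1"
    using assms by (simp add: jcontent_def algebra_simps)
  then show "E k + 1 < 0" "E k + \<alpha> < 0" using pos by auto
qed

lemma E_high: assumes "i < k" shows "E k > 0"
  using jcontent_less[OF pos anti assms] by simp

text \<open>Above row \<open>i\<close> only the column of the new box changes its height, from
  \<open>i\<close> to \<open>Suc i\<close>. The weight there passes from \<open>fE k\<close> to
  \<open>gE k\<close>, both expressed by the content difference \<open>E k\<close>.\<close>

lemma row_product_above:
  assumes "k < i"
  shows "(\<Prod>j\<in>{1..add_box r i k}. hook_weight \<alpha> (add_box r i) k j) =
         (\<Prod>j\<in>{1..r k}. hook_weight \<alpha> r k j) * (gE k / fE k)"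
proof -
  let ?m = "Suc (r i)"
  have m: "?m \<in> {1..r k}" using addable[OF assms] by auto
  have rk: "add_box r i k = r k" using assms by (simp add: add_box_def)
  have "(\<Prod>j\<in>{1..r k}-{?m}. hook_weight \<alpha> (add_box r i) k j) = (\<Prod>j\<in>{1..r k}-{?m}. hook_weight \<alpha> r k j)"
    by (rule prod.cong) (auto simp: hook_weight_def col_height_simps rk)
  moreover have "hook_weight \<alpha> (add_box r i) k ?m = gE k"
    by (simp add: hook_weight_def col_height_simps rk jcontent_def) (simp add: algebra_simps)
  moreover have "hook_weight \<alpha> r k ?m = fE k"
    by (simp add: hook_weight_def col_height_simps jcontent_def) (simp add: algebra_simps)
  ultimately have "(\<Prod>j\<in>{1..r k}. hook_weight \<alpha> (add_box r i) k j) =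
      gE k * (\<Prod>j\<in>{1..r k}-{?m}. hook_weight \<alpha> r k j)"
    "(\<Prod>j\<in>{1..r k}. hook_weight \<alpha> r k j) = fE k * (\<Prod>j\<in>{1..r k}-{?m}. hook_weight \<alpha> r k j)"
    by (simp_all only: prod.remove[OF finite_atLeastAtMost m])
  moreover have "fE k \<noteq> 0" using E_low[OF assms] by simp
  ultimately show ?thesis by (simp only: rk) (simp add: field_simps)
qed

text \<open>Along a block of columns of equal height the quotients of hook weights telescope.\<close>

lemma row_product_telescope:
  assumes "i \<le> K" "K \<le> N"
  shows "(\<Prod>j\<in>{r K<..r i}. hook_weight \<alpha> (add_box r i) i j / hook_weight \<alpha> r i j) =
         (\<Prod>k=i..<K. gE (Suc k) / fE k)"
  using assms
proof (induction K rule: dec_induct)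
  case (step K)
  \<comment> \<open>In a column of height \<open>Suc K\<close>, \<open>B j\<close> is the weight of
    box \<open>j\<close> of row \<open>i\<close> after the insertion. The arm was shorter by one
    before, so the old weight is \<open>B (Suc j)\<close>.\<close>
  define B where "B j = (\<alpha> * (real (r i) + 1 - real j) + (real K - real i) + 1) *
      (\<alpha> * (real (r i) + 1 - real j) + (real K - real i) + \<alpha>)" for j :: nat
  have le: "r (Suc K) \<le> r K" "r K \<le> r i" using anti step by (auto simp: antimono_def)
  have Bnz: "B j \<noteq> 0" if "j \<le> Suc (r i)" for j
  proof -
    have "\<alpha> * (real (r i) + 1 - real j) \<ge> 0" using that pos by simp
    then have "\<alpha> * (real (r i) + 1 - real j) + (real K - real i) \<ge> 0" using step by simp
    then have "B j > 0" using pos unfolding B_def by (intro mult_pos_pos) linarith+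
    then show ?thesis by simp
  qed
  have c: "col_height r j = Suc K" if "j \<in> {r (Suc K)<..r K}" for j
    using that anti by (intro col_height_eq) (auto simp: antimono_def less_Suc_eq_le intro: order_trans)
  have "(\<Prod>j\<in>{r (Suc K)<..r K}. hook_weight \<alpha> (add_box r i) i j / hook_weight \<alpha> r i j) =
        (\<Prod>j\<in>{r (Suc K)<..r K}. B j / B (Suc j))"
  proof (rule prod.cong)
    fix j assume j: "j \<in> {r (Suc K)<..r K}"
    then have "j \<noteq> Suc (r i)" using le by auto
    then have h: "col_height (add_box r i) j = Suc K" by (simp add: col_height_simps c[OF j])
    have "hook_weight \<alpha> (add_box r i) i j = B j"
      unfolding hook_weight_def h B_def by (simp add: add_box_def algebra_simps)
    moreover have "hook_weight \<alpha> r i j = B (Suc j)"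
      unfolding hook_weight_def c[OF j] B_def by (simp add: algebra_simps)
    ultimately show "hook_weight \<alpha> (add_box r i) i j / hook_weight \<alpha> r i j = B j / B (Suc j)"
      by simp
  qed simp
  also have "\<dots> = B (Suc (r (Suc K))) / B (Suc (r K))"
  proof -
    have "(\<Prod>j\<in>{a<..b}. B j / B (Suc j)) = B (Suc a) / B (Suc b)" if "a \<le> b" "b \<le> r i" for a b
      using that
    proof (induction b rule: dec_induct)
      case base
      then show ?case using Bnz[of "Suc a"] by simp
    next
      case (step b)
      have "{a<..Suc b} = insert (Suc b) {a<..b}" using step by auto
      then show ?case using step Bnz[of "Suc b"] by simp
    qed
    then show ?thesis using le by simp
  qed
  also have "\<dots> = gE (Suc K) / fE K"
    by (simp add: B_def jcontent_def algebra_simps)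
  finally have blk: "(\<Prod>j\<in>{r (Suc K)<..r K}. hook_weight \<alpha> (add_box r i) i j / hook_weight \<alpha> r i j) = \<dots>" .
  have "{r (Suc K)<..r i} = {r (Suc K)<..r K} \<union> {r K<..r i}" using le by auto
  then have "(\<Prod>j\<in>{r (Suc K)<..r i}. hook_weight \<alpha> (add_box r i) i j / hook_weight \<alpha> r i j) =
      gE (Suc K) / fE K * (\<Prod>k=i..<K. gE (Suc k) / fE k)"
    using step by (simp add: prod.union_disjoint blk)
  then show ?case using step by (simp add: mult.commute)
qed simp

text \<open>Telescoping down to the empty row \<open>N\<close> covers the old boxes of row
  \<open>i\<close>; the new box, with neither arm nor leg, has weight \<alpha>.\<close>

lemma row_product_same:
  "(\<Prod>j\<in>{1..add_box r i i}. hook_weight \<alpha> (add_box r i) i j) =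
   (\<Prod>j\<in>{1..r i}. hook_weight \<alpha> r i j) * (\<Prod>k\<in>{i<..<N}. gE k / fE k) * gE N"
proof -
  have nz: "hook_weight \<alpha> r i j \<noteq> 0" if "j \<in> {1..r i}" for j
    using hook_weight_pos[OF pos anti _ N, of j i] that by force
  have "{1..r i} = {r N<..r i}" using N by auto
  then have *: "(\<Prod>j\<in>{1..r i}. hook_weight \<alpha> (add_box r i) i j / hook_weight \<alpha> r i j) =
      (\<Prod>k=i..<N. gE (Suc k) / fE k)"
    using row_product_telescope[of N] i by simp
  have "(\<Prod>j\<in>{1..r i}. hook_weight \<alpha> (add_box r i) i j) =
      (\<Prod>j\<in>{1..r i}. hook_weight \<alpha> r i j) * (\<Prod>k=i..<N. gE (Suc k) / fE k)"
    unfolding *[symmetric] prod.distrib[symmetric] using nz by (intro prod.cong) auto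
  moreover have "hook_weight \<alpha> (add_box r i) i (Suc (r i)) = \<alpha>"
    by (simp add: hook_weight_def col_height_simps) (simp add: add_box_def)
  \<comment> \<open>The numerators run over \<open>Suc i..N\<close>, the denominators over
    \<open>i..N - 1\<close>: \<open>gE N\<close> is left over, and \<open>fE i = \<alpha>\<close> is
    to cancel the weight of the new box.\<close>
  moreover have "(\<Prod>k=i..<N. gE (Suc k) / fE k) = (\<Prod>k\<in>{i<..<N}. gE k / fE k) * gE N / \<alpha>"
  proof -
    obtain n where n: "N = Suc n" "i \<le> n" using i by (cases N) auto
    have "(\<Prod>k=i..<N. gE (Suc k)) = (\<Prod>k\<in>{Suc i..<Suc N}. gE k)"
      by (rule prod.shift_bounds_Suc_ivl[symmetric])
    also have "{Suc i..<Suc N} = insert N {i<..<N}" using i by auto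
    finally have g: "(\<Prod>k=i..<N. gE (Suc k)) = (\<Prod>k\<in>{i<..<N}. gE k) * gE N" by simp
    have "{i..<N} = insert i {i<..<N}" using i by auto
    then have f: "(\<Prod>k=i..<N. fE k) = \<alpha> * (\<Prod>k\<in>{i<..<N}. fE k)" by simp
    show ?thesis unfolding prod_dividef g f by simp
  qed
  ultimately show ?thesis using pos by (simp add: add_box_def)
qed

lemma row_product_below:
  assumes "i < k"
  shows "(\<Prod>j\<in>{1..add_box r i k}. hook_weight \<alpha> (add_box r i) k j) = (\<Prod>j\<in>{1..r k}. hook_weight \<alpha> r k j)"
proof (rule prod.cong)
  fix j assume "j \<in> {1..r k}"
  then have "j \<noteq> Suc (r i)" using antimonoD[OF anti, of i k] assms by auto
  then show "hook_weight \<alpha> (add_box r i) k j = hook_weight \<alpha> r k j"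
    using assms by (simp add: hook_weight_def col_height_simps) (simp add: add_box_def)
qed (use assms in \<open>simp add: add_box_def\<close>)

text \<open>Each factor of the quotient of hook products splits into \<open>E k / (E k + 1)\<close>
  and \<open>(E k + \<alpha> - 1) / (E k + \<alpha>)\<close>. The former are inverse to those of
  \<open>up_prob\<close>; the latter are those of \<open>down_weight\<close> for the larger diagram,
  in which the content of row \<open>i\<close> has grown by \<alpha>. The factor \<open>gE N\<close>
  splits in the same way.\<close>

lemma hook_product_add_box:
  "hook_product \<alpha> N (add_box r i) * up_prob \<alpha> N r i = hook_product \<alpha> N r * down_weight \<alpha> N (add_box r i) i"
proof -
  let ?J = "{..<N} - {i}"
  have J: "?J = {..<i} \<union> {i<..<N}" using i by auto
  have split: "(\<Prod>k<N. h k) = h i * ((\<Prod>k<i. h k) * (\<Prod>k\<in>{i<..<N}. h k))" for h :: "nat \<Rightarrow> real"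
  proof -
    have "prod h ?J = (\<Prod>k<i. h k) * (\<Prod>k\<in>{i<..<N}. h k)"
      unfolding J by (rule prod.union_disjoint) auto
    then show ?thesis using i by (subst prod.remove[of _ i]) auto
  qed
  have "hook_product \<alpha> N (add_box r i) = hook_product \<alpha> N r * (\<Prod>k\<in>?J. gE k / fE k) * gE N"
  proof -
    have "prod h ?J = (\<Prod>k<i. h k) * (\<Prod>k\<in>{i<..<N}. h k)" for h :: "nat \<Rightarrow> real"
      unfolding J by (rule prod.union_disjoint) auto
    moreover have "(\<Prod>k<i. \<Prod>j\<in>{1..add_box r i k}. hook_weight \<alpha> (add_box r i) k j) =
        (\<Prod>k<i. \<Prod>j\<in>{1..r k}. hook_weight \<alpha> r k j) * (\<Prod>k<i. gE k / fE k)"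
      unfolding prod.distrib[symmetric] by (rule prod.cong) (use row_product_above in auto)
    moreover have "(\<Prod>k\<in>{i<..<N}. \<Prod>j\<in>{1..add_box r i k}. hook_weight \<alpha> (add_box r i) k j) =
        (\<Prod>k\<in>{i<..<N}. \<Prod>j\<in>{1..r k}. hook_weight \<alpha> r k j)"
      by (rule prod.cong) (use row_product_below in auto)
    ultimately show ?thesis
      unfolding hook_product_def split row_product_same by (simp only: mult_ac)
  qed
  also have "(\<Prod>k\<in>?J. gE k / fE k) =
      (\<Prod>k\<in>?J. E k) * (\<Prod>k\<in>?J. E k + \<alpha> - 1) / ((\<Prod>k\<in>?J. E k + 1) * (\<Prod>k\<in>?J. E k + \<alpha>))"
    by (simp add: prod_dividef prod.distrib)
  finally have H: "hook_product \<alpha> N (add_box r i) = hook_product \<alpha> N r *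
      ((\<Prod>k\<in>?J. E k) * (\<Prod>k\<in>?J. E k + \<alpha> - 1) / ((\<Prod>k\<in>?J. E k + 1) * (\<Prod>k\<in>?J. E k + \<alpha>))) * gE N" .
  have ins: "{..N} - {i} = insert N ?J" using i by auto
  have "(\<Prod>k<N. E k + 1) = (\<Prod>k\<in>?J. E k + 1)" using i by (subst prod.remove[of _ i]) auto
  then have U: "up_prob \<alpha> N r i = (\<Prod>k\<in>?J. E k + 1) / (E N * (\<Prod>k\<in>?J. E k))"
    by (simp add: up_prob_def ins)
  have c: "jcontent \<alpha> (add_box r i) i = jcontent \<alpha> r i + \<alpha>"
    by (simp add: jcontent_def add_box_def algebra_simps)
  have c': "jcontent \<alpha> (add_box r i) k = jcontent \<alpha> r k" if "k \<noteq> i" for k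
    using that by (simp add: jcontent_def add_box_def)
  have "(\<Prod>k\<in>?J. jcontent \<alpha> (add_box r i) i - jcontent \<alpha> (add_box r i) k - 1) = (\<Prod>k\<in>?J. E k + \<alpha> - 1)"
    "(\<Prod>k\<in>?J. jcontent \<alpha> (add_box r i) i - jcontent \<alpha> (add_box r i) k) = (\<Prod>k\<in>?J. E k + \<alpha>)"
    by (rule prod.cong; simp add: c c')+
  then have D: "down_weight \<alpha> N (add_box r i) i =
      (E N + \<alpha> - 1) * (\<Prod>k\<in>?J. E k + \<alpha> - 1) / (\<Prod>k\<in>?J. E k + \<alpha>)"
    using i by (simp add: down_weight_def ins c c')
  have nz: "(\<Prod>k\<in>?J. E k) \<noteq> 0" "(\<Prod>k\<in>?J. E k + 1) \<noteq> 0" "E N \<noteq> 0"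
  proof -
    have "E k \<noteq> 0" "E k + 1 \<noteq> 0" if "k \<noteq> i" for k
      using E_low[of k] E_high[of k] pos that by (cases "k < i"; force)+
    then show "(\<Prod>k\<in>?J. E k) \<noteq> 0" "(\<Prod>k\<in>?J. E k + 1) \<noteq> 0" "E N \<noteq> 0" using i by auto
  qed
  have "h * (a * b / (c * e)) * (x * y) * (c / (x * a)) = h * (y * b / e)"
    if "a \<noteq> 0" "c \<noteq> 0" "x \<noteq> 0" for h a b c e x y :: real
    using that by simp
  from this[OF nz] show ?thesis unfolding H U D .
qed

end

subsection \<open>The growth process\<close>

definition jack_weight :: "real \<Rightarrow> nat \<Rightarrow> (nat \<Rightarrow> nat) \<Rightarrow> real" where
  "jack_weight \<alpha> n r = fact n * \<alpha> ^ n / hook_product \<alpha> n r"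

definition jack_mean :: "real \<Rightarrow> nat \<Rightarrow> ((nat \<Rightarrow> nat) \<Rightarrow> real) \<Rightarrow> real" where
  "jack_mean \<alpha> n h = (\<Sum>r\<in>row_functions n. jack_weight \<alpha> n r * h r)"

definition addable_rows :: "nat \<Rightarrow> (nat \<Rightarrow> nat) \<Rightarrow> nat set" where
  "addable_rows N r = {i. i < N \<and> (\<forall>k<i. r i < r k)}"

lemma row_functionsD:
  assumes "r \<in> row_functions n"
  shows "antimono r" "\<And>i. i \<ge> n \<Longrightarrow> r i = 0" "sum r {..<n} = n"
  using assms by (auto simp: row_functions_def)

lemma sum_row_function:
  assumes "r \<in> row_functions n" "n \<le> N"
  shows "sum r {..<N} = n"
proof -
  have "sum r {..<N} = sum r {..<n}"
    using row_functionsD(2)[OF assms(1)] assms(2) by (intro sum.mono_neutral_right) auto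
  then show ?thesis using row_functionsD(3)[OF assms(1)] by simp
qed

lemma finite_row_functions: "finite (row_functions n)"
proof (rule finite_subset)
  show "row_functions n \<subseteq> {r. \<forall>i. (i \<in> {..<n} \<longrightarrow> r i \<in> {..n}) \<and> (i \<notin> {..<n} \<longrightarrow> r i = 0)}"
  proof (intro subsetI CollectI allI conjI impI)
    fix r i assume r: "r \<in> row_functions n" and "i \<in> {..<n}"
    then show "r i \<in> {..n}"
      using member_le_sum[of i "{..<n}" r] row_functionsD(3)[OF r] by auto
  next
    fix r i assume "r \<in> row_functions n" "i \<notin> {..<n}"
    then show "r i = 0" by (auto simp: row_functions_def)
  qed
qed (intro finite_set_of_finite_funs; simp)

lemma jack_weight_nonneg:
  assumes "\<alpha> > 0" "r \<in> row_functions n"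
  shows "jack_weight \<alpha> n r \<ge> 0"
  using hook_product_pos[OF assms(1) row_functionsD(1)[OF assms(2)], of n] assms
    row_functionsD(2)[OF assms(2), of n]
  by (simp add: jack_weight_def)

section \<open>Addable and removable rows\<close>

lemma up_prob_eq_0:
  assumes "r \<in> row_functions n" "n < N" "i \<le> N" "i \<notin> addable_rows N r"
  shows "up_prob \<alpha> N r i = 0"
proof -
  from assms have "i = N \<or> (\<exists>k<i. \<not> r i < r k)" by (auto simp: addable_rows_def)
  then have "i > 0 \<and> r (i - 1) = r i"
  proof
    \<comment> \<open>The strict bound \<open>n < N\<close> makes row \<open>N - 1\<close> empty
      like row \<open>N\<close>.\<close>
    assume "i = N" then show ?thesis using row_functionsD(2)[OF assms(1)] assms(2) by auto
  next
    assume "\<exists>k<i. \<not> r i < r k"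
    then obtain k where k: "k < i" "r k \<le> r i" by auto
    with antimonoD[OF row_functionsD(1)[OF assms(1)], of k "i - 1"]
      antimonoD[OF row_functionsD(1)[OF assms(1)], of "i - 1" i]
    have "r i \<le> r (i - 1)" "r (i - 1) \<le> r k" by simp_all
    with k show ?thesis by simp
  qed
  then have "i - 1 < N" "jcontent \<alpha> r i - jcontent \<alpha> r (i - 1) + 1 = 0"
    using assms(3) by (auto simp: jcontent_def of_nat_diff Suc_leI)
  then have "(\<Prod>k<N. jcontent \<alpha> r i - jcontent \<alpha> r k + 1) = 0" by (intro prod_zero) auto
  then show ?thesis by (simp add: up_prob_def)
qed

lemma down_weight_eq_0:
  assumes "i < N" "r (Suc i) = r i"
  shows "down_weight \<alpha> N r i = 0"
proof -
  have "jcontent \<alpha> r i - jcontent \<alpha> r (Suc i) - 1 = 0" using assms by (simp add: jcontent_def)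
  then have "(\<Prod>k\<in>{..N}-{i}. jcontent \<alpha> r i - jcontent \<alpha> r k - 1) = 0"
    using assms by (intro prod_zero) auto
  then show ?thesis by (simp add: down_weight_def)
qed

lemma addable_rows_bound:
  assumes "r \<in> row_functions n" "i \<in> addable_rows N r"
  shows "i \<le> n"
proof (rule ccontr)
  assume "\<not> i \<le> n"
  then have "r i < r n" using assms(2) by (auto simp: addable_rows_def)
  then show False using row_functionsD(2)[OF assms(1), of n] by simp
qed

lemma add_box_in_row_functions:
  assumes "r \<in> row_functions n" "i \<in> addable_rows N r"
  shows "add_box r i \<in> row_functions (Suc n)"
proof -
  have i: "i \<le> n" by (rule addable_rows_bound[OF assms])
  have "sum (add_box r i) {..<Suc n} = Suc (sum r {..<Suc n})"
    using i by (simp add: add_box_def sum.remove[of _ i] del: sum.lessThan_Suc)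
  then show ?thesis
    using i sum_row_function[OF assms(1), of "Suc n"] row_functionsD(2)[OF assms(1)]
      antimono_add_box[OF row_functionsD(1)[OF assms(1)], of i] assms(2)
    by (auto simp: row_functions_def addable_rows_def add_box_def)
qed

lemma remove_box_in_row_functions:
  assumes r: "r \<in> row_functions (Suc n)" and i: "r (Suc i) < r i" and N: "n < N"
  shows "r(i := r i - 1) \<in> row_functions n" "i \<in> addable_rows N (r(i := r i - 1))"
proof -
  have anti: "antimono (r(i := r i - 1))"
    unfolding antimono_def
  proof safe
    fix k l :: nat assume kl: "k \<le> l"
    have "r l \<le> r (Suc i)" if "k = i" "l \<noteq> i"
      using row_functionsD(1)[OF r] that kl by (auto simp: antimono_def)
    moreover have "r l \<le> r k" using row_functionsD(1)[OF r] kl by (auto simp: antimono_def)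
    ultimately show "(r(i := r i - 1)) l \<le> (r(i := r i - 1)) k" using i by auto
  qed
  have iS: "i < Suc n" using i row_functionsD(2)[OF r, of i] by (cases "i < Suc n") auto
  have "sum (r(i := r i - 1)) {..<Suc n} = sum r {..<Suc n} - 1"
    using iS i by (simp add: sum.remove[of _ i] del: sum.lessThan_Suc)
  then have s: "sum (r(i := r i - 1)) {..<Suc n} = n"
    using row_functionsD(3)[OF r] by simp
  \<comment> \<open>A nonempty row of index at least \<open>n\<close> would make all rows
    \<open>0..n\<close> nonempty, which takes more than \<open>n\<close> boxes.\<close>
  have z: "(r(i := r i - 1)) k = 0" if "k \<ge> n" for k
  proof (rule ccontr)
    assume nz: "(r(i := r i - 1)) k \<noteq> 0"
    have "1 \<le> (r(i := r i - 1)) l" if "l \<le> n" for l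
      using antimonoD[OF anti, of l k] nz that \<open>k \<ge> n\<close> by linarith
    then have "(\<Sum>l<Suc n. 1) \<le> sum (r(i := r i - 1)) {..<Suc n}"
      by (intro sum_mono) (simp add: less_Suc_eq_le)
    then show False using s by simp
  qed
  from s z[of n] have "sum (r(i := r i - 1)) {..<n} = n" by simp
  then show "r(i := r i - 1) \<in> row_functions n" using anti z by (simp add: row_functions_def)
  have "r i \<le> r k" if "k < i" for k
    using row_functionsD(1)[OF r] that by (auto simp: antimono_def)
  then show "i \<in> addable_rows N (r(i := r i - 1))"
    using iS N i by (fastforce simp: addable_rows_def)
qed

text \<open>Time reversal: both sides are the mass of the step from \<open>r\<close> to
  \<open>add_box r i\<close>. The constant \<open>\<alpha> * (n + 1)\<close> is the quotient of the
  prefactors of the two Jack weights, the rest is the identity for hook products.\<close>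

lemma jack_weight_up_prob:
  assumes "\<alpha> > 0" "r \<in> row_functions n" "n < N" "i \<in> addable_rows N r"
  shows "jack_weight \<alpha> n r * up_prob \<alpha> N r i =
         jack_weight \<alpha> (Suc n) (add_box r i) * (down_weight \<alpha> N (add_box r i) i / (\<alpha> * real (Suc n)))"
proof -
  have anti: "antimono r" and z: "r N = 0"
    using row_functionsD[OF assms(2)] assms(3) by auto
  have i: "i < N" "\<And>k. k < i \<Longrightarrow> r i < r k" using assms(4) by (auto simp: addable_rows_def)
  have add: "add_box r i \<in> row_functions (Suc n)" by (rule add_box_in_row_functions[OF assms(2,4)])
  have ext: "hook_product \<alpha> N r = hook_product \<alpha> n r"
    "hook_product \<alpha> N (add_box r i) = hook_product \<alpha> (Suc n) (add_box r i)"
    using row_functionsD(2)[OF assms(2)] row_functionsD(2)[OF add] assms(3)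
    by (intro hook_product_extend; simp)+
  have p: "hook_product \<alpha> n r > 0" "hook_product \<alpha> (Suc n) (add_box r i) > 0"
    using hook_product_pos[OF assms(1) anti z] ext
      hook_product_pos[OF assms(1) row_functionsD(1)[OF add], of N] row_functionsD(2)[OF add, of N] assms(3)
    by auto
  from hook_product_add_box[OF assms(1) anti i(1) z i(2)]
  have "up_prob \<alpha> N r i = hook_product \<alpha> n r * down_weight \<alpha> N (add_box r i) i /
      hook_product \<alpha> (Suc n) (add_box r i)"
    using p by (simp add: ext field_simps)
  then show ?thesis
    using p assms(1) by (simp only: jack_weight_def fact_Suc power_Suc of_nat_mult) simp
qed

text \<open>The Jack--Plancherel measures are the marginals of a growth process that adds a box to
  row \<open>i\<close> with probability \<open>up_prob\<close>.\<close>

lemma jack_mean_Suc: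
  assumes "\<alpha> > 0" "n < N" "N \<ge> 2"
  shows "jack_mean \<alpha> (Suc n) h =
         jack_mean \<alpha> n (\<lambda>r. \<Sum>i\<le>N. up_prob \<alpha> N r i * h (add_box r i))"
proof -
  \<comment> \<open>The down weights of a diagram with \<open>n + 1\<close> boxes sum to
    \<open>\<alpha> * (n + 1)\<close>, so its contribution can be spread over its removable
    rows.\<close>
  define w where "w r i = jack_weight \<alpha> (Suc n) r * (down_weight \<alpha> N r i / (\<alpha> * real (Suc n))) * h r" for r i
  define rem where "rem r = {i. i < N \<and> r (Suc i) < r i}" for r :: "nat \<Rightarrow> nat"
  have fin: "finite (rem r)" "finite (addable_rows N r)" for r
    by (auto simp: rem_def addable_rows_def)
  have "jack_mean \<alpha> (Suc n) h = (\<Sum>r\<in>row_functions (Suc n). \<Sum>i\<in>rem r. w r i)"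
    unfolding jack_mean_def
  proof (rule sum.cong)
    fix r assume r: "r \<in> row_functions (Suc n)"
    have "(\<Sum>i\<in>rem r. down_weight \<alpha> N r i) = (\<Sum>i<N. down_weight \<alpha> N r i)"
    proof (rule sum.mono_neutral_left)
      show "\<forall>i\<in>{..<N} - rem r. down_weight \<alpha> N r i = 0"
      proof
        fix i assume i: "i \<in> {..<N} - rem r"
        have "r (Suc i) \<le> r i" using row_functionsD(1)[OF r] by (simp add: antimono_def)
        with i show "down_weight \<alpha> N r i = 0"
          by (intro down_weight_eq_0) (auto simp: rem_def)
      qed
    qed (auto simp: rem_def)
    also have "\<dots> = \<alpha> * real (Suc n)"
      using sum_down_weight[OF assms(1) row_functionsD(1)[OF r] _ assms(3)] row_functionsD(2)[OF r]
        sum_row_function[OF r, of N] assms(2) by (simp flip: of_nat_sum)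
    finally have "(\<Sum>i\<in>rem r. down_weight \<alpha> N r i / (\<alpha> * real (Suc n))) = 1"
      using assms(1) by (simp flip: sum_divide_distrib)
    then show "jack_weight \<alpha> (Suc n) r * h r = (\<Sum>i\<in>rem r. w r i)"
      unfolding w_def sum_distrib_left[symmetric] sum_distrib_right[symmetric] by simp
  qed simp
  also have "\<dots> = (\<Sum>(r, i)\<in>Sigma (row_functions (Suc n)) rem. w r i)"
    by (rule sum.Sigma) (auto simp: finite_row_functions fin)
  \<comment> \<open>Pairs of a large diagram and a removable row correspond bijectively to pairs of
    a small diagram and an addable row.\<close>
  also have "\<dots> = (\<Sum>(r, i)\<in>Sigma (row_functions n) (addable_rows N). w (add_box r i) i)"
  proof (rule sum.reindex_bij_witness[of _ "\<lambda>(r, i). (add_box r i, i)" "\<lambda>(r, i). (r(i := r i - 1), i)"])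
    fix a assume "a \<in> Sigma (row_functions (Suc n)) rem"
    then obtain r i where a: "a = (r, i)" and r: "r \<in> row_functions (Suc n)" and i: "r (Suc i) < r i"
      by (auto simp: rem_def)
    show "(case a of (r, i) \<Rightarrow> (r(i := r i - 1), i)) \<in> Sigma (row_functions n) (addable_rows N)"
      using remove_box_in_row_functions[OF r i assms(2)] a by auto
    show "(case case a of (r, i) \<Rightarrow> (r(i := r i - 1), i) of (r, i) \<Rightarrow> (add_box r i, i)) = a"
      using i a by (auto simp: add_box_def)
    then show "(case case a of (r, i) \<Rightarrow> (r(i := r i - 1), i) of (r, i) \<Rightarrow> w (add_box r i) i) =
        (case a of (r, i) \<Rightarrow> w r i)"
      by (auto simp: a)
  next
    fix b assume "b \<in> Sigma (row_functions n) (addable_rows N)"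
    then obtain r i where b: "b = (r, i)" and r: "r \<in> row_functions n" and i: "i \<in> addable_rows N r"
      by auto
    show "(case case b of (r, i) \<Rightarrow> (add_box r i, i) of (r, i) \<Rightarrow> (r(i := r i - 1), i)) = b"
      by (auto simp: add_box_def b)
    have "r (Suc i) \<le> r i" using row_functionsD(1)[OF r] by (simp add: antimono_def)
    then show "(case b of (r, i) \<Rightarrow> (add_box r i, i)) \<in> Sigma (row_functions (Suc n)) rem"
      using add_box_in_row_functions[OF r i] i b
      by (auto simp: rem_def add_box_def addable_rows_def)
  qed
  also have "\<dots> = (\<Sum>r\<in>row_functions n. \<Sum>i\<in>addable_rows N r. w (add_box r i) i)"
    by (rule sum.Sigma[symmetric]) (auto simp: finite_row_functions fin)
  also have "\<dots> = jack_mean \<alpha> n (\<lambda>r. \<Sum>i\<le>N. up_prob \<alpha> N r i * h (add_box r i))"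
    unfolding jack_mean_def
  proof (rule sum.cong)
    fix r assume r: "r \<in> row_functions n"
    have "(\<Sum>i\<in>addable_rows N r. w (add_box r i) i) =
        (\<Sum>i\<in>addable_rows N r. jack_weight \<alpha> n r * (up_prob \<alpha> N r i * h (add_box r i)))"
    proof (rule sum.cong)
      fix i assume "i \<in> addable_rows N r"
      from jack_weight_up_prob[OF assms(1) r assms(2) this]
      show "w (add_box r i) i = jack_weight \<alpha> n r * (up_prob \<alpha> N r i * h (add_box r i))"
        unfolding w_def by (simp only: mult.assoc[symmetric])
    qed simp
    also have "\<dots> = (\<Sum>i\<le>N. jack_weight \<alpha> n r * (up_prob \<alpha> N r i * h (add_box r i)))"
      by (rule sum.mono_neutral_left)
         (use up_prob_eq_0[OF r assms(2)] in \<open>simp_all, auto simp: addable_rows_def\<close>)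
    finally show "(\<Sum>i\<in>addable_rows N r. w (add_box r i) i) =
        jack_weight \<alpha> n r * (\<Sum>i\<le>N. up_prob \<alpha> N r i * h (add_box r i))"
      by (simp add: sum_distrib_left)
  qed simp
  finally show ?thesis .
qed

section \<open>Expectation with respect to the Jack--Plancherel measure\<close>

lemma row_functions_0: "row_functions 0 = {\<lambda>_. 0}"
  by (auto simp: row_functions_def antimono_def)

lemma jack_mean_0: "jack_mean \<alpha> 0 h = h (\<lambda>_. 0)"
  by (simp add: jack_mean_def row_functions_0 jack_weight_def hook_product_def)

lemma jack_mean_cong:
  "(\<And>r. r \<in> row_functions n \<Longrightarrow> h r = h' r) \<Longrightarrow> jack_mean \<alpha> n h = jack_mean \<alpha> n h'"
  by (simp add: jack_mean_def)

lemma jack_mean_linear: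
  "jack_mean \<alpha> n (\<lambda>r. h r + h' r) = jack_mean \<alpha> n h + jack_mean \<alpha> n h'"
  "jack_mean \<alpha> n (\<lambda>r. h r - h' r) = jack_mean \<alpha> n h - jack_mean \<alpha> n h'"
  "jack_mean \<alpha> n (\<lambda>r. c * h r) = c * jack_mean \<alpha> n h"
  by (simp_all add: jack_mean_def algebra_simps sum.distrib sum_subtractf sum_distrib_left)

lemma jack_mean_mono:
  assumes "\<alpha> > 0" "\<And>r. r \<in> row_functions n \<Longrightarrow> h r \<le> h' r"
  shows "jack_mean \<alpha> n h \<le> jack_mean \<alpha> n h'"
  unfolding jack_mean_def
  by (intro sum_mono mult_left_mono assms jack_weight_nonneg)

text \<open>Total mass 1 is inherited along the growth process, because the transition probabilities
  sum to 1.\<close>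

lemma jack_mean_const:
  assumes "\<alpha> > 0"
  shows "jack_mean \<alpha> n (\<lambda>_. c) = c"
proof (induction n)
  case (Suc n)
  \<comment> \<open>The row bound \<open>n + 2\<close> meets both requirements \<open>n < N\<close>
    and \<open>N \<ge> 2\<close>.\<close>
  have "jack_mean \<alpha> (Suc n) (\<lambda>_. c) = jack_mean \<alpha> n (\<lambda>_. c)"
    unfolding jack_mean_Suc[OF assms, of n "n + 2", OF less_add_same_cancel1[THEN iffD2, OF zero_less_numeral] le_add2]
      sum_distrib_right[symmetric]
    by (intro jack_mean_cong) (simp only: sum_up_prob[OF assms row_functionsD(1)] mult_1)
  with Suc show ?case by simp
qed (simp add: jack_mean_0)

lemma abs_jack_mean_le:
  assumes "\<alpha> > 0" "\<And>r. r \<in> row_functions n \<Longrightarrow> \<bar>h r\<bar> \<le> c"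
  shows "\<bar>jack_mean \<alpha> n h\<bar> \<le> c"
proof -
  have "jack_mean \<alpha> n h \<le> jack_mean \<alpha> n (\<lambda>_. c)" "jack_mean \<alpha> n (\<lambda>_. - c) \<le> jack_mean \<alpha> n h"
    using assms(2) by (intro jack_mean_mono assms(1); force simp: abs_le_iff)+
  then show ?thesis by (simp add: jack_mean_const assms(1))
qed

subsection \<open>Moments of the characteristic ratio\<close>

lemma char_ratio_as_prod:
  "char_ratio \<alpha> N r y = (\<Prod>k\<le>N. (y - jcontent \<alpha> r k) / (y + real k))"
  by (simp add: char_ratio_def prod_dividef)

lemma abs_char_factor_le:
  assumes "\<alpha> > 0" "\<delta> > 0" "\<delta> \<le> \<bar>y + real k\<bar>"
  shows "\<bar>(y - jcontent \<alpha> r k) / (y + real k)\<bar> \<le> exp (\<alpha> * real (r k) / \<delta>)"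
proof -
  have nz: "y + real k \<noteq> 0" using assms by auto
  have "(y - jcontent \<alpha> r k) / (y + real k) = 1 - \<alpha> * real (r k) / (y + real k)"
    using nz by (simp add: jcontent_def field_simps)
  also have "\<bar>\<dots>\<bar> \<le> 1 + \<bar>\<alpha> * real (r k) / (y + real k)\<bar>" by linarith
  also have "\<bar>\<alpha> * real (r k) / (y + real k)\<bar> \<le> \<alpha> * real (r k) / \<delta>"
    using assms by (simp add: abs_mult frac_le)
  also have "1 + \<alpha> * real (r k) / \<delta> \<le> exp (\<alpha> * real (r k) / \<delta>)" by (rule exp_ge_add_one_self)
  finally show ?thesis by simp
qed

text \<open>The exponential bounds of the factors multiply to the exponential of the total area, so
  the estimate depends neither on the shape of the diagram nor on \<open>N\<close>.\<close>

lemma prod_abs_char_factor_le: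
  assumes "\<alpha> > 0" "\<delta> > 0" "\<And>k. \<delta> \<le> \<bar>y + real k\<bar>" "A \<subseteq> {..N}"
    and r: "r \<in> row_functions n" "\<alpha> * real n \<le> S" "n \<le> N"
  shows "(\<Prod>k\<in>A. \<bar>(y - jcontent \<alpha> r k) / (y + real k)\<bar>) \<le> exp (S / \<delta>)"
proof -
  have fin: "finite A" using assms(4) finite_subset by blast
  have "(\<Prod>k\<in>A. \<bar>(y - jcontent \<alpha> r k) / (y + real k)\<bar>) \<le> (\<Prod>k\<in>A. exp (\<alpha> * real (r k) / \<delta>))"
    using abs_char_factor_le[OF assms(1-3)] by (intro prod_mono) auto
  also have "\<dots> = exp (\<Sum>k\<in>A. \<alpha> * real (r k) / \<delta>)" by (simp add: exp_sum fin)
  also have "(\<Sum>k\<in>A. \<alpha> * real (r k) / \<delta>) \<le> (\<Sum>k<Suc N. \<alpha> * real (r k) / \<delta>)"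
    using assms by (intro sum_mono2) auto
  also have "\<dots> = \<alpha> * real (sum r {..<Suc N}) / \<delta>"
    by (simp add: sum_distrib_left sum_divide_distrib del: sum.lessThan_Suc)
  also have "\<dots> \<le> S / \<delta>"
    using sum_row_function[OF r(1), of "Suc N"] r assms(2) by (simp add: divide_right_mono)
  finally show ?thesis by simp
qed

lemma abs_char_ratio_le:
  assumes "\<alpha> > 0" "\<delta> > 0" "\<And>k. \<delta> \<le> \<bar>y + real k\<bar>"
    and "r \<in> row_functions n" "\<alpha> * real n \<le> S" "n \<le> N"
  shows "\<bar>char_ratio \<alpha> N r y\<bar> \<le> exp (S / \<delta>)"
  using prod_abs_char_factor_le[OF assms(1-3) order_refl assms(4-6)]
  by (simp add: char_ratio_as_prod abs_prod)

lemma abs_char_ratio_omit_le: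
  assumes "\<alpha> > 0" "\<delta> > 0" "\<And>k. \<delta> \<le> \<bar>y + real k\<bar>"
    and "r \<in> row_functions n" "\<alpha> * real n \<le> S" "n \<le> N" and "i \<le> N"
  shows "\<bar>char_ratio_omit \<alpha> N r i y\<bar> \<le> exp (S / \<delta>) / \<delta>"
proof -
  let ?A = "{..N} - {i}"
  have "char_ratio_omit \<alpha> N r i y = (\<Prod>k\<in>?A. (y - jcontent \<alpha> r k) / (y + real k)) / (y + real i)"
    using assms(7) by (simp add: char_ratio_omit_def prod_dividef prod.remove[of "{..N}" i])
  then have "\<bar>char_ratio_omit \<alpha> N r i y\<bar> =
      (\<Prod>k\<in>?A. \<bar>(y - jcontent \<alpha> r k) / (y + real k)\<bar>) / \<bar>y + real i\<bar>"
    by (simp only: abs_divide abs_prod)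
  also have "\<dots> \<le> exp (S / \<delta>) / \<delta>"
    using prod_abs_char_factor_le[OF assms(1-3) _ assms(4-6), of ?A] assms(2) assms(3)[of i]
    by (intro frac_le) auto
  finally show ?thesis .
qed

section \<open>Recursions for means and covariances\<close>

definition jack_cov :: "real \<Rightarrow> nat \<Rightarrow> nat \<Rightarrow> real \<Rightarrow> real \<Rightarrow> real" where
  "jack_cov \<alpha> N n y z = jack_mean \<alpha> n (\<lambda>r. char_ratio \<alpha> N r y * char_ratio \<alpha> N r z) -
     jack_mean \<alpha> n (\<lambda>r. char_ratio \<alpha> N r y) * jack_mean \<alpha> n (\<lambda>r. char_ratio \<alpha> N r z)"

text \<open>Ensures that bounds in terms of \<delta> survive the shifts
  \<open>y \<mapsto> y + 1\<close> of the recursions.\<close>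

lemma shifted_distance:
  fixes \<delta> y :: real
  assumes "\<And>k. \<delta> \<le> \<bar>y + real k\<bar>"
  shows "\<delta> \<le> \<bar>y + real j + real k\<bar>"
  using assms[of "j + k"] by (simp add: add_ac)

context
  fixes \<alpha> \<delta> y0 :: real and N :: nat
  assumes \<alpha>: "\<alpha> > 0" and N: "N \<ge> 2" and \<delta>: "\<delta> > 0" and y0: "\<And>k. \<delta> \<le> \<bar>y0 + real k\<bar>"
begin

lemma sum_up_prob_omit_shifted:
  assumes r: "r \<in> row_functions n" and n: "n < N"
  shows "(\<Sum>i\<le>N. up_prob \<alpha> N r i * char_ratio_omit \<alpha> N r i (y0 + real j)) =
    char_ratio \<alpha> N r (y0 + real (Suc j)) / (y0 + real j)"
proof -
  have z: "r N = 0" using row_functionsD(2)[OF r] n by simp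
  have "y0 + real j + 1 + real N \<noteq> 0" using shifted_distance[OF y0, of j "Suc N"] \<delta> by auto
  then show ?thesis by (simp add: sum_up_prob_omit[OF \<alpha> row_functionsD(1)[OF r] z] add_ac)
qed

lemma mean_char_ratio_add_box:
  assumes r: "r \<in> row_functions n" and n: "n < N"
  shows "(\<Sum>i\<le>N. up_prob \<alpha> N r i * char_ratio \<alpha> N (add_box r i) (y0 + real j)) =
           char_ratio \<alpha> N r (y0 + real j) - \<alpha> / (y0 + real j) * char_ratio \<alpha> N r (y0 + real (Suc j))"
proof -
  define p where "p = up_prob \<alpha> N r"
  define Y where "Y = char_ratio \<alpha> N r (y0 + real j)"
  define u where "u i = char_ratio_omit \<alpha> N r i (y0 + real j)" for i
  have one: "(\<Sum>i\<le>N. p i) = 1" unfolding p_def by (rule sum_up_prob[OF \<alpha> row_functionsD(1)[OF r]])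
  have su: "(\<Sum>i\<le>N. p i * u i) = char_ratio \<alpha> N r (y0 + real (Suc j)) / (y0 + real j)"
    unfolding p_def u_def by (rule sum_up_prob_omit_shifted[OF assms])
  have "(\<Sum>i\<le>N. p i * char_ratio \<alpha> N (add_box r i) (y0 + real j)) = (\<Sum>i\<le>N. p i * Y - \<alpha> * (p i * u i))"
    by (rule sum.cong) (simp_all add: char_ratio_add_box Y_def u_def algebra_simps)
  also have "\<dots> = Y - \<alpha> * (\<Sum>i\<le>N. p i * u i)"
    unfolding sum_subtractf sum_distrib_right[symmetric] sum_distrib_left[symmetric] one by simp
  finally show ?thesis unfolding su by (simp add: p_def Y_def)
qed

lemma jack_mean_char_ratio_Suc:
  assumes "n < N"
  shows "jack_mean \<alpha> (Suc n) (\<lambda>r. char_ratio \<alpha> N r (y0 + real j)) =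
         jack_mean \<alpha> n (\<lambda>r. char_ratio \<alpha> N r (y0 + real j)) -
         \<alpha> / (y0 + real j) * jack_mean \<alpha> n (\<lambda>r. char_ratio \<alpha> N r (y0 + real (Suc j)))"
proof -
  have "jack_mean \<alpha> (Suc n) (\<lambda>r. char_ratio \<alpha> N r (y0 + real j)) =
    jack_mean \<alpha> n (\<lambda>r. char_ratio \<alpha> N r (y0 + real j) -
      \<alpha> / (y0 + real j) * char_ratio \<alpha> N r (y0 + real (Suc j)))"
    unfolding jack_mean_Suc[OF \<alpha> assms N] by (rule jack_mean_cong) (rule mean_char_ratio_add_box[OF _ assms])
  then show ?thesis by (simp only: jack_mean_linear)
qed

text \<open>The operator \<open>h y \<mapsto> h y - \<alpha> / y * h (y + 1)\<close> is applied
  \<open>n\<close> times to the constant 1. Powers of its second part produce the Pochhammer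
  symbols, and Pascal's rule yields the binomial expansion. The induction needs all shifts
  \<open>j\<close> at once.\<close>

lemma jack_mean_char_ratio:
  assumes "n \<le> N"
  shows "jack_mean \<alpha> n (\<lambda>r. char_ratio \<alpha> N r (y0 + real j)) =
         (\<Sum>m\<le>n. real (n choose m) * (- \<alpha>) ^ m / pochhammer (y0 + real j) m)"
  using assms
proof (induction n arbitrary: j)
  case 0
  have "y0 + real j + real k \<noteq> 0" for k using shifted_distance[OF y0, of j k] \<delta> by auto
  then show ?case by (simp add: jack_mean_0 char_ratio_def jcontent_def)
next
  case (Suc n)
  let ?y = "y0 + real j"
  define t where "t m = (- \<alpha>) ^ m / pochhammer ?y m" for m
  have tS: "t (Suc m) = - \<alpha> / ?y * ((- \<alpha>) ^ m / pochhammer (?y + 1) m)" for m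
    by (simp add: t_def pochhammer_rec)
  have "jack_mean \<alpha> (Suc n) (\<lambda>r. char_ratio \<alpha> N r ?y) =
      (\<Sum>m\<le>n. real (n choose m) * t m) + (\<Sum>m\<le>n. real (n choose m) * t (Suc m))"
  proof -
    have n: "n < N" "n \<le> N" using Suc.prems by auto
    have y1: "?y + 1 = y0 + real (Suc j)" by simp
    have "(\<Sum>m\<le>n. real (n choose m) * t (Suc m)) =
        - (\<alpha> / ?y * (\<Sum>m\<le>n. real (n choose m) * (- \<alpha>) ^ m / pochhammer (y0 + real (Suc j)) m))"
      unfolding sum_distrib_left sum_negf[symmetric] tS y1 by (intro sum.cong) auto
    then show ?thesis
      unfolding jack_mean_char_ratio_Suc[OF n(1)] Suc.IH[OF n(2)] by (simp add: t_def)
  qed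
  also have "(\<Sum>m\<le>n. real (n choose m) * t m) = (\<Sum>m\<le>Suc n. real (n choose m) * t m)"
    by simp
  also have "\<dots> = t 0 + (\<Sum>m\<le>n. real (n choose Suc m) * t (Suc m))"
    by (subst sum.atMost_Suc_shift) simp
  also have "\<dots> + (\<Sum>m\<le>n. real (n choose m) * t (Suc m)) =
      t 0 + (\<Sum>m\<le>n. real (Suc n choose Suc m) * t (Suc m))"
    by (simp add: algebra_simps sum.distrib)
  also have "\<dots> = (\<Sum>m\<le>Suc n. real (Suc n choose m) * t m)"
    by (subst sum.atMost_Suc_shift) simp
  finally show ?case by (simp add: t_def)
qed


end

context
  fixes \<alpha> S \<delta> y0 z0 :: real and N :: nat
  assumes \<alpha>: "\<alpha> > 0" and N: "N \<ge> 2" and S: "\<alpha> * real N \<le> S" and \<delta>: "\<delta> > 0"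
    and y0: "\<And>k. \<delta> \<le> \<bar>y0 + real k\<bar>" and z0: "\<And>k. \<delta> \<le> \<bar>z0 + real k\<bar>"
begin

text \<open>In the product of two affine expressions the first order terms average as for a single
  factor. Only the product of both increments, of order \<open>\<alpha>\<^sup>2\<close>, has no
  closed form.\<close>

lemma mean_char_ratio_product_add_box:
  assumes r: "r \<in> row_functions n" and n: "n < N"
  shows "(\<Sum>i\<le>N. up_prob \<alpha> N r i *
            (char_ratio \<alpha> N (add_box r i) (y0 + real j) * char_ratio \<alpha> N (add_box r i) (z0 + real l))) =
         char_ratio \<alpha> N r (y0 + real j) * char_ratio \<alpha> N r (z0 + real l)
         - \<alpha> / (z0 + real l) * (char_ratio \<alpha> N r (y0 + real j) * char_ratio \<alpha> N r (z0 + real (Suc l)))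
         - \<alpha> / (y0 + real j) * (char_ratio \<alpha> N r (y0 + real (Suc j)) * char_ratio \<alpha> N r (z0 + real l))
         + \<alpha>\<^sup>2 * (\<Sum>i\<le>N. up_prob \<alpha> N r i *
             (char_ratio_omit \<alpha> N r i (y0 + real j) * char_ratio_omit \<alpha> N r i (z0 + real l)))"
proof -
  define p where "p = up_prob \<alpha> N r"
  define Y where "Y = char_ratio \<alpha> N r (y0 + real j)"
  define Z where "Z = char_ratio \<alpha> N r (z0 + real l)"
  define u where "u i = char_ratio_omit \<alpha> N r i (y0 + real j)" for i
  define v where "v i = char_ratio_omit \<alpha> N r i (z0 + real l)" for i
  have one: "(\<Sum>i\<le>N. p i) = 1" unfolding p_def by (rule sum_up_prob[OF \<alpha> row_functionsD(1)[OF r]])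
  have su: "(\<Sum>i\<le>N. p i * u i) = char_ratio \<alpha> N r (y0 + real (Suc j)) / (y0 + real j)"
    and sv: "(\<Sum>i\<le>N. p i * v i) = char_ratio \<alpha> N r (z0 + real (Suc l)) / (z0 + real l)"
    unfolding p_def u_def v_def
    by (rule sum_up_prob_omit_shifted[OF \<alpha> N \<delta> y0 assms] sum_up_prob_omit_shifted[OF \<alpha> N \<delta> z0 assms])+
  have "(\<Sum>i\<le>N. p i * (char_ratio \<alpha> N (add_box r i) (y0 + real j) * char_ratio \<alpha> N (add_box r i) (z0 + real l))) =
      (\<Sum>i\<le>N. p i * (Y * Z) - \<alpha> * Y * (p i * v i) - \<alpha> * Z * (p i * u i) + \<alpha>\<^sup>2 * (p i * (u i * v i)))"
    by (rule sum.cong)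
       (simp_all add: char_ratio_add_box Y_def Z_def u_def v_def algebra_simps power2_eq_square)
  also have "\<dots> = Y * Z - \<alpha> * Y * (\<Sum>i\<le>N. p i * v i) - \<alpha> * Z * (\<Sum>i\<le>N. p i * u i) +
      \<alpha>\<^sup>2 * (\<Sum>i\<le>N. p i * (u i * v i))"
    unfolding sum_subtractf sum.distrib sum_distrib_right[symmetric] sum_distrib_left[symmetric] one
    by simp
  finally show ?thesis
    unfolding su sv by (simp add: p_def Y_def Z_def u_def v_def mult_ac)
qed

text \<open>Induction uniform in both shifts: a step multiplies the bound by at most
  \<open>1 + 2 * \<alpha> / \<delta>\<close>, because of the two shifted covariances, and adds at
  most \<open>2 * \<alpha>\<^sup>2 * B\<^sup>2\<close>.\<close>

lemma abs_jack_cov_le: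
  assumes "n \<le> N"
  shows "\<bar>jack_cov \<alpha> N n (y0 + real j) (z0 + real l)\<bar> \<le>
         2 * \<alpha>\<^sup>2 * (exp (S / \<delta>) / \<delta>)\<^sup>2 * real n * (1 + 2 * \<alpha> / \<delta>) ^ n"
  using assms
proof (induction n arbitrary: j l)
  case 0
  have "y0 + real j + real k \<noteq> 0" "z0 + real l + real k \<noteq> 0" for k
    using shifted_distance[OF y0, of j k] shifted_distance[OF z0, of l k] \<delta> by auto
  then show ?case by (simp add: jack_cov_def jack_mean_0 char_ratio_def jcontent_def)
next
  case (Suc n)
  define B where "B = exp (S / \<delta>) / \<delta>"
  define q where "q = 1 + 2 * \<alpha> / \<delta>"
  define c where "c = 2 * \<alpha>\<^sup>2 * B\<^sup>2 * real n * q ^ n"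
  define R where "R = jack_mean \<alpha> n (\<lambda>r. \<Sum>i\<le>N. up_prob \<alpha> N r i *
    (char_ratio_omit \<alpha> N r i (y0 + real j) * char_ratio_omit \<alpha> N r i (z0 + real l)))"
  define e where "e j = jack_mean \<alpha> n (\<lambda>r. char_ratio \<alpha> N r (y0 + real j))" for j
  define f where "f l = jack_mean \<alpha> n (\<lambda>r. char_ratio \<alpha> N r (z0 + real l))" for l
  define C where "C j l = jack_cov \<alpha> N n (y0 + real j) (z0 + real l)" for j l
  define a where "a = \<alpha> / (y0 + real j)"
  define b where "b = \<alpha> / (z0 + real l)"
  have n: "n < N" "n \<le> N" using Suc.prems by auto
  have Sn: "\<alpha> * real n \<le> S"
    using S mult_left_mono[of "real n" "real N" \<alpha>] \<alpha> n by linarith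
  have y: "\<delta> \<le> \<bar>y0 + real j + real k\<bar>" and z: "\<delta> \<le> \<bar>z0 + real l + real k\<bar>" for j l k
    using shifted_distance[OF y0] shifted_distance[OF z0] by auto
  have a: "\<bar>a\<bar> \<le> \<alpha> / \<delta>" and b: "\<bar>b\<bar> \<le> \<alpha> / \<delta>"
    using y[of j 0] z[of l 0] \<alpha> \<delta> by (simp_all add: a_def b_def frac_le)
  have B0: "B \<ge> 0" using \<delta> by (simp add: B_def)
  have omit: "\<bar>char_ratio_omit \<alpha> N r i (y0 + real j) * char_ratio_omit \<alpha> N r i (z0 + real l)\<bar> \<le> B\<^sup>2"
    if "r \<in> row_functions n" "i \<le> N" for r i
    unfolding abs_mult power2_eq_square B_def using that
    by (intro mult_mono abs_char_ratio_omit_le[OF \<alpha> \<delta> y _ Sn n(2)] abs_char_ratio_omit_le[OF \<alpha> \<delta> z _ Sn n(2)])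
       (use \<delta> in auto)
  have "\<bar>\<Sum>i\<le>N. up_prob \<alpha> N r i *
    (char_ratio_omit \<alpha> N r i (y0 + real j) * char_ratio_omit \<alpha> N r i (z0 + real l))\<bar> \<le> B\<^sup>2"
    if r: "r \<in> row_functions n" for r
  proof -
    note nonneg = up_prob_nonneg[OF \<alpha> row_functionsD(1)[OF r]]
    have "\<bar>\<Sum>i\<le>N. up_prob \<alpha> N r i *
        (char_ratio_omit \<alpha> N r i (y0 + real j) * char_ratio_omit \<alpha> N r i (z0 + real l))\<bar> \<le>
      (\<Sum>i\<le>N. \<bar>up_prob \<alpha> N r i *
        (char_ratio_omit \<alpha> N r i (y0 + real j) * char_ratio_omit \<alpha> N r i (z0 + real l))\<bar>)"
      by (rule sum_abs)
    also have "\<dots> \<le> (\<Sum>i\<le>N. up_prob \<alpha> N r i * B\<^sup>2)"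
    proof (rule sum_mono)
      fix i assume i: "i \<in> {..N}"
      show "\<bar>up_prob \<alpha> N r i *
        (char_ratio_omit \<alpha> N r i (y0 + real j) * char_ratio_omit \<alpha> N r i (z0 + real l))\<bar> \<le> up_prob \<alpha> N r i * B\<^sup>2"
        unfolding abs_mult[of "up_prob \<alpha> N r i"]
        using nonneg[of i N] i omit[OF r, of i]
        by (simp add: mult_left_mono)
    qed
    also have "\<dots> = B\<^sup>2"
      unfolding sum_distrib_right[symmetric] sum_up_prob[OF \<alpha> row_functionsD(1)[OF r]] by simp
    finally show ?thesis .
  qed
  then have R: "\<bar>R\<bar> \<le> B\<^sup>2" unfolding R_def by (rule abs_jack_mean_le[OF \<alpha>])
  have "\<bar>e (Suc j)\<bar> \<le> exp (S / \<delta>)" "\<bar>f (Suc l)\<bar> \<le> exp (S / \<delta>)"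
    unfolding e_def f_def
    by (rule abs_jack_mean_le[OF \<alpha> abs_char_ratio_le[OF \<alpha> \<delta> y _ Sn n(2)]]
      abs_jack_mean_le[OF \<alpha> abs_char_ratio_le[OF \<alpha> \<delta> z _ Sn n(2)]]; assumption)+
  then have "\<bar>a\<bar> * \<bar>e (Suc j)\<bar> \<le> \<alpha> / \<delta> * exp (S / \<delta>)" "\<bar>b\<bar> * \<bar>f (Suc l)\<bar> \<le> \<alpha> / \<delta> * exp (S / \<delta>)"
    using a b \<alpha> \<delta> by (intro mult_mono; simp)+
  then have ef: "\<bar>a * e (Suc j)\<bar> \<le> \<alpha> * B" "\<bar>b * f (Suc l)\<bar> \<le> \<alpha> * B"
    by (simp_all add: abs_mult B_def)
  have "\<bar>(a * e (Suc j)) * (b * f (Suc l))\<bar> \<le> (\<alpha> * B) * (\<alpha> * B)"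
    unfolding abs_mult[of "a * _"] using \<alpha> B0 by (intro mult_mono ef) auto
  moreover have "\<bar>\<alpha>\<^sup>2 * R\<bar> \<le> \<alpha>\<^sup>2 * B\<^sup>2"
    unfolding abs_mult using R by (intro mult_mono) auto
  moreover have "(\<alpha> * B) * (\<alpha> * B) = \<alpha>\<^sup>2 * B\<^sup>2" by (simp add: power2_eq_square)
  ultimately have rem: "\<bar>\<alpha>\<^sup>2 * R - (a * e (Suc j)) * (b * f (Suc l))\<bar> \<le> 2 * \<alpha>\<^sup>2 * B\<^sup>2"
    by linarith
  \<comment> \<open>The product of the two new means contributes
    \<open>(a * e (Suc j)) * (b * f (Suc l))\<close>, which joins the second order term
    \<open>\<alpha>\<^sup>2 * R\<close> in the remainder.\<close>
  have "jack_cov \<alpha> N (Suc n) (y0 + real j) (z0 + real l) =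
      C j l - b * C j (Suc l) - a * C (Suc j) l + (\<alpha>\<^sup>2 * R - (a * e (Suc j)) * (b * f (Suc l)))"
  proof -
    have "jack_mean \<alpha> (Suc n) (\<lambda>r. char_ratio \<alpha> N r (y0 + real j) * char_ratio \<alpha> N r (z0 + real l)) =
      jack_mean \<alpha> n (\<lambda>r. char_ratio \<alpha> N r (y0 + real j) * char_ratio \<alpha> N r (z0 + real l)
         - b * (char_ratio \<alpha> N r (y0 + real j) * char_ratio \<alpha> N r (z0 + real (Suc l)))
         - a * (char_ratio \<alpha> N r (y0 + real (Suc j)) * char_ratio \<alpha> N r (z0 + real l))
         + \<alpha>\<^sup>2 * (\<Sum>i\<le>N. up_prob \<alpha> N r i *
             (char_ratio_omit \<alpha> N r i (y0 + real j) * char_ratio_omit \<alpha> N r i (z0 + real l))))"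
      unfolding jack_mean_Suc[OF \<alpha> n(1) N] a_def b_def
      by (rule jack_mean_cong) (rule mean_char_ratio_product_add_box[OF _ n(1)])
    moreover have "jack_mean \<alpha> (Suc n) (\<lambda>r. char_ratio \<alpha> N r (y0 + real j)) = e j - a * e (Suc j)"
      unfolding e_def a_def by (rule jack_mean_char_ratio_Suc[OF \<alpha> N \<delta> y0 n(1)])
    moreover have "jack_mean \<alpha> (Suc n) (\<lambda>r. char_ratio \<alpha> N r (z0 + real l)) = f l - b * f (Suc l)"
      unfolding f_def b_def by (rule jack_mean_char_ratio_Suc[OF \<alpha> N \<delta> z0 n(1)])
    moreover define P where "P j l = jack_mean \<alpha> n (\<lambda>r. char_ratio \<alpha> N r (y0 + real j) * char_ratio \<alpha> N r (z0 + real l))" for j l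
    moreover have CP: "C j l = P j l - e j * f l" for j l
      unfolding C_def P_def e_def f_def jack_cov_def ..
    ultimately have "jack_cov \<alpha> N (Suc n) (y0 + real j) (z0 + real l) =
        P j l - b * P j (Suc l) - a * P (Suc j) l + \<alpha>\<^sup>2 * R - (e j - a * e (Suc j)) * (f l - b * f (Suc l))"
      unfolding jack_cov_def by (simp only: jack_mean_linear R_def)
    then show ?thesis
      unfolding CP by (simp add: algebra_simps)
  qed
  moreover have C: "\<bar>C j l\<bar> \<le> c" for j l
    using Suc.IH[OF n(2), of j l] by (simp add: C_def c_def B_def q_def)
  have c0: "c \<ge> 0" using \<alpha> \<delta> by (simp add: c_def q_def)
  have "\<bar>b * C j (Suc l)\<bar> \<le> \<alpha> / \<delta> * c" "\<bar>a * C (Suc j) l\<bar> \<le> \<alpha> / \<delta> * c"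
    unfolding abs_mult by (intro mult_mono a b C; use \<alpha> \<delta> in simp)+
  ultimately have "\<bar>jack_cov \<alpha> N (Suc n) (y0 + real j) (z0 + real l)\<bar> \<le>
      c + \<alpha> / \<delta> * c + \<alpha> / \<delta> * c + 2 * \<alpha>\<^sup>2 * B\<^sup>2"
    using rem C[of j l] by linarith
  also have "\<dots> = c * q + 2 * \<alpha>\<^sup>2 * B\<^sup>2" by (simp add: q_def algebra_simps)
  \<comment> \<open>Inflating the new error by \<open>q ^ Suc n\<close> gives it the shape of the
    accumulated ones.\<close>
  also have "\<dots> \<le> c * q + 2 * \<alpha>\<^sup>2 * B\<^sup>2 * q ^ Suc n"
    using mult_left_mono[OF one_le_power[of q "Suc n"], of "2 * \<alpha>\<^sup>2 * B\<^sup>2"] \<alpha> \<delta>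
    by (simp add: q_def)
  also have "\<dots> = 2 * \<alpha>\<^sup>2 * B\<^sup>2 * real (Suc n) * q ^ Suc n"
    by (simp add: c_def algebra_simps)
  finally show ?case by (simp only: B_def q_def)
qed

text \<open>\<open>\<alpha>\<^sup>2 * N\<close> is \<alpha> times the bounded area and the growth
  factor is at most \<open>exp (2 * S / \<delta>)\<close>. The factor \<alpha> that remains makes
  the variances vanish in the limit.\<close>

lemma abs_jack_cov_same_size_le:
  "\<bar>jack_cov \<alpha> N N y0 z0\<bar> \<le> \<alpha> * (2 * S * (exp (S / \<delta>) / \<delta>)\<^sup>2 * exp (2 * S / \<delta>))"
proof -
  let ?B = "(exp (S / \<delta>) / \<delta>)\<^sup>2"
  have "(1 + 2 * \<alpha> / \<delta>) ^ N \<le> exp (2 * \<alpha> / \<delta>) ^ N"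
    using \<alpha> \<delta> by (intro power_mono exp_ge_add_one_self) auto
  also have "\<dots> = exp (2 * (\<alpha> * real N) / \<delta>)" by (simp add: exp_of_nat_mult[symmetric] mult_ac)
  also have "\<dots> \<le> exp (2 * S / \<delta>)" using S \<delta> by (simp add: divide_right_mono)
  finally have q: "(1 + 2 * \<alpha> / \<delta>) ^ N \<le> exp (2 * S / \<delta>)" .
  have S0: "S \<ge> 0" using S \<alpha> by (smt (verit) mult_nonneg_nonneg of_nat_0_le_iff)
  have "\<bar>jack_cov \<alpha> N N y0 z0\<bar> \<le> 2 * \<alpha> * ?B * (\<alpha> * real N) * (1 + 2 * \<alpha> / \<delta>) ^ N"
    using abs_jack_cov_le[of N 0 0] by (simp add: power2_eq_square mult_ac)
  also have "\<dots> \<le> 2 * \<alpha> * ?B * S * exp (2 * S / \<delta>)"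
    using \<alpha> \<delta> S S0 q by (intro mult_mono) auto
  finally show ?thesis by (simp add: mult_ac)
qed

end

subsection \<open>Law of large numbers\<close>

text \<open>The hypergeometric series \<open>0F1(; y; - s)\<close>.\<close>

definition limit_ratio :: "real \<Rightarrow> real \<Rightarrow> real" where
  "limit_ratio s y = (\<Sum>m. (- s) ^ m / fact m / pochhammer y m)"

text \<open>Powers of \<open>a\<close> are distributed over the falling factorial: with
  \<open>a * d\<close> tending to \<open>s\<close> and \<open>a\<close> to 0, each factor tends to
  \<open>- s\<close> and is bounded, so both limit and majorant can be read off factorwise.\<close>

lemma binomial_power_eq_prod:
  "real (d choose m) * (- a) ^ m = (\<Prod>i=0..<m. a * real i - a * real d) / fact m"
proof -
  have "(\<Prod>i=0..<m. a * real i - a * real d) = (\<Prod>i=0..<m. (- a) * (real d - real i))"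
    by (simp add: algebra_simps)
  also have "\<dots> = (- a) ^ m * (\<Prod>i=0..<m. real d - real i)" by (simp only: prod.distrib) simp
  finally show ?thesis by (simp add: binomial_gbinomial gbinomial_prod_rev)
qed

lemma binomial_power_tendsto:
  fixes \<alpha> :: "nat \<Rightarrow> real"
  assumes "\<alpha> \<longlonglongrightarrow> 0" "(\<lambda>d. \<alpha> d * real d) \<longlonglongrightarrow> s"
  shows "(\<lambda>d. real (d choose m) * (- \<alpha> d) ^ m) \<longlonglongrightarrow> (- s) ^ m / fact m"
proof -
  have "(\<lambda>d. (\<Prod>i=0..<m. \<alpha> d * real i - \<alpha> d * real d) / fact m) \<longlonglongrightarrow> (\<Prod>i=0..<m. 0 * real i - s) / fact m"
    by (intro tendsto_intros assms) auto
  then show ?thesis by (simp add: binomial_power_eq_prod)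
qed

lemma abs_binomial_power_le:
  assumes "a \<ge> 0" "a * real d \<le> S"
  shows "\<bar>real (d choose m) * (- a) ^ m\<bar> \<le> S ^ m / fact m"
proof (cases "m \<le> d")
  case True
  have "\<bar>a * real i - a * real d\<bar> \<le> S" if "i < m" for i
  proof -
    have "a * real i \<le> a * real d" using that True assms by (intro mult_left_mono) auto
    moreover have "a * real i \<ge> 0" using assms by simp
    ultimately show ?thesis using assms(2) by linarith
  qed
  then have "(\<Prod>i=0..<m. \<bar>a * real i - a * real d\<bar>) \<le> (\<Prod>i=0..<m. S)"
    by (intro prod_mono) auto
  then show ?thesis by (simp add: binomial_power_eq_prod abs_prod divide_right_mono)
next
  case False
  have "S \<ge> 0" using assms by (smt (verit) mult_nonneg_nonneg of_nat_0_le_iff)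
  with False show ?thesis by (simp add: binomial_eq_0)
qed

lemma abs_pochhammer_ge:
  fixes \<delta> y :: real
  assumes "\<delta> > 0" "\<And>k. \<delta> \<le> \<bar>y + real k\<bar>"
  shows "\<bar>pochhammer y m\<bar> \<ge> \<delta> ^ m"
proof -
  have "(\<Prod>i=0..<m. \<delta>) \<le> (\<Prod>i=0..<m. \<bar>y + real i\<bar>)" using assms by (intro prod_mono) auto
  then show ?thesis by (simp add: pochhammer_prod abs_prod)
qed

text \<open>Dominated convergence for series (Tannery) with majorant
  \<open>((s + 1) / \<delta>) ^ m / fact m\<close>; \<open>s + 1\<close> serves as an eventual upper
  bound of \<open>\<alpha> d * d\<close>.\<close>

lemma binomial_series_tendsto:
  fixes \<alpha> :: "nat \<Rightarrow> real"
  assumes pos: "\<And>d. d \<ge> 1 \<Longrightarrow> \<alpha> d > 0"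
    and lim: "\<alpha> \<longlonglongrightarrow> 0" "(\<lambda>d. \<alpha> d * real d) \<longlonglongrightarrow> s"
    and \<delta>: "\<delta> > 0" "\<And>k. \<delta> \<le> \<bar>y + real k\<bar>"
  shows "(\<lambda>d. \<Sum>m\<le>d. real (d choose m) * (- \<alpha> d) ^ m / pochhammer y m) \<longlonglongrightarrow> limit_ratio s y"
proof -
  define t where "t m d = real (d choose m) * (- \<alpha> d) ^ m / pochhammer y m" for m d
  define K where "K m = ((s + 1) / \<delta>) ^ m / fact m" for m
  have ev: "eventually (\<lambda>d. d \<ge> 1 \<and> \<alpha> d * real d \<le> s + 1) sequentially"
    using order_tendstoD(2)[OF lim(2) less_add_one] eventually_ge_at_top[of 1]
    by eventually_elim auto
  have bound: "norm (t m d) \<le> K m" if "d \<ge> 1 \<and> \<alpha> d * real d \<le> s + 1" for m d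
  proof -
    have "\<bar>t m d\<bar> = \<bar>real (d choose m) * (- \<alpha> d) ^ m\<bar> / \<bar>pochhammer y m\<bar>"
      by (simp only: t_def abs_divide)
    also have "\<dots> \<le> ((s + 1) ^ m / fact m) / \<delta> ^ m"
      using that pos[of d] \<delta> abs_binomial_power_le[of "\<alpha> d" d "s + 1" m]
      by (intro frac_le abs_pochhammer_ge) (auto intro: order_trans[OF abs_ge_zero])
    finally show ?thesis by (simp add: K_def power_divide field_simps)
  qed
  have "(\<lambda>d. t m d) \<longlonglongrightarrow> (- s) ^ m / fact m / pochhammer y m" for m
    unfolding t_def divide_inverse
    by (intro tendsto_intros binomial_power_tendsto[OF lim, unfolded divide_inverse])
  moreover have "eventually (\<lambda>(m, d). norm (t m d) \<le> K m) (at_top \<times>\<^sub>F sequentially)"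
    using eventually_prodI[OF always_eventually ev, of "\<lambda>_. True" at_top]
    by (rule eventually_mono) (use bound in \<open>auto simp del: of_nat_le_iff\<close>)
  moreover have "summable K"
    unfolding K_def using summable_exp[of "(s + 1) / \<delta>"] by (simp add: field_simps)
  ultimately have "(\<lambda>d. suminf (\<lambda>m. t m d)) \<longlonglongrightarrow> limit_ratio s y"
    using tannerys_theorem[of t "\<lambda>m. (- s) ^ m / fact m / pochhammer y m" sequentially K]
    by (simp add: limit_ratio_def)
  moreover have "suminf (\<lambda>m. t m d) = (\<Sum>m\<le>d. t m d)" for d
    by (rule suminf_finite) (auto simp: t_def not_le)
  ultimately show ?thesis by (simp add: t_def)
qed

lemma distance_to_integers:
  fixes y :: real
  assumes "y \<notin> \<int>"
  obtains \<delta> where "\<delta> > 0" "\<And>k::nat. \<delta> \<le> \<bar>y + real k\<bar>"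
proof
  let ?\<delta> = "min (frac y) (1 - frac y)"
  show "?\<delta> > 0" using assms frac_lt_1[of y] frac_gt_0_iff[of y] by auto
  fix k :: nat
  show "?\<delta> \<le> \<bar>y + real k\<bar>"
  proof (cases "- int k \<le> \<lfloor>y\<rfloor>")
    case True
    then have "real_of_int \<lfloor>y\<rfloor> \<ge> - real k" by linarith
    then show ?thesis by (simp add: frac_def min_def) linarith
  next
    case False
    then have "real_of_int \<lfloor>y\<rfloor> + 1 \<le> - real k" by linarith
    then show ?thesis by (simp add: frac_def min_def) linarith
  qed
qed

lemma jack_chebyshev:
  assumes "\<alpha> > 0" "\<epsilon> > 0" and m_def: "m = jack_mean \<alpha> n X"
  shows "jack_mean \<alpha> n (\<lambda>r. of_bool (\<bar>X r - m\<bar> > \<epsilon>)) \<le>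
    (jack_mean \<alpha> n (\<lambda>r. X r * X r) - m * m) / \<epsilon>\<^sup>2"
proof -
  have "jack_mean \<alpha> n (\<lambda>r. of_bool (\<bar>X r - m\<bar> > \<epsilon>)) \<le> jack_mean \<alpha> n (\<lambda>r. inverse (\<epsilon>\<^sup>2) * (X r - m)\<^sup>2)"
  proof (rule jack_mean_mono[OF assms(1)])
    fix r
    show "of_bool (\<bar>X r - m\<bar> > \<epsilon>) \<le> inverse (\<epsilon>\<^sup>2) * (X r - m)\<^sup>2"
    proof (cases "\<bar>X r - m\<bar> > \<epsilon>")
      case True
      then have "\<epsilon>\<^sup>2 \<le> (X r - m)\<^sup>2" using assms(2) by (simp add: abs_le_square_iff[symmetric])
      with True assms(2) show ?thesis by (simp add: field_simps)
    qed simp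
  qed
  also have "\<dots> = inverse (\<epsilon>\<^sup>2) * jack_mean \<alpha> n (\<lambda>r. X r * X r - 2 * m * X r + m * m)"
  proof -
    have "jack_mean \<alpha> n (\<lambda>r. (X r - m)\<^sup>2) = jack_mean \<alpha> n (\<lambda>r. X r * X r - 2 * m * X r + m * m)"
      by (rule jack_mean_cong) (simp add: power2_eq_square algebra_simps)
    then show ?thesis by (simp only: jack_mean_linear(3))
  qed
  also have "\<dots> = inverse (\<epsilon>\<^sup>2) * (jack_mean \<alpha> n (\<lambda>r. X r * X r) - 2 * m * m + m * m)"
    unfolding jack_mean_linear jack_mean_const[OF assms(1)] by (simp only: m_def)
  finally show ?thesis by (simp add: field_simps)
qed

text \<open>One half of \<epsilon> absorbs the distance of the mean to its limit, the other enters
  Chebyshev's inequality. The row bound is taken equal to the number of boxes.\<close>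

lemma char_ratio_law_of_large_numbers:
  fixes \<alpha> :: "nat \<Rightarrow> real"
  assumes pos: "\<And>d. d \<ge> 1 \<Longrightarrow> \<alpha> d > 0"
    and lim: "\<alpha> \<longlonglongrightarrow> 0" "(\<lambda>d. \<alpha> d * real d) \<longlonglongrightarrow> s"
    and y: "y \<notin> \<int>" and \<epsilon>: "\<epsilon> > 0"
  shows "(\<lambda>d. jack_mean (\<alpha> d) d (\<lambda>r. of_bool (\<bar>char_ratio (\<alpha> d) d r y - limit_ratio s y\<bar> > \<epsilon>))) \<longlonglongrightarrow> 0"
proof -
  obtain \<delta> where \<delta>: "\<delta> > 0" "\<And>k::nat. \<delta> \<le> \<bar>y + real k\<bar>"
    using distance_to_integers[OF y] by blast
  define m where "m d = jack_mean (\<alpha> d) d (\<lambda>r. char_ratio (\<alpha> d) d r y)" for d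
  define C where "C = 2 * (s + 1) * (exp ((s + 1) / \<delta>) / \<delta>)\<^sup>2 * exp (2 * (s + 1) / \<delta>)"
  have ev: "eventually (\<lambda>d. d \<ge> 2 \<and> \<alpha> d * real d \<le> s + 1) sequentially"
    using order_tendstoD(2)[OF lim(2) less_add_one] eventually_ge_at_top[of 2]
    by eventually_elim auto
  have "eventually (\<lambda>d. (\<Sum>m\<le>d. real (d choose m) * (- \<alpha> d) ^ m / pochhammer y m) = m d) sequentially"
    using ev
  proof eventually_elim
    case (elim d)
    with jack_mean_char_ratio[OF pos[of d] _ \<delta>, of d d 0] show ?case by (simp add: m_def)
  qed
  with binomial_series_tendsto[OF pos lim \<delta>] have "m \<longlonglongrightarrow> limit_ratio s y"
    by (rule Lim_transform_eventually)
  then have evm: "eventually (\<lambda>d. \<bar>m d - limit_ratio s y\<bar> < \<epsilon> / 2) sequentially"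
    using tendstoD[of m "limit_ratio s y" sequentially "\<epsilon> / 2"] \<epsilon> by (simp add: dist_real_def)
  show ?thesis
  proof (rule tendsto_sandwich[OF _ _ tendsto_const])
    show "eventually (\<lambda>d. 0 \<le> jack_mean (\<alpha> d) d (\<lambda>r. of_bool (\<bar>char_ratio (\<alpha> d) d r y - limit_ratio s y\<bar> > \<epsilon>))) sequentially"
      using ev
    proof eventually_elim
      case (elim d)
      show ?case
        unfolding jack_mean_def
        using elim pos[of d] by (intro sum_nonneg mult_nonneg_nonneg jack_weight_nonneg) auto
    qed
    show "eventually (\<lambda>d. jack_mean (\<alpha> d) d (\<lambda>r. of_bool (\<bar>char_ratio (\<alpha> d) d r y - limit_ratio s y\<bar> > \<epsilon>))
        \<le> \<alpha> d * C / (\<epsilon> / 2)\<^sup>2) sequentially"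
      using ev evm
    proof eventually_elim
      case (elim d)
      have a: "\<alpha> d > 0" using elim pos[of d] by simp
      have "jack_mean (\<alpha> d) d (\<lambda>r. of_bool (\<bar>char_ratio (\<alpha> d) d r y - limit_ratio s y\<bar> > \<epsilon>)) \<le>
        jack_mean (\<alpha> d) d (\<lambda>r. of_bool (\<bar>char_ratio (\<alpha> d) d r y - m d\<bar> > \<epsilon> / 2))"
      proof (rule jack_mean_mono[OF a])
        fix r
        have "\<bar>char_ratio (\<alpha> d) d r y - limit_ratio s y\<bar> \<le>
            \<bar>char_ratio (\<alpha> d) d r y - m d\<bar> + \<bar>m d - limit_ratio s y\<bar>" by linarith
        with elim show "of_bool (\<bar>char_ratio (\<alpha> d) d r y - limit_ratio s y\<bar> > \<epsilon>) \<le>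
            (of_bool (\<bar>char_ratio (\<alpha> d) d r y - m d\<bar> > \<epsilon> / 2) :: real)"
          by (auto simp: of_bool_def)
      qed
      also have "\<dots> \<le> jack_cov (\<alpha> d) d d y y / (\<epsilon> / 2)\<^sup>2"
        using jack_chebyshev[OF a _ m_def, of "\<epsilon> / 2"] \<epsilon> by (simp add: jack_cov_def m_def)
      also have "\<dots> \<le> \<alpha> d * C / (\<epsilon> / 2)\<^sup>2"
        using abs_jack_cov_same_size_le[OF a _ _ \<delta>(1) \<delta>(2) \<delta>(2), of d "s + 1"] elim
        unfolding C_def by (intro divide_right_mono) auto
      finally show ?case .
    qed
    show "(\<lambda>d. \<alpha> d * C / (\<epsilon> / 2)\<^sup>2) \<longlonglongrightarrow> 0"
      using tendsto_mult_left_zero[OF lim(1), of "C / (\<epsilon> / 2)\<^sup>2"] by simp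
  qed
qed

subsection \<open>Zeros of the limit\<close>

text \<open>Regularisation of \<open>limit_ratio\<close> that is finite at every \<open>y\<close>,
  since \<open>rGamma\<close> has no poles. For \<open>s = t\<^sup>2\<close> with
  \<open>t > 0\<close> it is \<open>t powr (1 - y) * bessel_J (y - 1) (2 * t)\<close>.\<close>

definition limit_char :: "real \<Rightarrow> real \<Rightarrow> real" where
  "limit_char s y = (\<Sum>m. (- s) ^ m / fact m * rGamma (y + real m))"

text \<open>Compactness gives a bound up to 2. Beyond,
  \<open>rGamma (x - 1) = (x - 1) * rGamma x\<close> with \<open>x - 1 \<ge> 1\<close> shows that
  unit shifts to the right do not increase the modulus.\<close>

lemma rGamma_bounded_above_interval:
  fixes A :: real
  assumes "A \<ge> 0"
  obtains B where "\<And>x. x \<ge> - A \<Longrightarrow> \<bar>rGamma x\<bar> \<le> B"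
proof -
  have "bounded (rGamma ` {-A..2::real})"
    by (intro compact_imp_bounded compact_continuous_image continuous_intros) simp
  then obtain B where B: "\<forall>x\<in>{-A..2}. \<bar>rGamma x\<bar> \<le> B"
    by (auto simp: bounded_iff)
  have "\<forall>x\<in>{-A..2 + real n}. \<bar>rGamma x\<bar> \<le> B" for n
  proof (induction n)
    case (Suc n)
    show ?case
    proof
      fix x assume x: "x \<in> {-A..2 + real (Suc n)}"
      show "\<bar>rGamma x\<bar> \<le> B"
      proof (cases "x \<le> 2")
        case True
        then show ?thesis using B x by auto
      next
        case False
        then have "\<bar>rGamma (x - 1)\<bar> \<le> B" using x Suc assms by auto
        also have "rGamma (x - 1) = (x - 1) * rGamma x" using rGamma_plus1[of "x - 1"] by simp
        finally have "(x - 1) * \<bar>rGamma x\<bar> \<le> B" using False by (simp add: abs_mult)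
        moreover have "1 * \<bar>rGamma x\<bar> \<le> (x - 1) * \<bar>rGamma x\<bar>"
          using False by (intro mult_right_mono) auto
        ultimately show ?thesis by simp
      qed
    qed
  qed (use B in simp)
  moreover have "\<exists>n. x \<le> 2 + real n" for x
    using real_arch_simple[of "x - 2"] by (auto simp: algebra_simps)
  ultimately have "\<bar>rGamma x\<bar> \<le> B" if "x \<ge> - A" for x
    using that by (metis atLeastAtMost_iff)
  then show ?thesis using that by blast
qed

lemma continuous_limit_char: "isCont (limit_char s) y"
proof -
  define A where "A = \<bar>y\<bar> + 1"
  obtain B where B: "\<And>x. x \<ge> - A \<Longrightarrow> \<bar>rGamma x\<bar> \<le> B"
    using rGamma_bounded_above_interval[of A] by (auto simp: A_def)
  have B0: "B \<ge> 0" using B[of 0] by (simp add: A_def)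
  have "uniform_limit {-A<..<A} (\<lambda>n x. \<Sum>m<n. (- s) ^ m / fact m * rGamma (x + real m)) (limit_char s) sequentially"
    unfolding limit_char_def
  proof (rule Weierstrass_m_test)
    show "norm ((- s) ^ m / fact m * rGamma (x + real m)) \<le> \<bar>s\<bar> ^ m / fact m * B"
      if "x \<in> {-A<..<A}" for m x
      using B[of "x + real m"] that
      by (simp add: abs_mult power_abs mult_left_mono divide_right_mono)
    show "summable (\<lambda>m. \<bar>s\<bar> ^ m / fact m * B)"
      using summable_mult2[OF summable_exp[of "\<bar>s\<bar>"], of B] by (simp add: field_simps)
  qed
  then have "continuous_on {-A<..<A} (limit_char s)"
    by (rule uniform_limit_theorem[rotated])
       (auto intro!: always_eventually continuous_at_imp_continuous_on continuous_intros)
  then show ?thesis by (rule continuous_on_interior) (auto simp: A_def)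
qed

lemma limit_char_eq:
  assumes "y \<notin> \<int>"
  shows "limit_char s y = rGamma y * limit_ratio s y"
proof -
  have nz: "pochhammer y m \<noteq> 0" for m
  proof
    assume "pochhammer y m = 0"
    then obtain k where "y = - real k" by (auto simp: pochhammer_eq_0_iff)
    with assms show False by simp
  qed
  obtain \<delta> where \<delta>: "\<delta> > 0" "\<And>k::nat. \<delta> \<le> \<bar>y + real k\<bar>"
    using distance_to_integers[OF assms] by blast
  have "summable (\<lambda>m. (- s) ^ m / fact m / pochhammer y m)"
  proof (rule summable_comparison_test)
    show "\<exists>N. \<forall>m\<ge>N. norm ((- s) ^ m / fact m / pochhammer y m) \<le> (\<bar>s\<bar> / \<delta>) ^ m / fact m"
    proof (intro exI allI impI)
      fix m :: nat
      have "norm ((- s) ^ m / fact m / pochhammer y m) = (\<bar>s\<bar> ^ m / fact m) / \<bar>pochhammer y m\<bar>"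
        by (simp add: abs_mult power_abs)
      also have "\<dots> \<le> (\<bar>s\<bar> ^ m / fact m) / \<delta> ^ m"
        using \<delta> by (intro frac_le abs_pochhammer_ge) auto
      finally show "norm ((- s) ^ m / fact m / pochhammer y m) \<le> (\<bar>s\<bar> / \<delta>) ^ m / fact m"
        by (simp add: power_divide field_simps)
    qed
    show "summable (\<lambda>m. (\<bar>s\<bar> / \<delta>) ^ m / fact m)"
      using summable_exp[of "\<bar>s\<bar> / \<delta>"] by (simp add: field_simps)
  qed
  then have "rGamma y * limit_ratio s y = (\<Sum>m. rGamma y * ((- s) ^ m / fact m / pochhammer y m))"
    unfolding limit_ratio_def by (rule suminf_mult[symmetric])
  also have "\<dots> = limit_char s y"
    unfolding limit_char_def
  proof (rule suminf_cong)
    fix m show "rGamma y * ((- s) ^ m / fact m / pochhammer y m) = (- s) ^ m / fact m * rGamma (y + real m)"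
      using pochhammer_rGamma[of y m] nz[of m] by (simp add: field_simps)
  qed
  finally show ?thesis ..
qed

section \<open>From product bounds to zeros\<close>

lemma dense_nonneg_imp_nonneg:
  fixes h :: "real \<Rightarrow> real"
  assumes cont: "isCont h y" and dense: "\<And>a b::real. a < b \<Longrightarrow> \<exists>z\<in>D. a < z \<and> z < b"
    and nonneg: "\<And>z. z \<in> D \<Longrightarrow> a < z \<Longrightarrow> z < b \<Longrightarrow> 0 \<le> h z" and y: "a < y" "y < b"
  shows "0 \<le> h y"
proof (rule ccontr)
  assume "\<not> 0 \<le> h y"
  then have "eventually (\<lambda>z. h z < 0) (at y)"
    using cont by (intro order_tendstoD(2)[of h "h y"]) (auto simp: isCont_def)
  then obtain e where e: "e > 0" "\<And>z. z \<noteq> y \<Longrightarrow> dist z y < e \<Longrightarrow> h z < 0"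
    by (auto simp: eventually_at)
  obtain z where z: "z \<in> D" "y < z" "z < min b (y + e)"
    using dense[of y "min b (y + e)"] y e(1) by auto
  then show False using e(2)[of z] nonneg[of z] y by (auto simp: dist_real_def)
qed

text \<open>From row \<open>K\<close> on the denominators \<open>z + i\<close> are at least
  \<open>2 * S + 2\<close>, while the \<open>a * r i\<close> sum to at most \<open>S\<close>; by
  Weierstrass' product inequality the tail lies between 1/2 and 1. The first \<open>K\<close>
  denominators turn \<open>rGamma z\<close> into the positive \<open>rGamma (z + K)\<close>. So the
  first \<open>K\<close> contents fix the modulus up to a factor 2.\<close>

lemma char_ratio_rGamma_bounds:
  assumes a: "a > 0" and r: "r \<in> row_functions n" and S: "a * real n \<le> S" and K: "K \<le> n"
    and z: "z \<notin> \<int>" "z + real K \<ge> 2 * S + 2"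
  defines "G \<equiv> rGamma (z + real K) * \<bar>\<Prod>i<K. z - jcontent a r i\<bar>"
  shows "\<bar>rGamma z * char_ratio a n r z\<bar> \<le> G" "G / 2 \<le> \<bar>rGamma z * char_ratio a n r z\<bar>"
proof -
  have nz: "z + real k \<noteq> 0" for k
  proof
    assume "z + real k = 0" then have "z = - real k" by simp
    with z(1) show False by simp
  qed
  have S0: "S \<ge> 0" using a S by (smt (verit) mult_nonneg_nonneg of_nat_0_le_iff)
  define T where "T = (\<Prod>i\<in>{K..n}. 1 - a * real (r i) / (z + real i))"
  have "a * real (\<Sum>i\<le>n. r i) \<le> S"
    using sum_row_function[OF r, of "Suc n"] S by (simp add: lessThan_Suc_atMost)
  moreover have "(\<Sum>i\<in>{K..n}. a * real (r i)) \<le> (\<Sum>i\<le>n. a * real (r i))"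
    using a by (intro sum_mono2) auto
  ultimately have sumu: "(\<Sum>i\<in>{K..n}. a * real (r i)) \<le> S" by (simp add: sum_distrib_left)
  have f: "0 \<le> a * real (r i) / (z + real i)" "a * real (r i) / (z + real i) \<le> a * real (r i) / (2 * S + 2)"
    if "i \<in> {K..n}" for i
    using that z(2) a S0 by (auto intro!: divide_left_mono divide_nonneg_nonneg mult_pos_pos)
  have "(\<Sum>i\<in>{K..n}. a * real (r i) / (z + real i)) \<le> (\<Sum>i\<in>{K..n}. a * real (r i) / (2 * S + 2))"
    using f by (intro sum_mono) auto
  also have "\<dots> = (\<Sum>i\<in>{K..n}. a * real (r i)) / (2 * S + 2)" by (simp add: sum_divide_distrib)
  also have "\<dots> \<le> S / (2 * S + 2)" using sumu S0 by (intro divide_right_mono) auto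
  also have "\<dots> \<le> 1 / 2" using S0 by (simp add: field_simps)
  finally have half: "(\<Sum>i\<in>{K..n}. a * real (r i) / (z + real i)) \<le> 1 / 2" .
  have le1: "a * real (r i) / (z + real i) \<le> 1" if "i \<in> {K..n}" for i
  proof -
    have "a * real (r i) / (z + real i) \<le> (\<Sum>i\<in>{K..n}. a * real (r i) / (z + real i))"
      using f(1) that by (intro member_le_sum) auto
    with half show ?thesis by simp
  qed
  have "1 - (\<Sum>i\<in>{K..n}. a * real (r i) / (z + real i)) \<le> T"
    unfolding T_def using f(1) le1 by (intro Weierstrass_prod_ineq) auto
  with half have T2: "1 / 2 \<le> T" by simp
  have T1: "T \<le> 1" unfolding T_def using f(1) le1 by (intro prod_le_1) auto
  have "{..n} = {..<K} \<union> {K..n}" using K by auto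
  then have "char_ratio a n r z =
      (\<Prod>i<K. (z - jcontent a r i) / (z + real i)) * (\<Prod>i\<in>{K..n}. (z - jcontent a r i) / (z + real i))"
    by (simp only: char_ratio_as_prod) (rule prod.union_disjoint, auto)
  also have "(\<Prod>i\<in>{K..n}. (z - jcontent a r i) / (z + real i)) = T"
    unfolding T_def by (rule prod.cong) (use nz in \<open>auto simp: jcontent_def field_simps\<close>)
  also have "(\<Prod>i<K. (z - jcontent a r i) / (z + real i)) = (\<Prod>i<K. z - jcontent a r i) / pochhammer z K"
    by (simp add: prod_dividef pochhammer_prod lessThan_atLeast0)
  finally have "rGamma z * char_ratio a n r z = rGamma (z + real K) * (\<Prod>i<K. z - jcontent a r i) * T"
    using pochhammer_rGamma[of z K] nz by (simp add: pochhammer_prod)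
  moreover have "rGamma (z + real K) > 0"
    using z(2) S0 by (simp add: rGamma_inverse_Gamma)
  ultimately have e: "\<bar>rGamma z * char_ratio a n r z\<bar> = G * T" and G0: "G \<ge> 0"
    using T2 by (simp_all add: abs_mult G_def)
  show "\<bar>rGamma z * char_ratio a n r z\<bar> \<le> G" "G / 2 \<le> \<bar>rGamma z * char_ratio a n r z\<bar>"
    unfolding e using mult_left_mono[OF T1 G0] mult_left_mono[OF T2 G0] by auto
qed

text \<open>Both bounds pass to the limit on the dense set \<open>D\<close>, and to all points by
  continuity. The upper bound makes every \<open>v i - i\<close> a zero, the lower bound excludes
  other zeros.\<close>

lemma limit_char_eq_0_iff:
  fixes a :: "nat \<Rightarrow> real" and n :: "nat \<Rightarrow> nat" and r :: "nat \<Rightarrow> nat \<Rightarrow> nat"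
  assumes a: "\<And>k. a k > 0" and r: "\<And>k. r k \<in> row_functions (n k)"
    and n: "filterlim n at_top sequentially" and S: "\<And>k. a k * real (n k) \<le> S"
    and v: "\<And>i. (\<lambda>k. a k * real (r k i)) \<longlonglongrightarrow> v i"
    and D: "D \<inter> \<int> = {}" "\<And>a b::real. a < b \<Longrightarrow> \<exists>z\<in>D. a < z \<and> z < b"
    and lim: "\<And>z. z \<in> D \<Longrightarrow> (\<lambda>k. char_ratio (a k) (n k) (r k) z) \<longlonglongrightarrow> limit_ratio s z"
  shows "limit_char s y = 0 \<longleftrightarrow> (\<exists>i. y = v i - real i)"
proof -
  define A where "A = \<bar>y\<bar> + 1"
  \<comment> \<open>Large enough for the tail estimate on the whole interval \<open>(-A, A)\<close>,
    and for \<open>y = v i - i\<close> to force \<open>i < K\<close>.\<close>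
  obtain K :: nat where K: "real K \<ge> A + 2 * S + 2" using real_arch_simple by blast
  define G where "G z = rGamma (z + real K) * \<bar>\<Prod>i<K. z - (v i - real i)\<bar>" for z
  have S0: "S \<ge> 0" using a[of 0] S[of 0] by (smt (verit) mult_nonneg_nonneg of_nat_0_le_iff)
  have main: "\<bar>limit_char s z\<bar> \<le> G z \<and> G z / 2 \<le> \<bar>limit_char s z\<bar>" if z: "z \<in> D" "-A < z" "z < A" for z
  proof -
    have zZ: "z \<notin> \<int>" using D(1) z(1) by auto
    define G' where "G' k = rGamma (z + real K) * \<bar>\<Prod>i<K. z - jcontent (a k) (r k) i\<bar>" for k
    have G': "G' \<longlonglongrightarrow> G z"
      unfolding G'_def G_def jcontent_def by (intro tendsto_intros v)
    have L: "(\<lambda>k. \<bar>rGamma z * char_ratio (a k) (n k) (r k) z\<bar>) \<longlonglongrightarrow> \<bar>limit_char s z\<bar>"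
      unfolding limit_char_eq[OF zZ] by (intro tendsto_intros lim z)
    have ev: "eventually (\<lambda>k. K \<le> n k) sequentially" using n by (auto simp: filterlim_at_top)
    have b: "\<bar>rGamma z * char_ratio (a k) (n k) (r k) z\<bar> \<le> G' k \<and> G' k / 2 \<le> \<bar>rGamma z * char_ratio (a k) (n k) (r k) z\<bar>"
      if "K \<le> n k" for k
      using char_ratio_rGamma_bounds[OF a r S that zZ] K z by (simp add: G'_def)
    have "\<bar>limit_char s z\<bar> \<le> G z"
      by (rule tendsto_le[OF _ G' L]) (use ev b in \<open>auto elim: eventually_mono\<close>)
    moreover have "G z / 2 \<le> \<bar>limit_char s z\<bar>"
      by (rule tendsto_le[OF _ L tendsto_divide[OF G' tendsto_const]])
         (use ev b in \<open>auto elim: eventually_mono\<close>)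
    ultimately show ?thesis by blast
  qed
  have yA: "-A < y" "y < A" by (auto simp: A_def)
  have contG: "isCont G y" unfolding G_def by (intro continuous_intros)
  have "0 \<le> G y - \<bar>limit_char s y\<bar>"
    by (rule dense_nonneg_imp_nonneg[OF _ D(2) _ yA]) (use main in \<open>auto intro!: continuous_intros contG continuous_limit_char\<close>)
  moreover have "0 \<le> \<bar>limit_char s y\<bar> - G y / 2"
    by (rule dense_nonneg_imp_nonneg[OF _ D(2) _ yA]) (use main in \<open>auto intro!: continuous_intros contG continuous_limit_char\<close>)
  ultimately have "limit_char s y = 0 \<longleftrightarrow> G y = 0" by auto
  also have "\<dots> \<longleftrightarrow> (\<exists>i<K. y = v i - real i)"
  proof -
    have "y + real K > 0" using yA K S0 by linarith
    then have "rGamma (y + real K) > 0" by (simp add: rGamma_inverse_Gamma)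
    then show ?thesis by (auto simp: G_def)
  qed
  also have "\<dots> \<longleftrightarrow> (\<exists>i. y = v i - real i)"
  proof
    assume "\<exists>i. y = v i - real i"
    then obtain i where i: "y = v i - real i" by blast
    have "a k * real (r k i) \<le> S" for k
    proof -
      have "r k i \<le> n k"
      proof (cases "i < n k")
        case True
        then show ?thesis using member_le_sum[of i "{..<n k}" "r k"] row_functionsD(3)[OF r] by auto
      qed (use row_functionsD(2)[OF r] in auto)
      then have "a k * real (r k i) \<le> a k * real (n k)" using a[of k] by (intro mult_left_mono) auto
      with S[of k] show ?thesis by simp
    qed
    then have "v i \<le> S" using v[of i] by (intro LIMSEQ_le_const2) auto
    then have "i < K" using i yA K S0 by linarith
    with i show "\<exists>i<K. y = v i - real i" by blast
  qed blast
  finally show ?thesis .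
qed

text \<open>Strong induction: \<open>f n\<close> is some \<open>g i\<close>, and
  \<open>i < n\<close> is impossible because those values are already taken by \<open>f i\<close>.
  Hence \<open>f n \<le> g n\<close>, and symmetrically.\<close>

lemma strict_decreasing_range_unique:
  fixes f g :: "nat \<Rightarrow> real"
  assumes "\<And>i j. i < j \<Longrightarrow> f j < f i" "\<And>i j. i < j \<Longrightarrow> g j < g i" "range f = range g"
  shows "f = g"
proof
  fix n show "f n = g n"
  proof (induction n rule: less_induct)
    case (less n)
    have "f n \<in> range g" "g n \<in> range f" using assms(3) by auto
    then obtain i j where ij: "f n = g i" "g n = f j" by auto
    have "n \<le> i" "n \<le> j" using ij less assms(1)[of _ n] assms(2)[of _ n] by (metis less_irrefl not_le)+
    then have "g i \<le> g n" "f j \<le> f n"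
      using assms(1)[of n j] assms(2)[of n i] by (auto simp: le_less)
    with ij show ?case by simp
  qed
qed

subsection \<open>Compactness\<close>

lemma exists_strict_mono_choice:
  assumes "\<And>k n::nat. \<exists>d>n. P k d"
  shows "\<exists>f::nat \<Rightarrow> nat. strict_mono f \<and> (\<forall>k. P k (f k))"
proof -
  obtain f where "\<And>k. P k (f k)" "\<And>k. f k < f (Suc k)"
    using dependent_nat_choice[of P "\<lambda>_ x y. x < y"] assms by metis
  then show ?thesis by (auto simp: strict_mono_Suc_iff)
qed

lemma coordinatewise_convergent_subsequence:
  fixes u :: "nat \<Rightarrow> nat \<Rightarrow> real"
  assumes "\<And>k i. u k i \<in> {0..S}"
  shows "\<exists>f v. strict_mono f \<and> (\<forall>i. (\<lambda>k. u (f k) i) \<longlonglongrightarrow> v i)"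
proof -
  interpret subseqs "\<lambda>i f. convergent (\<lambda>k. u (f k) i)"
  proof
    fix i and f :: "nat \<Rightarrow> nat"
    have "\<forall>k. u (f k) i \<in> {0..S}" using assms by blast
    moreover have "seq_compact {0..S}"
      using compact_Icc by (rule compact_eq_seq_compact_metric[THEN iffD1])
    ultimately obtain l g where "strict_mono g" "((\<lambda>k. u (f k) i) \<circ> g) \<longlonglongrightarrow> l"
      unfolding seq_compact_def by meson
    then show "\<exists>g. strict_mono g \<and> convergent (\<lambda>k. u ((f \<circ> g) k) i)"
      by (auto simp: convergent_def o_def)
  qed
  \<comment> \<open>The diagonal sequence is a subsequence of stage \<open>i\<close> only from entry
    \<open>Suc i\<close> on.\<close>
  have diag: "convergent (\<lambda>k. u ((diagseq \<circ> (+) (Suc i)) k) i)" for i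
  proof (rule diagseq_holds)
    fix r f :: "nat \<Rightarrow> nat" and i
    assume "strict_mono r" "convergent (\<lambda>k. u (f k) i)"
    then show "convergent (\<lambda>k. u ((f \<circ> r) k) i)"
      using convergent_subseq_convergent[of "\<lambda>k. u (f k) i" r] by (simp add: o_def)
  qed
  have "convergent (\<lambda>k. u (diagseq k) i)" for i
    using diag[of i] convergent_ignore_initial_segment[of "\<lambda>k. u (diagseq k) i" "Suc i"]
    by (simp only: o_def add.commute[of "Suc i"])
  then have "(\<lambda>k. u (diagseq k) i) \<longlonglongrightarrow> lim (\<lambda>k. u (diagseq k) i)" for i
    by (rule convergent_LIMSEQ_iff[THEN iffD1])
  then show ?thesis
    by (intro exI[of _ diagseq] exI[of _ "\<lambda>i. lim (\<lambda>k. u (diagseq k) i)"] conjI allI subseq_diagseq)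
qed

text \<open>Countable, so that one diagonal sequence reaches every point; without integers, so that
  the law of large numbers applies; dense, so that continuity extends the resulting bounds to all
  reals.\<close>

definition sample_points :: "real set" where
  "sample_points = \<rat> - \<int>"

lemma sample_points_dense:
  assumes "a < b"
  shows "\<exists>z\<in>sample_points. a < z \<and> z < b"
proof -
  obtain q where q: "q \<in> \<rat>" "a < q" "q < b" using Rats_dense_in_real[OF assms] by auto
  show ?thesis
  proof (cases "q \<in> \<int>")
    case True
    obtain q' where q': "q' \<in> \<rat>" "q < q'" "q' < min b (q + 1)"
      using Rats_dense_in_real[of q "min b (q + 1)"] q by auto
    have "q' \<notin> \<int>"
    proof
      assume "q' \<in> \<int>"
      with True obtain m n where "q = of_int m" "q' = of_int n" by (auto elim!: Ints_cases)
      with q' show False by auto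
    qed
    with q' q show ?thesis by (auto simp: sample_points_def intro!: bexI[of _ q'])
  qed (use q in \<open>auto simp: sample_points_def\<close>)
qed

text \<open>If \<open>Bad\<close> keeps a non-vanishing mass, the law of large numbers at finitely many sample
  points still leaves bad diagrams with nearly the limiting values there; a diagonal subsequence
  of these makes all rescaled rows converge.\<close>

lemma bad_sequence:
  fixes \<alpha> :: "nat \<Rightarrow> real" and Bad :: "nat \<Rightarrow> (nat \<Rightarrow> nat) set"
  assumes all_pos: "\<forall>d\<ge>1. \<alpha> d > 0"
    and lim: "\<alpha> \<longlonglongrightarrow> 0" "(\<lambda>d. \<alpha> d * real d) \<longlonglongrightarrow> s"
    and bad: "\<not> (\<lambda>d. jack_mean (\<alpha> d) d (\<lambda>r. of_bool (r \<in> Bad d))) \<longlonglongrightarrow> 0"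
  shows "\<exists>f r v. strict_mono f \<and> (\<forall>k. f k \<ge> 1 \<and> \<alpha> (f k) * real (f k) \<le> s + 1) \<and>
    (\<forall>k. r k \<in> row_functions (f k) \<and> r k \<in> Bad (f k)) \<and>
    (\<forall>i. (\<lambda>k. \<alpha> (f k) * real (r k i)) \<longlonglongrightarrow> v i) \<and>
    (\<forall>z\<in>sample_points. (\<lambda>k. char_ratio (\<alpha> (f k)) (f k) (r k) z) \<longlonglongrightarrow> limit_ratio s z)"
proof -
  have pos: "\<alpha> d > 0" if "d \<ge> 1" for d using all_pos that by blast
  define p where "p d = jack_mean (\<alpha> d) d (\<lambda>r. of_bool (r \<in> Bad d))" for d
  define e where "e = from_nat_into sample_points"
  have cnt: "countable sample_points" "sample_points \<noteq> {}"
    using sample_points_dense[of 0 1] by (auto simp: sample_points_def countable_rat)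
  have eD: "e j \<in> sample_points" for j unfolding e_def by (rule from_nat_into[OF cnt(2)])
  \<comment> \<open>Stage \<open>k\<close> tests \<open>k + 1\<close> points with tolerance
    \<open>1 / (k + 1)\<close>, so the approximation improves in both respects along the
    sequence.\<close>
  define far where "far k d r = (\<exists>j\<le>k. \<bar>char_ratio (\<alpha> d) d r (e j) - limit_ratio s (e j)\<bar> > 1 / real (Suc k))" for k d r
  from bad obtain \<eta> where \<eta>: "\<eta> > 0" and fr: "\<And>n. \<exists>d\<ge>n. \<bar>p d\<bar> \<ge> \<eta>"
    unfolding LIMSEQ_iff p_def[symmetric] by (auto simp: not_less)
  have "(\<lambda>d. \<Sum>j\<le>k. jack_mean (\<alpha> d) d (\<lambda>r. of_bool
        (\<bar>char_ratio (\<alpha> d) d r (e j) - limit_ratio s (e j)\<bar> > 1 / real (Suc k)))) \<longlonglongrightarrow> (\<Sum>j\<le>k. 0)" for k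
    using eD by (intro tendsto_sum char_ratio_law_of_large_numbers[OF pos lim]) (auto simp: sample_points_def)
  then have small: "eventually (\<lambda>d. (\<Sum>j\<le>k. jack_mean (\<alpha> d) d (\<lambda>r. of_bool
        (\<bar>char_ratio (\<alpha> d) d r (e j) - limit_ratio s (e j)\<bar> > 1 / real (Suc k)))) < \<eta>) sequentially" for k
    using \<eta> by (intro order_tendstoD(2)[of _ "\<Sum>j\<le>k. 0"]) auto
  have evS: "eventually (\<lambda>d. \<alpha> d * real d < s + 1) sequentially"
    by (rule order_tendstoD(2)[OF lim(2) less_add_one])
  have step: "\<exists>d>n. 1 \<le> d \<and> \<alpha> d * real d \<le> s + 1 \<and> (\<exists>r\<in>row_functions d. r \<in> Bad d \<and> \<not> far k d r)" for k n
  proof -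
    from eventually_conj[OF small[of k] evS] obtain m where m:
      "\<And>d. d \<ge> m \<Longrightarrow> (\<Sum>j\<le>k. jack_mean (\<alpha> d) d (\<lambda>r. of_bool
        (\<bar>char_ratio (\<alpha> d) d r (e j) - limit_ratio s (e j)\<bar> > 1 / real (Suc k)))) < \<eta> \<and> \<alpha> d * real d < s + 1"
      unfolding eventually_sequentially by blast
    obtain d where d: "d \<ge> max m (Suc n)" "\<bar>p d\<bar> \<ge> \<eta>" using fr by blast
    have a: "\<alpha> d > 0" using pos d by simp
    have "\<exists>r\<in>row_functions d. r \<in> Bad d \<and> \<not> far k d r"
    proof (rule ccontr)
      assume "\<not> ?thesis"
      then have all: "far k d r" if "r \<in> row_functions d" "r \<in> Bad d" for r using that by blast
      \<comment> \<open>Union bound: if every bad diagram were far, the mass of \<open>Bad d\<close>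
        would be at most a sum of \<open>k + 1\<close> masses that is below \<eta>.\<close>
      have "p d \<le> jack_mean (\<alpha> d) d (\<lambda>r. \<Sum>j\<le>k. of_bool
        (\<bar>char_ratio (\<alpha> d) d r (e j) - limit_ratio s (e j)\<bar> > 1 / real (Suc k)))"
        unfolding p_def
      proof (rule jack_mean_mono[OF a])
        fix r assume r: "r \<in> row_functions d"
        show "of_bool (r \<in> Bad d) \<le> (\<Sum>j\<le>k. of_bool
          (\<bar>char_ratio (\<alpha> d) d r (e j) - limit_ratio s (e j)\<bar> > 1 / real (Suc k)) :: real)"
        proof (cases "r \<in> Bad d")
          case True
          from all[OF r this] obtain j where "j \<le> k"
            "\<bar>char_ratio (\<alpha> d) d r (e j) - limit_ratio s (e j)\<bar> > 1 / real (Suc k)"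
            unfolding far_def by blast
          then show ?thesis
            using member_le_sum[of j "{..k}" "\<lambda>j. of_bool
              (\<bar>char_ratio (\<alpha> d) d r (e j) - limit_ratio s (e j)\<bar> > 1 / real (Suc k)) :: real"] True
            by auto
        qed (simp add: sum_nonneg)
      qed
      also have "\<dots> = (\<Sum>j\<le>k. jack_mean (\<alpha> d) d (\<lambda>r. of_bool
        (\<bar>char_ratio (\<alpha> d) d r (e j) - limit_ratio s (e j)\<bar> > 1 / real (Suc k))))"
        unfolding jack_mean_def sum_distrib_left by (rule sum.swap)
      also have "\<dots> < \<eta>" using m[of d] d(1) by simp
      finally have "p d < \<eta>" .
      moreover have "p d \<ge> 0"
        unfolding p_def jack_mean_def using a
        by (intro sum_nonneg mult_nonneg_nonneg jack_weight_nonneg) auto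
      ultimately show False using d(2) by simp
    qed
    then show ?thesis using d(1) m[of d] by (intro exI[of _ d]) auto
  qed
  from exists_strict_mono_choice[of "\<lambda>k d. 1 \<le> d \<and> \<alpha> d * real d \<le> s + 1 \<and>
      (\<exists>r\<in>row_functions d. r \<in> Bad d \<and> \<not> far k d r)", OF step] obtain f where f: "strict_mono f"
    "\<And>k. 1 \<le> f k" "\<And>k. \<alpha> (f k) * real (f k) \<le> s + 1"
    "\<And>k. \<exists>r\<in>row_functions (f k). r \<in> Bad (f k) \<and> \<not> far k (f k) r" by blast
  from f(4) obtain r where r: "\<And>k. r k \<in> row_functions (f k)" "\<And>k. r k \<in> Bad (f k)"
    "\<And>k. \<not> far k (f k) (r k)" by metis
  have conv: "(\<lambda>k. char_ratio (\<alpha> (f k)) (f k) (r k) z) \<longlonglongrightarrow> limit_ratio s z" if "z \<in> sample_points" for z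
  proof -
    from from_nat_into_surj[OF cnt(1) \<open>z \<in> sample_points\<close>]
    obtain j where j: "z = e j" by (auto simp: e_def)
    have "eventually (\<lambda>k. norm (char_ratio (\<alpha> (f k)) (f k) (r k) z - limit_ratio s z) \<le>
        inverse (real (Suc k))) sequentially"
      using eventually_ge_at_top[of j]
      by eventually_elim (use r(3) in \<open>auto simp: far_def j not_less inverse_eq_divide\<close>)
    then have "(\<lambda>k. char_ratio (\<alpha> (f k)) (f k) (r k) z - limit_ratio s z) \<longlonglongrightarrow> 0"
      by (rule Lim_null_comparison[OF _ LIMSEQ_inverse_real_of_nat])
    then show ?thesis by (rule LIM_zero_cancel)
  qed
  have "\<alpha> (f k) * real (r k i) \<in> {0..s + 1}" for k i
  proof -
    have "r k i \<le> f k"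
    proof (cases "i < f k")
      case True
      then show ?thesis using member_le_sum[of i "{..<f k}" "r k"] row_functionsD(3)[OF r(1)] by auto
    qed (use row_functionsD(2)[OF r(1)] in auto)
    then have "\<alpha> (f k) * real (r k i) \<le> \<alpha> (f k) * real (f k)"
      using pos[OF f(2)[of k]] by (intro mult_left_mono) auto
    also note f(3)[of k]
    finally show ?thesis using pos[OF f(2)[of k]] by simp
  qed
  then obtain g v where g: "strict_mono g" and v: "\<And>i. (\<lambda>k. \<alpha> (f (g k)) * real (r (g k) i)) \<longlonglongrightarrow> v i"
    using coordinatewise_convergent_subsequence[of "\<lambda>k i. \<alpha> (f k) * real (r k i)" "s + 1"] by auto
  have "strict_mono (f \<circ> g)" using f(1) g by (rule strict_mono_o)
  moreover have "(\<lambda>k. char_ratio (\<alpha> (f (g k))) (f (g k)) (r (g k)) z) \<longlonglongrightarrow> limit_ratio s z"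
    if "z \<in> sample_points" for z
    using LIMSEQ_subseq_LIMSEQ[OF conv[OF that] g] by (simp add: o_def)
  ultimately show ?thesis
    using f(2,3) r(1,2) v by (intro exI[of _ "f \<circ> g"] exI[of _ "r \<circ> g"] exI[of _ v]) auto
qed

text \<open>Turns probability into deterministic sequences. The candidate \<open>v\<close> comes
  from one convergent subsequence; the limit of any other has the same associated zero set, namely
  that of \<open>limit_char s\<close>, and so equals \<open>v\<close>.\<close>

lemma limit_rows:
  fixes \<alpha> :: "nat \<Rightarrow> real"
  assumes pos: "\<And>d. d \<ge> 1 \<Longrightarrow> \<alpha> d > 0"
    and lim: "\<alpha> \<longlonglongrightarrow> 0" "(\<lambda>d. \<alpha> d * real d) \<longlonglongrightarrow> s"
  obtains v :: "nat \<Rightarrow> real"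
  where "antimono v" "\<forall>i. v i \<ge> 0" "v \<longlonglongrightarrow> 0"
    "\<forall>y. limit_char s y = 0 \<longleftrightarrow> (\<exists>i. y = v i - real i)"
    "\<forall>Bad. (\<lambda>d. jack_mean (\<alpha> d) d (\<lambda>r. of_bool (r \<in> Bad d))) \<longlonglongrightarrow> 0 \<or>
       (\<exists>f r. strict_mono f \<and> (\<forall>k. f k \<ge> 1 \<and> r k \<in> row_functions (f k) \<and> r k \<in> Bad (f k)) \<and>
          (\<forall>i. (\<lambda>k. \<alpha> (f k) * real (r k i)) \<longlonglongrightarrow> v i))"
proof -
  have all_pos: "\<forall>d\<ge>1. \<alpha> d > 0" using pos by blast
  have props: "antimono v \<and> (\<forall>i. v i \<ge> 0) \<and> v \<longlonglongrightarrow> 0 \<and> (\<forall>y. limit_char s y = 0 \<longleftrightarrow> (\<exists>i. y = v i - real i))"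
    if f: "strict_mono f" and f1: "\<And>k. f k \<ge> 1" "\<And>k. \<alpha> (f k) * real (f k) \<le> s + 1"
      and r: "\<And>k. r k \<in> row_functions (f k)"
      and v: "\<And>i. (\<lambda>k. \<alpha> (f k) * real (r k i)) \<longlonglongrightarrow> v i"
      and c: "\<And>z. z \<in> sample_points \<Longrightarrow> (\<lambda>k. char_ratio (\<alpha> (f k)) (f k) (r k) z) \<longlonglongrightarrow> limit_ratio s z"
    for f :: "nat \<Rightarrow> nat" and r v
  proof (intro conjI allI)
    have a: "\<alpha> (f k) > 0" for k using pos[OF f1(1)] .
    have anti: "antimono (r k)" for k by (rule row_functionsD(1)[OF r])
    show "antimono v"
    proof (rule antimonoI)
      fix i j :: nat assume "i \<le> j"
      then have "r k j \<le> r k i" for k using antimonoD[OF anti] by blast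
      then have "\<alpha> (f k) * real (r k j) \<le> \<alpha> (f k) * real (r k i)" for k
        using a[of k] by (intro mult_left_mono) auto
      then show "v j \<le> v i" by (intro LIMSEQ_le[OF v v] exI[of _ 0] allI impI)
    qed
    show v0: "v i \<ge> 0" for i
      using a[THEN less_imp_le] by (intro LIMSEQ_le_const[OF v] exI[of _ 0]) simp
    \<comment> \<open>The first \<open>i + 1\<close> rows are at least as long as row
      \<open>i\<close> and contain at most \<open>f k\<close> boxes together.\<close>
    have upper: "v i \<le> (s + 1) / real (Suc i)" for i
    proof (rule LIMSEQ_le_const2[OF v], intro exI allI impI)
      fix k :: nat
      have "(\<Sum>j<Suc i. r k i) \<le> (\<Sum>j<Suc i. r k j)"
        by (intro sum_mono antimonoD[OF anti]) simp
      also have "\<dots> \<le> (\<Sum>j<max (f k) (Suc i). r k j)" by (intro sum_mono2) auto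
      also have "\<dots> = f k" by (intro sum_row_function[OF r]) simp
      finally have "Suc i * r k i \<le> f k" by (simp del: sum.lessThan_Suc)
      then have "real (Suc i) * real (r k i) \<le> real (f k)" by (metis of_nat_le_iff of_nat_mult)
      then have "\<alpha> (f k) * (real (Suc i) * real (r k i)) \<le> \<alpha> (f k) * real (f k)"
        using a[of k] by (intro mult_left_mono) simp_all
      also note f1(2)[of k]
      finally show "\<alpha> (f k) * real (r k i) \<le> (s + 1) / real (Suc i)"
        by (simp add: pos_le_divide_eq mult_ac del: of_nat_Suc)
    qed
    have "(\<lambda>i. (s + 1) / real (Suc i)) \<longlonglongrightarrow> 0"
      using tendsto_mult_right_zero[OF LIMSEQ_inverse_real_of_nat, of "s + 1"]
      by (simp only: divide_inverse)
    then show "v \<longlonglongrightarrow> 0"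
      by (rule tendsto_sandwich[OF always_eventually always_eventually tendsto_const, rotated 2])
         (use v0 upper in auto)
    show "limit_char s y = 0 \<longleftrightarrow> (\<exists>i. y = v i - real i)" for y
      by (rule limit_char_eq_0_iff[OF a r filterlim_subseq[OF f] f1(2) v _ sample_points_dense c])
         (auto simp: sample_points_def)
  qed
  \<comment> \<open>The full event keeps mass 1, hence supplies a convergent subsequence from which
    \<open>v\<close> is defined.\<close>
  have "\<not> (\<lambda>d. jack_mean (\<alpha> d) d (\<lambda>r. of_bool (r \<in> UNIV))) \<longlonglongrightarrow> 0"
  proof
    assume "(\<lambda>d. jack_mean (\<alpha> d) d (\<lambda>r. of_bool (r \<in> UNIV))) \<longlonglongrightarrow> 0"
    moreover have "eventually (\<lambda>d. jack_mean (\<alpha> d) d (\<lambda>r. of_bool (r \<in> UNIV)) = 1) sequentially"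
      using eventually_ge_at_top[of 1] by eventually_elim (simp add: jack_mean_const pos)
    ultimately have "(\<lambda>d. 1::real) \<longlonglongrightarrow> 0" by (rule Lim_transform_eventually)
    then show False by (simp add: LIMSEQ_const_iff)
  qed
  from bad_sequence[OF all_pos lim this] obtain f0 r0 v where f0: "strict_mono f0"
    "\<forall>k. f0 k \<ge> 1 \<and> \<alpha> (f0 k) * real (f0 k) \<le> s + 1"
    and r0: "\<forall>k. r0 k \<in> row_functions (f0 k) \<and> r0 k \<in> UNIV"
    and v0: "\<forall>i. (\<lambda>k. \<alpha> (f0 k) * real (r0 k i)) \<longlonglongrightarrow> v i"
    and c0: "\<forall>z\<in>sample_points. (\<lambda>k. char_ratio (\<alpha> (f0 k)) (f0 k) (r0 k) z) \<longlonglongrightarrow> limit_ratio s z"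
    by (elim exE conjE) (rule that)
  have v: "antimono v" "\<And>i. v i \<ge> 0" "v \<longlonglongrightarrow> 0"
    "\<And>y. limit_char s y = 0 \<longleftrightarrow> (\<exists>i. y = v i - real i)"
    using props[OF f0(1) conjunct1[OF f0(2)[rule_format]] conjunct2[OF f0(2)[rule_format]]
      conjunct1[OF r0[rule_format]] v0[rule_format] c0[rule_format]] by blast+
  have persist: "\<exists>f r. strict_mono f \<and> (\<forall>k. f k \<ge> 1 \<and> r k \<in> row_functions (f k) \<and> r k \<in> Bad (f k)) \<and>
      (\<forall>i. (\<lambda>k. \<alpha> (f k) * real (r k i)) \<longlonglongrightarrow> v i)"
    if "\<not> (\<lambda>d. jack_mean (\<alpha> d) d (\<lambda>r. of_bool (r \<in> Bad d))) \<longlonglongrightarrow> 0" for Bad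
  proof -
    from bad_sequence[OF all_pos lim that] obtain f r w where f: "strict_mono f"
      "\<forall>k. f k \<ge> 1 \<and> \<alpha> (f k) * real (f k) \<le> s + 1"
      and r: "\<forall>k. r k \<in> row_functions (f k) \<and> r k \<in> Bad (f k)"
      and w: "\<forall>i. (\<lambda>k. \<alpha> (f k) * real (r k i)) \<longlonglongrightarrow> w i"
      and c: "\<forall>z\<in>sample_points. (\<lambda>k. char_ratio (\<alpha> (f k)) (f k) (r k) z) \<longlonglongrightarrow> limit_ratio s z"
      by (elim exE conjE) (rule that)
    have W: "antimono w" "\<And>y. limit_char s y = 0 \<longleftrightarrow> (\<exists>i. y = w i - real i)"
      using props[OF f(1) conjunct1[OF f(2)[rule_format]] conjunct2[OF f(2)[rule_format]]
        conjunct1[OF r[rule_format]] w[rule_format] c[rule_format]] by blast+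
    \<comment> \<open>Both sequences are strictly decreasing enumerations of the zeros of
      \<open>limit_char s\<close>.\<close>
    have "(\<lambda>i. v i - real i) = (\<lambda>i. w i - real i)"
    proof (rule strict_decreasing_range_unique)
      show "v j - real j < v i - real i" "w j - real j < w i - real i" if "i < j" for i j
        using antimonoD[OF v(1), of i j] antimonoD[OF W(1), of i j] that by auto
      have "range (\<lambda>i. v i - real i) = {y. limit_char s y = 0}" by (auto simp: v(4))
      also have "\<dots> = range (\<lambda>i. w i - real i)" by (auto simp: W(2))
      finally show "range (\<lambda>i. v i - real i) = range (\<lambda>i. w i - real i)" .
    qed
    then have "v i - real i = w i - real i" for i by (rule fun_cong)
    then have "w i = v i" for i by simp
    with w have "\<forall>i. (\<lambda>k. \<alpha> (f k) * real (r k i)) \<longlonglongrightarrow> v i" by simp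
    with f r show ?thesis by (intro exI[of _ f] exI[of _ r] conjI allI) simp_all
  qed
  show ?thesis
  proof (rule that[OF v(1) allI[OF v(2)] v(3) allI[OF v(4)]], intro allI)
    fix Bad
    show "(\<lambda>d. jack_mean (\<alpha> d) d (\<lambda>r. of_bool (r \<in> Bad d))) \<longlonglongrightarrow> 0 \<or>
       (\<exists>f r. strict_mono f \<and> (\<forall>k. f k \<ge> 1 \<and> r k \<in> row_functions (f k) \<and> r k \<in> Bad (f k)) \<and>
          (\<forall>i. (\<lambda>k. \<alpha> (f k) * real (r k i)) \<longlonglongrightarrow> v i))"
      using persist[of Bad] by argo
  qed
qed

subsection \<open>Young diagrams as row functions\<close>

definition row_function :: "nat list \<Rightarrow> nat \<Rightarrow> nat" where
  "row_function \<mu> i = row_length \<mu> (Suc i)"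

lemma row_function_nth: "row_function \<mu> i = (if i < length \<mu> then \<mu> ! i else 0)"
  by (simp add: row_function_def row_length_def)

lemma length_young_diagram:
  assumes "\<mu> \<in> young_diagrams d"
  shows "length \<mu> \<le> d"
proof -
  have "length \<mu> = (\<Sum>r\<leftarrow>\<mu>. 1)" by (simp add: sum_list_triv)
  also have "\<dots> \<le> (\<Sum>r\<leftarrow>\<mu>. r)"
    using assms by (intro sum_list_mono) (auto simp: young_diagrams_def Suc_le_eq)
  finally show ?thesis using assms by (simp add: young_diagrams_def)
qed

lemma row_function_in_row_functions:
  assumes "\<mu> \<in> young_diagrams d"
  shows "row_function \<mu> \<in> row_functions d"
proof -
  have "antimono (row_function \<mu>)"
    using row_length_antimono[OF assms] by (auto simp: antimono_def row_function_def)
  moreover have "sum (row_function \<mu>) {..<d} = (\<Sum>i<length \<mu>. row_function \<mu> i)"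
    using length_young_diagram[OF assms]
    by (intro sum.mono_neutral_right) (auto simp: row_function_nth)
  moreover have "\<dots> = d"
    using assms by (simp add: row_function_nth young_diagrams_def sum_list_sum_nth lessThan_atLeast0)
  ultimately show ?thesis
    using length_young_diagram[OF assms] by (auto simp: row_functions_def row_function_nth)
qed

lemma inj_on_row_function: "inj_on row_function (young_diagrams d)"
proof (rule inj_onI)
  fix \<mu> \<nu> assume Y: "\<mu> \<in> young_diagrams d" "\<nu> \<in> young_diagrams d" and eq: "row_function \<mu> = row_function \<nu>"
  have len: "i < length \<kappa> \<longleftrightarrow> 0 < row_function \<kappa> i" if "\<kappa> \<in> young_diagrams d" for \<kappa> i
    using that by (auto simp: row_function_nth young_diagrams_def)
  have l: "length \<mu> = length \<nu>"
    using len[OF Y(1)] len[OF Y(2)] eq by (metis linorder_neqE_nat less_irrefl)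
  show "\<mu> = \<nu>"
  proof (rule nth_equalityI[OF l])
    fix i assume "i < length \<mu>"
    then show "\<mu> ! i = \<nu> ! i" using fun_cong[OF eq, of i] l by (simp add: row_function_nth)
  qed
qed

lemma finite_young_diagrams: "finite (young_diagrams d)"
proof (rule inj_on_finite[OF inj_on_row_function])
  show "row_function ` young_diagrams d \<subseteq> row_functions d"
    using row_function_in_row_functions by blast
qed (rule finite_row_functions)

lemma jack_plancherel_eq:
  assumes "\<mu> \<in> young_diagrams d"
  shows "jack_plancherel \<alpha> d \<mu> = jack_weight \<alpha> d (row_function \<mu>)"
proof -
  let ?r = "row_function \<mu>"
  have boxes: "boxes \<mu> = (\<lambda>(i, j). (Suc i, j)) ` Sigma {..<d} (\<lambda>i. {1..?r i})"
  proof (intro set_eqI iffI)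
    fix b assume "b \<in> boxes \<mu>"
    then obtain i j where b: "b = (Suc i, j)" "i < length \<mu>" "1 \<le> j" "j \<le> row_length \<mu> (Suc i)"
      by (cases b; cases "fst b") (auto simp: boxes_def)
    then show "b \<in> (\<lambda>(i, j). (Suc i, j)) ` Sigma {..<d} (\<lambda>i. {1..?r i})"
      using length_young_diagram[OF assms] by (auto simp: row_function_def intro!: image_eqI[of _ _ "(i, j)"])
  next
    fix b assume "b \<in> (\<lambda>(i, j). (Suc i, j)) ` Sigma {..<d} (\<lambda>i. {1..?r i})"
    then show "b \<in> boxes \<mu>"
      by (auto simp: boxes_def row_function_def row_length_def split: if_splits)
  qed
  have col: "col_length \<mu> j = col_height ?r j" if "1 \<le> j" for j
  proof -
    have "{i. 1 \<le> i \<and> i \<le> length \<mu> \<and> j \<le> row_length \<mu> i} = Suc ` {k. j \<le> ?r k}"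
    proof (intro set_eqI iffI)
      fix i assume i: "i \<in> {i. 1 \<le> i \<and> i \<le> length \<mu> \<and> j \<le> row_length \<mu> i}"
      then have "i = Suc (i - 1)" by simp
      with i show "i \<in> Suc ` {k. j \<le> ?r k}" by (intro image_eqI[of _ _ "i - 1"]) (auto simp: row_function_def)
    qed (use that in \<open>auto simp: row_function_def row_length_def split: if_splits\<close>)
    then show ?thesis by (simp add: col_length_def col_height_def card_image)
  qed
  have "(\<Prod>(i, j)\<in>boxes \<mu>.
        (\<alpha> * (real (row_length \<mu> i) - real j) + (real (col_length \<mu> j) - real i) + 1) *
        (\<alpha> * (real (row_length \<mu> i) - real j) + (real (col_length \<mu> j) - real i) + \<alpha>)) =
      (\<Prod>(i, j)\<in>Sigma {..<d} (\<lambda>i. {1..?r i}). hook_weight \<alpha> ?r i j)"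
    unfolding boxes
    by (subst prod.reindex)
       (auto intro!: inj_onI prod.cong simp: col hook_weight_def row_function_def)
  also have "\<dots> = hook_product \<alpha> d ?r"
    unfolding hook_product_def by (rule prod.Sigma[symmetric]) auto
  finally show ?thesis by (simp add: jack_plancherel_def jack_weight_def)
qed

text \<open>An upper bound is the form in which this is used, to show that probabilities vanish:
  enlarging the sum from the image of \<open>row_function\<close> to all of
  \<open>row_functions d\<close> adds only nonnegative terms.\<close>

lemma measure_le_jack_mean:
  assumes \<alpha>: "\<alpha> > 0" and M: "prob_space M"
    and X: "distributed M (count_space (young_diagrams d)) X (\<lambda>\<mu>. ennreal (jack_plancherel \<alpha> d \<mu>))"
  shows "measure M {s \<in> space M. P (X s)} \<le>
    jack_mean \<alpha> d (\<lambda>r. of_bool (r \<in> row_function ` {\<mu> \<in> young_diagrams d. P \<mu>}))"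
proof -
  let ?Y = "young_diagrams d"
  let ?A = "{\<mu> \<in> ?Y. P \<mu>}"
  have meas: "X \<in> measurable M (count_space ?Y)" using X by (simp add: distributed_def)
  have nonneg: "jack_plancherel \<alpha> d \<mu> \<ge> 0" if "\<mu> \<in> ?Y" for \<mu>
    using jack_weight_nonneg[OF \<alpha> row_function_in_row_functions[OF that]] jack_plancherel_eq[OF that] by simp
  have "{s \<in> space M. P (X s)} = X -` ?A \<inter> space M"
    using measurable_space[OF meas] by auto
  then have "emeasure M {s \<in> space M. P (X s)} =
      (\<integral>\<^sup>+ \<mu>. ennreal (jack_plancherel \<alpha> d \<mu>) * indicator ?A \<mu> \<partial>count_space ?Y)"
    using distributed_emeasure[OF X, of ?A] by simp
  also have "\<dots> = (\<Sum>\<mu>\<in>?Y. ennreal (jack_plancherel \<alpha> d \<mu>) * indicator ?A \<mu>)"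
    by (rule nn_integral_count_space_finite[OF finite_young_diagrams])
  also have "\<dots> = (\<Sum>\<mu>\<in>?Y. ennreal (jack_plancherel \<alpha> d \<mu> * of_bool (P \<mu>)))"
    by (rule sum.cong) (auto simp: indicator_def)
  also have "\<dots> = ennreal (\<Sum>\<mu>\<in>?Y. jack_plancherel \<alpha> d \<mu> * of_bool (P \<mu>))"
    using nonneg by (intro sum_ennreal) auto
  finally have "measure M {s \<in> space M. P (X s)} = (\<Sum>\<mu>\<in>?Y. jack_plancherel \<alpha> d \<mu> * of_bool (P \<mu>))"
    unfolding measure_def using nonneg by (simp add: sum_nonneg)
  also have "\<dots> = (\<Sum>\<mu>\<in>?Y. jack_weight \<alpha> d (row_function \<mu>) *
      of_bool (row_function \<mu> \<in> row_function ` ?A))"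
  proof (rule sum.cong)
    fix \<mu> assume \<mu>: "\<mu> \<in> ?Y"
    have "row_function \<mu> \<in> row_function ` ?A \<longleftrightarrow> P \<mu>"
      using inj_on_image_mem_iff[OF inj_on_row_function \<mu>, of ?A] \<mu> by auto
    then show "jack_plancherel \<alpha> d \<mu> * of_bool (P \<mu>) = jack_weight \<alpha> d (row_function \<mu>) *
      of_bool (row_function \<mu> \<in> row_function ` ?A)"
      by (simp add: jack_plancherel_eq[OF \<mu>])
  qed simp
  also have "\<dots> = (\<Sum>r\<in>row_function ` ?Y. jack_weight \<alpha> d r * of_bool (r \<in> row_function ` ?A))"
    by (subst sum.reindex[OF inj_on_row_function]) simp
  also have "\<dots> \<le> jack_mean \<alpha> d (\<lambda>r. of_bool (r \<in> row_function ` ?A))"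
    unfolding jack_mean_def
    by (rule sum_mono2)
       (use finite_row_functions row_function_in_row_functions jack_weight_nonneg[OF \<alpha>] in auto)
  finally show ?thesis .
qed

subsection \<open>Profiles\<close>

text \<open>The closed complement of a diagram is a union of quadrants with corners
  \<open>(\<rho> i, h * i)\<close>; on the line \<open>a - b = x\<close> the \<open>i\<close>-th one
  begins where \<open>a + b\<close> equals this maximum. The formula also covers infinitely many
  rows, hence the limit shape.\<close>

definition staircase :: "(nat \<Rightarrow> real) \<Rightarrow> real \<Rightarrow> real \<Rightarrow> real" where
  "staircase \<rho> h x = (INF i. max (2 * \<rho> i - x) (2 * h * real i + x))"

lemma bdd_below_staircase:
  assumes "\<And>i. \<rho> i \<ge> (0::real)"
  shows "bdd_below (range (\<lambda>i. max (2 * \<rho> i - x) (2 * h * real i + x)))"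
  by (rule bdd_belowI[of _ "- x"]) (use assms in \<open>auto simp: le_max_iff_disj\<close>)

lemma staircase_le:
  assumes "\<And>i. \<rho> i \<ge> 0"
  shows "staircase \<rho> h x \<le> max (2 * \<rho> i - x) (2 * h * real i + x)"
  unfolding staircase_def by (rule cINF_lower[OF bdd_below_staircase[OF assms]]) simp

lemma staircase_ge:
  assumes "\<And>i. c \<le> max (2 * \<rho> i - x) (2 * h * real i + x)"
  shows "c \<le> staircase \<rho> h x"
  unfolding staircase_def by (rule cINF_greatest) (use assms in auto)

lemma diff_le_max:
  fixes a :: real
  assumes "x \<le> max a b" "a \<le> a' + \<eta>" "b \<le> b' + \<eta>"
  shows "x - \<eta> \<le> max a' b'"
  using assms by (auto simp: le_max_iff_disj)

text \<open>Up to row \<open>K\<close> corresponding corners differ by at most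
  \<open>\<eta> / 2\<close> in each coordinate. A later corner of the second staircase is compared
  with corner \<open>K\<close> of the first, whose row is already at most
  \<open>\<eta> / 2\<close>.\<close>

lemma staircase_diff_le:
  assumes \<rho>: "\<And>i. \<rho> i \<ge> 0" and \<rho>': "\<And>i. \<rho>' i \<ge> 0" and h': "h' \<ge> 0" "h \<ge> 0"
    and near: "\<And>i. i \<le> K \<Longrightarrow> 2 * \<bar>\<rho> i - \<rho>' i\<bar> \<le> \<eta>" "2 * real K * \<bar>h - h'\<bar> \<le> \<eta>" "2 * \<rho> K \<le> \<eta>"
  shows "staircase \<rho> h x - \<eta> \<le> staircase \<rho>' h' x"
proof (rule staircase_ge)
  fix i
  have *: "2 * h * real j \<le> 2 * h' * real j + \<eta>" if "j \<le> K" for j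
  proof -
    have "2 * (h - h') * real j \<le> 2 * \<bar>h - h'\<bar> * real j" by (intro mult_right_mono mult_left_mono abs_ge_self) auto
    also have "\<dots> \<le> 2 * \<bar>h - h'\<bar> * real K" using that by (intro mult_left_mono) auto
    finally show ?thesis using near(2) by (simp add: algebra_simps)
  qed
  show "staircase \<rho> h x - \<eta> \<le> max (2 * \<rho>' i - x) (2 * h' * real i + x)"
  proof (cases "i \<le> K")
    case True
    show ?thesis
      by (rule diff_le_max[OF staircase_le[of \<rho> h x i, OF \<rho>]])
         (use near(1)[OF True] *[OF True] in \<open>auto simp: abs_if algebra_simps split: if_splits\<close>)
  next
    case False
    then have "2 * h' * real K \<le> 2 * h' * real i" using h' by (intro mult_left_mono) auto
    then show ?thesis
      by (intro diff_le_max[OF staircase_le[of \<rho> h x K, OF \<rho>]])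
         (use *[of K] near(3) \<rho>'[of i] in simp_all)
  qed
qed

lemma staircase_close:
  assumes "\<And>i. \<rho> i \<ge> 0" "\<And>i. \<rho>' i \<ge> 0" "h' \<ge> 0" "h \<ge> 0"
    and "\<And>i. i \<le> K \<Longrightarrow> 2 * \<bar>\<rho> i - \<rho>' i\<bar> \<le> \<eta>" "2 * real K * \<bar>h - h'\<bar> \<le> \<eta>"
    "2 * \<rho> K \<le> \<eta>" "2 * \<rho>' K \<le> \<eta>"
  shows "\<bar>staircase \<rho> h x - staircase \<rho>' h' x\<bar> \<le> \<eta>"
  using staircase_diff_le[of \<rho> \<rho>' h' h K \<eta> x] staircase_diff_le[of \<rho>' \<rho> h h' K \<eta> x] assms
  by (simp add: abs_minus_commute abs_le_iff)

text \<open>As the profile is unique, it suffices to exhibit one boundary point on the line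
  \<open>a - b = x\<close>: a small diagonal move of \<open>p\<close> upwards leads into
  \<open>A\<close>, downwards out of it.\<close>

lemma profile_eq_staircase:
  assumes \<mu>: "\<mu> \<in> young_diagrams d" and w: "w > 0" and h: "h > 0"
  shows "profile w h \<mu> x = staircase (\<lambda>i. w * real (row_function \<mu> i)) h x"
proof -
  define \<rho> where "\<rho> i = w * real (row_function \<mu> i)" for i
  define f where "f = staircase \<rho> h x"
  define A where "A = ({0..} \<times> {0..}) - scaled_diagram w h \<mu>"
  define p where "p = ((f + x) / 2, (f - x) / 2)"
  have \<rho>0: "\<rho> i \<ge> 0" for i using w by (simp add: \<rho>_def)
  \<comment> \<open>Strict inequalities, because the boxes are closed.\<close>
  have outside: "(a, b) \<in> A" if ab: "a > \<rho> i" "b > real i * h" for a b i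
  proof -
    have "a \<ge> 0" using ab(1) \<rho>0[of i] by simp
    moreover have "b \<ge> 0" using ab(2) h by (smt (verit) mult_nonneg_nonneg of_nat_0_le_iff)
    moreover have "(a, b) \<notin> scaled_diagram w h \<mu>"
    proof
      assume "(a, b) \<in> scaled_diagram w h \<mu>"
      then obtain i' j where b: "(i', j) \<in> boxes \<mu>" "a \<le> real j * w" "b \<le> real i' * h"
        by (auto simp: scaled_diagram_def)
      then have "real i * h < real i' * h" using ab(2) by simp
      then have "i < i'" using h by simp
      then have "row_length \<mu> i' \<le> row_length \<mu> (Suc i)" by (intro row_length_antimono[OF \<mu>]) auto
      moreover have "j \<le> row_length \<mu> i'" using b(1) by (auto simp: boxes_def)
      ultimately have "real j \<le> real (row_function \<mu> i)" by (simp add: row_function_def)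
      then have "real j * w \<le> \<rho> i" using w by (simp add: \<rho>_def mult.commute mult_left_mono)
      with ab(1) b(2) show False by simp
    qed
    ultimately show ?thesis by (simp add: A_def)
  qed
  have inside: "\<exists>k. \<rho> k \<le> a \<and> h * real k \<le> b" if ab: "(a, b) \<in> A" for a b
  proof -
    from ab have ab0: "a \<ge> 0" "b \<ge> 0" and nin: "(a, b) \<notin> scaled_diagram w h \<mu>" by (auto simp: A_def)
    \<comment> \<open>The horizontal strip at height \<open>b\<close> belongs to row
      \<open>k\<close>.\<close>
    define k where "k = nat \<lfloor>b / h\<rfloor>"
    have "real k \<le> b / h" "b / h \<le> real k + 1" unfolding k_def using ab0 h by simp_all
    then have k: "real k * h \<le> b" "b \<le> real (Suc k) * h" using h by (simp_all add: field_simps)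
    have "\<rho> k \<le> a"
    proof (rule ccontr)
      assume "\<not> \<rho> k \<le> a"
      then have lt: "a \<le> real (row_function \<mu> k) * w" by (simp add: \<rho>_def mult.commute)
      have nz: "row_function \<mu> k \<noteq> 0" using \<open>\<not> \<rho> k \<le> a\<close> ab0 by (intro notI) (simp add: \<rho>_def)
      obtain j where j: "1 \<le> j" "j \<le> row_function \<mu> k" "(real j - 1) * w \<le> a" "a \<le> real j * w"
        using box_of_coord[OF w ab0(1) lt] nz by auto
      have "(Suc k, j) \<in> boxes \<mu>"
        using j nz by (auto simp: boxes_def row_function_def row_length_def split: if_splits)
      with j k have "(a, b) \<in> scaled_diagram w h \<mu>"
        unfolding scaled_diagram_def by (intro UN_I[of "(Suc k, j)"]) auto
      with nin show False by simp
    qed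
    with k(1) show ?thesis by (auto simp: mult.commute)
  qed
  have "p \<in> closure A"
    unfolding closure_sequential
  proof (intro exI conjI allI)
    fix n :: nat
    have "\<exists>i. max (2 * \<rho> i - x) (2 * h * real i + x) < f + 2 * inverse (real (Suc n))"
      using cINF_less_iff[OF _ bdd_below_staircase[of \<rho> x h, OF \<rho>0], of "f + 2 * inverse (real (Suc n))"]
      by (simp add: f_def staircase_def)
    then obtain i where "max (2 * \<rho> i - x) (2 * h * real i + x) < f + 2 * inverse (real (Suc n))" ..
    then show "((f + x) / 2 + inverse (real (Suc n)), (f - x) / 2 + inverse (real (Suc n))) \<in> A"
      by (intro outside[of i]) (simp_all add: field_simps del: of_nat_Suc)
  next
    have "(\<lambda>n. ((f + x) / 2 + inverse (real (Suc n)), (f - x) / 2 + inverse (real (Suc n)))) \<longlonglongrightarrow>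
        ((f + x) / 2 + 0, (f - x) / 2 + 0)"
      by (intro tendsto_intros LIMSEQ_inverse_real_of_nat)
    then show "(\<lambda>n. ((f + x) / 2 + inverse (real (Suc n)), (f - x) / 2 + inverse (real (Suc n)))) \<longlonglongrightarrow> p"
      by (simp add: p_def)
  qed
  moreover have "p \<in> closure (- A)"
    unfolding closure_sequential
  proof (intro exI conjI allI)
    fix n :: nat
    define e where "e = inverse (real (Suc n))"
    have e: "e > 0" by (simp add: e_def)
    show "((f + x) / 2 - inverse (real (Suc n)), (f - x) / 2 - inverse (real (Suc n))) \<in> - A"
      unfolding e_def[symmetric]
    proof
      assume "((f + x) / 2 - e, (f - x) / 2 - e) \<in> A"
      from inside[OF this] obtain k where k: "\<rho> k \<le> (f + x) / 2 - e" "h * real k \<le> (f - x) / 2 - e"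
        by blast
      have "f \<le> max (2 * \<rho> k - x) (2 * h * real k + x)"
        unfolding f_def by (rule staircase_le[OF \<rho>0])
      moreover have "2 * \<rho> k - x \<le> f - 2 * e" using k(1) by (simp add: field_simps)
      moreover have "2 * (h * real k) + x \<le> f - 2 * e" using k(2) by (simp add: field_simps)
      ultimately have "f \<le> f - 2 * e" by (simp only: mult.assoc max.bounded_iff le_max_iff_disj) linarith
      with e show False by linarith
    qed
  next
    have "(\<lambda>n. ((f + x) / 2 - inverse (real (Suc n)), (f - x) / 2 - inverse (real (Suc n)))) \<longlonglongrightarrow>
        ((f + x) / 2 - 0, (f - x) / 2 - 0)"
      by (intro tendsto_intros LIMSEQ_inverse_real_of_nat)
    then show "(\<lambda>n. ((f + x) / 2 - inverse (real (Suc n)), (f - x) / 2 - inverse (real (Suc n)))) \<longlonglongrightarrow> p"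
      by (simp add: p_def)
  qed
  ultimately have "p \<in> boundary_curve w h \<mu>"
    by (simp add: boundary_curve_def frontier_closures flip: A_def)
  also have "boundary_curve w h \<mu> = {(x, y). x + y = profile w h \<mu> (x - y)}"
    unfolding profile_def by (rule theI'[OF profile_well_defined[OF assms]])
  finally show ?thesis by (simp add: p_def f_def \<rho>_def[abs_def] field_simps)
qed

subsection \<open>The limit theorem\<close>

lemma summable_limit_char: "summable (\<lambda>m. (- s) ^ m / fact m * rGamma (y + real m) :: real)"
proof -
  obtain B where B: "\<And>x. x \<ge> - \<bar>y\<bar> \<Longrightarrow> \<bar>rGamma x\<bar> \<le> B"
    using rGamma_bounded_above_interval[of "\<bar>y\<bar>"] by auto
  show ?thesis
  proof (rule summable_comparison_test)
    show "\<exists>N. \<forall>m\<ge>N. norm ((- s) ^ m / fact m * rGamma (y + real m)) \<le> \<bar>s\<bar> ^ m / fact m * B"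
      using B by (intro exI[of _ 0] allI impI)
        (simp add: abs_mult power_abs mult_left_mono divide_right_mono)
    show "summable (\<lambda>m. \<bar>s\<bar> ^ m / fact m * B)"
      using summable_mult2[OF summable_exp[of "\<bar>s\<bar>"], of B] by (simp add: field_simps)
  qed
qed

lemma bessel_J_eq_limit_char:
  assumes "t > 0"
  shows "bessel_J \<nu> (2 * t) = t powr \<nu> * limit_char (t\<^sup>2) (\<nu> + 1)"
proof -
  have "t powr \<nu> * limit_char (t\<^sup>2) (\<nu> + 1) =
      (\<Sum>m. t powr \<nu> * ((- (t\<^sup>2)) ^ m / fact m * rGamma (\<nu> + 1 + real m)))"
    unfolding limit_char_def by (rule suminf_mult[OF summable_limit_char, symmetric])
  also have "\<dots> = bessel_J \<nu> (2 * t)"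
    unfolding bessel_J_def
  proof (rule suminf_cong)
    fix m
    have "(- (t\<^sup>2)) ^ m = (- 1) ^ m * t ^ (2 * m)"
      by (subst power_minus) (simp add: power_mult)
    moreover have "t powr (2 * real m + \<nu>) = t ^ (2 * m) * t powr \<nu>"
      using assms powr_realpow[of t "2 * m"] by (simp add: powr_add)
    ultimately show "t powr \<nu> * ((- (t\<^sup>2)) ^ m / fact m * rGamma (\<nu> + 1 + real m)) =
        (- 1) ^ m / fact m * rGamma (real m + \<nu> + 1) * (2 * t / 2) powr (2 * real m + \<nu>)"
      by (simp add: add_ac)
  qed
  finally show ?thesis ..
qed

text \<open>Lower bounds come from \<open>split\<close>: corners up to row \<open>j\<close> are
  bounded through \<open>2 * \<rho> i - x\<close>, the later ones through the second entry, which is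
  smallest at \<open>Suc j\<close>.\<close>

lemma staircase_steps:
  fixes \<rho> :: "nat \<Rightarrow> real"
  assumes anti: "antimono \<rho>" and \<rho>0: "\<And>i. \<rho> i \<ge> 0" and h: "h > 0"
  shows "x > \<rho> 0 \<Longrightarrow> staircase \<rho> h x = x"
    and "\<rho> j - real (Suc j) * h \<le> x \<Longrightarrow> x \<le> \<rho> j - real j * h \<Longrightarrow> staircase \<rho> h x = 2 * \<rho> j - x"
    and "\<rho> (Suc j) - real (Suc j) * h \<le> x \<Longrightarrow> x \<le> \<rho> j - real (Suc j) * h \<Longrightarrow>
      staircase \<rho> h x = x + 2 * real (Suc j) * h"
proof -
  note le = staircase_le[of \<rho> h x, OF \<rho>0]
  have split: "c \<le> staircase \<rho> h x"
    if "\<And>i. i \<le> j \<Longrightarrow> c \<le> 2 * \<rho> i - x" "c \<le> 2 * h * real (Suc j) + x" for c j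
  proof (rule staircase_ge)
    fix i
    show "c \<le> max (2 * \<rho> i - x) (2 * h * real i + x)"
    proof (cases "i \<le> j")
      case False
      then have "2 * h * real (Suc j) \<le> 2 * h * real i" using h by (intro mult_left_mono) auto
      with that(2) show ?thesis by linarith
    qed (use that(1) in \<open>auto simp: le_max_iff_disj\<close>)
  qed
  show "staircase \<rho> h x = x" if "x > \<rho> 0"
  proof (rule antisym)
    show "staircase \<rho> h x \<le> x" using le[of 0] that by simp
    show "x \<le> staircase \<rho> h x" using h by (intro staircase_ge) (simp add: le_max_iff_disj)
  qed
  show "staircase \<rho> h x = 2 * \<rho> j - x"
    if "\<rho> j - real (Suc j) * h \<le> x" "x \<le> \<rho> j - real j * h"
  proof (rule antisym)
    show "staircase \<rho> h x \<le> 2 * \<rho> j - x" using le[of j] that by (simp add: algebra_simps)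
    show "2 * \<rho> j - x \<le> staircase \<rho> h x"
      using that antimonoD[OF anti, of _ j] by (intro split[of j]) (simp_all add: algebra_simps)
  qed
  show "staircase \<rho> h x = x + 2 * real (Suc j) * h"
    if "\<rho> (Suc j) - real (Suc j) * h \<le> x" "x \<le> \<rho> j - real (Suc j) * h"
  proof (rule antisym)
    show "staircase \<rho> h x \<le> x + 2 * real (Suc j) * h"
      using le[of "Suc j"] that by (simp add: algebra_simps)
    show "x + 2 * real (Suc j) * h \<le> staircase \<rho> h x"
    proof (rule split[of j])
      fix i assume "i \<le> j"
      then have "\<rho> j \<le> \<rho> i" by (rule antimonoD[OF anti])
      with that(2) show "x + 2 * real (Suc j) * h \<le> 2 * \<rho> i - x" by (simp add: algebra_simps)
    qed (simp add: algebra_simps)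
  qed
qed

text \<open>The points \<open>\<rho> j - j * h\<close> decrease without bound, so there is a first
  one below \<open>x\<close>. Between consecutive ones, \<open>\<rho> i - Suc i * h\<close>
  separates the piece of slope 1 from that of slope -1.\<close>

lemma staircase_cover:
  fixes \<rho> :: "nat \<Rightarrow> real"
  assumes anti: "antimono \<rho>" and h: "h > 0"
  shows "x > \<rho> 0 \<or> (\<exists>j. \<rho> j - real (Suc j) * h \<le> x \<and> x \<le> \<rho> j - real j * h) \<or>
    (\<exists>j. \<rho> (Suc j) - real (Suc j) * h \<le> x \<and> x \<le> \<rho> j - real (Suc j) * h)"
proof (cases "x > \<rho> 0")
  case False
  define P where "P j \<longleftrightarrow> \<rho> j - real j * h < x" for j
  obtain N where N: "real N * h > \<rho> 0 - x"
    using reals_Archimedean3[OF h] by blast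
  have "\<rho> N \<le> \<rho> 0" using antimonoD[OF anti, of 0 N] by simp
  with N have "P N" by (simp add: P_def)
  define j where "j = (LEAST j. P j)"
  have Pj: "P j" unfolding j_def by (rule LeastI[of P N, OF \<open>P N\<close>])
  have "\<not> P 0" using False by (simp add: P_def)
  with Pj have "j \<noteq> 0" by (intro notI) simp
  then obtain i where i: "j = Suc i" by (cases j) auto
  have "\<not> P i" using not_less_Least[of i P] i by (simp add: j_def)
  then have "x \<le> \<rho> i - real i * h" by (simp add: P_def)
  moreover have "\<rho> (Suc i) - real (Suc i) * h \<le> x" using Pj by (simp add: P_def i)
  ultimately show ?thesis by (meson linear)
qed simp

theorem theorem1p4:
  fixes g :: real
    and \<alpha> :: "nat \<Rightarrow> real"
    and M :: "nat \<Rightarrow> 'a measure"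
    and \<Lambda> :: "nat \<Rightarrow> 'a \<Rightarrow> nat list"
  assumes "g < 0"
    and "\<And>d. d \<ge> 1 \<Longrightarrow> \<alpha> d > 0"
    and "\<And>d. d \<ge> 1 \<Longrightarrow> prob_space (M d)"
    and "\<And>d. d \<ge> 1 \<Longrightarrow>
           distributed (M d) (count_space (young_diagrams d)) (\<Lambda> d)
             (\<lambda>\<mu>. ennreal (jack_plancherel (\<alpha> d) d \<mu>))"
    and "filterlim (\<lambda>d. inverse (\<alpha> d)) at_top sequentially"
    and "(\<lambda>d. sqrt (\<alpha> d * real d)) \<longlonglongrightarrow> - inverse g"
  shows "\<exists>l :: nat \<Rightarrow> real.
           strict_mono_on {1..} l \<and>
           l ` {1..} = {z. bessel_J (z * inverse g) (- 2 * inverse g) = 0} \<and>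
           (\<forall>i\<ge>1. tendsto_in_prob M (\<lambda>d s. real (row_length (\<Lambda> d s) i) / (- g * real d))
                     (- l i - real i * g)) \<and>
           (\<exists>\<omega>. is_limit_shape \<alpha> M \<Lambda> \<omega> \<and>
              (\<forall>x > - l 1 - g. \<omega> x = x) \<and>
              (\<forall>i\<ge>1. \<forall>x\<in>{- l i .. - l i - g}. \<omega> x = - 2 * (l i + real i * g) - x) \<and>
              (\<forall>i\<ge>1. \<forall>x\<in>{- l (i + 1) - g .. - l i}. \<omega> x = x - 2 * real i * g) \<and>
              (\<forall>x. x > - l 1 - g \<or>
                   (\<exists>i\<ge>1. x \<in> {- l i .. - l i - g}) \<or>
                   (\<exists>i\<ge>1. x \<in> {- l (i + 1) - g .. - l i})))"
proof -
  \<comment> \<open>The limit of \<open>sqrt (\<alpha> d * d)\<close>: the area parameter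
    \<open>s\<close> becomes \<open>t\<^sup>2\<close>, and the limiting box height is
    \<open>1 / t = - g\<close>.\<close>
  define t where "t = - inverse g"
  have t: "t > 0" and g: "g = - (1 / t)" using assms(1) by (simp_all add: t_def field_simps)
  have sqrt_lim: "(\<lambda>d. sqrt (\<alpha> d * real d)) \<longlonglongrightarrow> t" using assms(6) by (simp add: t_def)
  have \<alpha>0: "\<alpha> \<longlonglongrightarrow> 0"
    using tendsto_inverse_0_at_top[OF assms(5)] by simp
  have area: "(\<lambda>d. \<alpha> d * real d) \<longlonglongrightarrow> t\<^sup>2"
  proof (rule Lim_transform_eventually)
    show "(\<lambda>d. (sqrt (\<alpha> d * real d))\<^sup>2) \<longlonglongrightarrow> t\<^sup>2" by (intro tendsto_intros sqrt_lim)
    show "eventually (\<lambda>d. (sqrt (\<alpha> d * real d))\<^sup>2 = \<alpha> d * real d) sequentially"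
      using eventually_ge_at_top[of 1] by eventually_elim (simp add: assms(2) less_imp_le)
  qed
  obtain v :: "nat \<Rightarrow> real" where v: "antimono v" "\<forall>i. v i \<ge> 0" and v0: "v \<longlonglongrightarrow> 0"
    and zeros: "\<forall>y. limit_char (t\<^sup>2) y = 0 \<longleftrightarrow> (\<exists>i. y = v i - real i)"
    and negligible: "\<forall>Bad. (\<lambda>d. jack_mean (\<alpha> d) d (\<lambda>r. of_bool (r \<in> Bad d))) \<longlonglongrightarrow> 0 \<or>
       (\<exists>f r. strict_mono f \<and> (\<forall>k. f k \<ge> 1 \<and> r k \<in> row_functions (f k) \<and> r k \<in> Bad (f k)) \<and>
          (\<forall>i. (\<lambda>k. \<alpha> (f k) * real (r k i)) \<longlonglongrightarrow> v i))"
    by (rule limit_rows[OF _ \<alpha>0 area]) (erule assms(2), rule that)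
  \<comment> \<open>An event is negligible as soon as no sequence of diagrams in it has rescaled
    rows converging to \<open>v\<close>; rows and limit shape both become deterministic
    questions.\<close>
  have in_prob: "(\<lambda>d. measure (M d) {s \<in> space (M d). P d (\<Lambda> d s)}) \<longlonglongrightarrow> 0"
    if no: "\<And>f \<mu>. strict_mono f \<Longrightarrow> (\<And>k. f k \<ge> 1) \<Longrightarrow> (\<And>k. \<mu> k \<in> young_diagrams (f k)) \<Longrightarrow>
        (\<And>k. P (f k) (\<mu> k)) \<Longrightarrow> (\<And>i. (\<lambda>k. \<alpha> (f k) * real (row_function (\<mu> k) i)) \<longlonglongrightarrow> v i) \<Longrightarrow> False"
    for P :: "nat \<Rightarrow> nat list \<Rightarrow> bool"
  proof -
    define Bad where "Bad d = row_function ` {\<mu> \<in> young_diagrams d. P d \<mu>}" for d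
    have "(\<lambda>d. jack_mean (\<alpha> d) d (\<lambda>r. of_bool (r \<in> Bad d))) \<longlonglongrightarrow> 0"
    proof (rule ccontr)
      assume "\<not> ?thesis"
      with negligible obtain f r where f: "strict_mono f"
        "\<forall>k. f k \<ge> 1 \<and> r k \<in> row_functions (f k) \<and> r k \<in> Bad (f k)"
        and lim: "\<forall>i. (\<lambda>k. \<alpha> (f k) * real (r k i)) \<longlonglongrightarrow> v i" by blast
      have "\<forall>k. \<exists>\<mu>. \<mu> \<in> young_diagrams (f k) \<and> P (f k) \<mu> \<and> r k = row_function \<mu>"
        using f(2) by (auto simp: Bad_def)
      from choice[OF this] obtain \<mu> where \<mu>:
        "\<forall>k. \<mu> k \<in> young_diagrams (f k) \<and> P (f k) (\<mu> k) \<and> r k = row_function (\<mu> k)" ..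
      show False by (rule no[of f \<mu>]) (use f \<mu> lim in simp_all)
    qed
    then show ?thesis
    proof (rule tendsto_sandwich[OF _ _ tendsto_const, rotated 2])
      show "eventually (\<lambda>d. measure (M d) {s \<in> space (M d). P d (\<Lambda> d s)} \<le>
          jack_mean (\<alpha> d) d (\<lambda>r. of_bool (r \<in> Bad d))) sequentially"
        unfolding Bad_def using eventually_ge_at_top[of 1]
      proof eventually_elim
        case (elim d)
        then show ?case by (intro measure_le_jack_mean assms(2-4))
      qed
    qed simp
  qed
  \<comment> \<open>A zero \<open>y = v j - j\<close> of \<open>limit_char\<close> belongs to the
    order \<open>y - 1 = z * inverse g = - t * z\<close>, that is
    \<open>z = (j + 1 - v j) / t\<close>. Rows counted from 0 become labels counted from 1.\<close>
  define l where "l i = (real i - v (i - 1)) / t" for i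
  have lS: "l (Suc j) = - (v j - real (Suc j)) / t" for j by (simp add: l_def)
  have mono: "strict_mono_on {1..} l"
  proof (rule strict_mono_onI)
    fix i j :: nat assume ij: "i \<in> {1..}" "j \<in> {1..}" "i < j"
    then have "v (j - 1) \<le> v (i - 1)" by (intro antimonoD[OF v(1)]) simp
    with ij have "real i - v (i - 1) < real j - v (j - 1)" by simp
    then show "l i < l j" using t by (simp add: l_def divide_strict_right_mono)
  qed
  have range_l: "l ` {1..} = {z. bessel_J (z * inverse g) (- 2 * inverse g) = 0}"
  proof -
    have b: "bessel_J (z * inverse g) (- 2 * inverse g) = 0 \<longleftrightarrow> (\<exists>j. z = l (Suc j))" for z
    proof -
      have eqs: "z * inverse g = - (t * z)" "- 2 * inverse g = 2 * t" by (simp_all add: t_def)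
      have "bessel_J (z * inverse g) (- 2 * inverse g) = 0 \<longleftrightarrow> limit_char (t\<^sup>2) (1 - t * z) = 0"
        unfolding eqs bessel_J_eq_limit_char[OF t] using t by (simp add: algebra_simps)
      also have "\<dots> \<longleftrightarrow> (\<exists>j. z = l (Suc j))"
        unfolding zeros[rule_format] lS using t by (intro ex_cong1) (auto simp: field_simps)
      finally show ?thesis .
    qed
    have "{1..} = range Suc" by (auto simp: image_iff Suc_le_eq gr0_conv_Suc)
    then have "l ` {1..} = range (\<lambda>j. l (Suc j))" by (simp only: image_image)
    then show ?thesis unfolding b by auto
  qed
  have sub: "(\<lambda>k. F (f k)) \<longlonglongrightarrow> c" if "F \<longlonglongrightarrow> c" "strict_mono f" for F :: "nat \<Rightarrow> real" and f c
    using LIMSEQ_subseq_LIMSEQ[OF that] by (simp add: o_def)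
  have rows: "tendsto_in_prob M (\<lambda>d s. real (row_length (\<Lambda> d s) i) / (- g * real d)) (- l i - real i * g)"
    if i: "i \<ge> 1" for i
    unfolding tendsto_in_prob_def
  proof (intro allI impI)
    fix \<epsilon> :: real assume \<epsilon>: "\<epsilon> > 0"
    from i obtain j where j: "i = Suc j" by (cases i) auto
    have c: "- l i - real i * g = v j / t" using t by (simp add: j lS g field_simps)
    show "(\<lambda>d. measure (M d) {s \<in> space (M d).
        \<bar>real (row_length (\<Lambda> d s) i) / (- g * real d) - (- l i - real i * g)\<bar> > \<epsilon>}) \<longlonglongrightarrow> 0"
    proof (rule in_prob[of "\<lambda>d \<mu>. \<bar>real (row_length \<mu> i) / (- g * real d) - (- l i - real i * g)\<bar> > \<epsilon>"])
      fix f :: "nat \<Rightarrow> nat" and \<mu>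
      assume f: "strict_mono f" "\<And>k. f k \<ge> 1"
        and far: "\<And>k. \<bar>real (row_length (\<mu> k) i) / (- g * real (f k)) - (- l i - real i * g)\<bar> > \<epsilon>"
        and lim: "\<And>i. (\<lambda>k. \<alpha> (f k) * real (row_function (\<mu> k) i)) \<longlonglongrightarrow> v i"
      \<comment> \<open>Since \<open>- g = 1 / t\<close>, this expands the normalised row by
        \<alpha>, leaving only sequences with known limits.\<close>
      have "(\<lambda>k. t * (\<alpha> (f k) * real (row_function (\<mu> k) j)) / (\<alpha> (f k) * real (f k))) \<longlonglongrightarrow> t * v j / t\<^sup>2"
        using t by (intro tendsto_intros lim sub[OF area f(1)]) auto
      also have "t * v j / t\<^sup>2 = v j / t" using t by (simp add: power2_eq_square)
      also have "(\<lambda>k. t * (\<alpha> (f k) * real (row_function (\<mu> k) j)) / (\<alpha> (f k) * real (f k))) =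
          (\<lambda>k. real (row_length (\<mu> k) i) / (- g * real (f k)))"
        using t assms(2)[OF f(2)] by (auto simp: fun_eq_iff row_function_def j g less_imp_neq[symmetric])
      finally have "(\<lambda>k. real (row_length (\<mu> k) i) / (- g * real (f k))) \<longlonglongrightarrow> - l i - real i * g"
        unfolding c .
      from eventually_happens'[OF _ tendstoD[OF this \<epsilon>]] obtain k where
        "\<bar>real (row_length (\<mu> k) i) / (- g * real (f k)) - (- l i - real i * g)\<bar> < \<epsilon>"
        by (auto simp: dist_real_def)
      with far[of k] show False by simp
    qed
  qed
  define \<rho> where "\<rho> i = v i / t" for i
  define \<omega> where "\<omega> = staircase \<rho> (1 / t)"
  have \<rho>: "antimono \<rho>" "\<And>i. \<rho> i \<ge> 0"
    using v t by (auto simp: \<rho>_def antimono_def divide_right_mono)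
  have shape: "is_limit_shape \<alpha> M \<Lambda> \<omega>"
    unfolding is_limit_shape_def sup_tendsto_in_prob_def
  proof (intro allI impI)
    fix \<epsilon> :: real assume \<epsilon>: "\<epsilon> > 0"
    let ?w = "\<lambda>d. sqrt (\<alpha> d / real d)" and ?h = "\<lambda>d. 1 / sqrt (\<alpha> d * real d)"
    show "(\<lambda>d. measure (M d) {s \<in> space (M d).
        (SUP x. ereal \<bar>profile (?w d) (?h d) (\<Lambda> d s) x - \<omega> x\<bar>) > ereal \<epsilon>}) \<longlonglongrightarrow> 0"
    proof (rule in_prob[of "\<lambda>d \<mu>. (SUP x. ereal \<bar>profile (?w d) (?h d) \<mu> x - \<omega> x\<bar>) > ereal \<epsilon>"])
      fix f :: "nat \<Rightarrow> nat" and \<mu>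
      assume f: "strict_mono f" "\<And>k. f k \<ge> 1" and Y: "\<And>k. \<mu> k \<in> young_diagrams (f k)"
        and far: "\<And>k. (SUP x. ereal \<bar>profile (?w (f k)) (?h (f k)) (\<mu> k) x - \<omega> x\<bar>) > ereal \<epsilon>"
        and lim: "\<And>i. (\<lambda>k. \<alpha> (f k) * real (row_function (\<mu> k) i)) \<longlonglongrightarrow> v i"
      define R where "R k i = ?w (f k) * real (row_function (\<mu> k) i)" for k i
      have a: "\<alpha> (f k) > 0" for k using assms(2)[OF f(2)] .
      have d: "real (f k) > 0" for k using f(2)[of k] by simp
      \<comment> \<open>This form of the width makes a scaled row the quotient of two convergent
        sequences.\<close>
      have w: "?w (f k) = \<alpha> (f k) / sqrt (\<alpha> (f k) * real (f k))" for k
        using a[of k] d[of k] by (simp add: real_sqrt_divide real_sqrt_mult field_simps)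
      have h: "(\<lambda>k. ?h (f k)) \<longlonglongrightarrow> 1 / t"
        using t by (intro tendsto_intros sub[OF sqrt_lim f(1)]) auto
      have R: "(\<lambda>k. R k i) \<longlonglongrightarrow> \<rho> i" for i
      proof -
        have "(\<lambda>k. (\<alpha> (f k) * real (row_function (\<mu> k) i)) / sqrt (\<alpha> (f k) * real (f k))) \<longlonglongrightarrow> v i / t"
          using t by (intro tendsto_intros lim sub[OF sqrt_lim f(1)]) auto
        then show ?thesis by (simp add: R_def w \<rho>_def)
      qed
      have "\<rho> \<longlonglongrightarrow> 0 / t" unfolding \<rho>_def using t by (intro tendsto_intros v0) auto
      then have "eventually (\<lambda>i. 2 * \<rho> i < \<epsilon>) sequentially"
        using order_tendstoD(2)[of \<rho> "0 / t" sequentially "\<epsilon> / 2"] \<epsilon> by (simp add: mult.commute)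
      \<comment> \<open>As \<rho> tends to 0, uniform closeness needs only the rows up to
        \<open>K\<close>.\<close>
      then obtain K where K: "2 * \<rho> K < \<epsilon>" by (auto simp: eventually_sequentially)
      have ev1: "eventually (\<lambda>k. \<forall>i\<in>{..K}. 2 * \<bar>R k i - \<rho> i\<bar> < \<epsilon>) sequentially"
      proof (intro eventually_ball_finite ballI)
        fix i
        have "(\<lambda>k. 2 * \<bar>R k i - \<rho> i\<bar>) \<longlonglongrightarrow> 2 * \<bar>\<rho> i - \<rho> i\<bar>" by (intro tendsto_intros R)
        then show "eventually (\<lambda>k. 2 * \<bar>R k i - \<rho> i\<bar> < \<epsilon>) sequentially"
          by (rule order_tendstoD(2)) (use \<epsilon> in simp)
      qed simp
      have "(\<lambda>k. 2 * real K * \<bar>?h (f k) - 1 / t\<bar>) \<longlonglongrightarrow> 2 * real K * \<bar>1 / t - 1 / t\<bar>"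
        by (intro tendsto_intros h)
      then have ev2: "eventually (\<lambda>k. 2 * real K * \<bar>?h (f k) - 1 / t\<bar> < \<epsilon>) sequentially"
        by (rule order_tendstoD(2)) (use \<epsilon> in simp)
      have "(\<lambda>k. 2 * R k K) \<longlonglongrightarrow> 2 * \<rho> K" by (intro tendsto_intros R)
      then have ev3: "eventually (\<lambda>k. 2 * R k K < \<epsilon>) sequentially"
        by (rule order_tendstoD(2)) (use K in simp)
      from eventually_happens'[OF _ eventually_conj[OF ev1 eventually_conj[OF ev2 ev3]]]
      obtain k where "\<forall>i\<in>{..K}. 2 * \<bar>R k i - \<rho> i\<bar> < \<epsilon>"
        and k: "2 * real K * \<bar>?h (f k) - 1 / t\<bar> < \<epsilon>" "2 * R k K < \<epsilon>" by auto
      then have k1: "2 * \<bar>R k i - \<rho> i\<bar> < \<epsilon>" if "i \<le> K" for i using that by blast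
      have "?w (f k) > 0" "?h (f k) > 0" using a[of k] d[of k] by auto
      note prof = profile_eq_staircase[OF Y[of k] this]
      have "\<bar>profile (?w (f k)) (?h (f k)) (\<mu> k) x - \<omega> x\<bar> \<le> \<epsilon>" for x
        unfolding prof \<omega>_def R_def[symmetric]
      proof (rule staircase_close[where K = K])
        show "R k i \<ge> 0" for i unfolding R_def using \<open>?w (f k) > 0\<close> by simp
        show "\<rho> i \<ge> 0" for i by (rule \<rho>(2))
        show "2 * \<bar>R k i - \<rho> i\<bar> \<le> \<epsilon>" if "i \<le> K" for i using k1[OF that] by simp
        show "2 * R k K \<le> \<epsilon>" "2 * \<rho> K \<le> \<epsilon>" "2 * real K * \<bar>?h (f k) - 1 / t\<bar> \<le> \<epsilon>"
          using k K by simp_all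
        show "?h (f k) \<ge> 0" "1 / t \<ge> 0" using \<open>?h (f k) > 0\<close> t by (auto intro: less_imp_le)
      qed
      then have "(SUP x. ereal \<bar>profile (?w (f k)) (?h (f k)) (\<mu> k) x - \<omega> x\<bar>) \<le> ereal \<epsilon>"
        by (intro SUP_least) simp
      with far[of k] show False by simp
    qed
  qed
  \<comment> \<open>The interval ends of the statement are the two kinds of corners of the staircase
    with step height \<open>1 / t\<close>.\<close>
  have coords: "- l (Suc j) = \<rho> j - real (Suc j) * (1 / t)" "- l (Suc j) - g = \<rho> j - real j * (1 / t)" for j
    using t by (simp_all add: lS \<rho>_def g field_simps)
  note steps = staircase_steps[OF \<rho>, of "1 / t", folded \<omega>_def]
  have h: "1 / t > 0" using t by simp
  have "\<omega> x = x" if "x > - l 1 - g" for x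
    using steps(1)[OF h] that coords(2)[of 0] by simp
  moreover have "\<omega> x = - 2 * (l i + real i * g) - x" if i: "i \<ge> 1" and x: "x \<in> {- l i .. - l i - g}" for i x
  proof -
    from i obtain j where j: "i = Suc j" by (cases i) auto
    have "\<omega> x = 2 * \<rho> j - x" using x coords[of j] unfolding j by (intro steps(2)[OF h]) auto
    also have "2 * \<rho> j = - 2 * (l i + real i * g)" using coords(1)[of j] by (simp add: j g algebra_simps)
    finally show ?thesis .
  qed
  moreover have "\<omega> x = x - 2 * real i * g" if i: "i \<ge> 1" and x: "x \<in> {- l (i + 1) - g .. - l i}" for i x
  proof -
    from i obtain j where j: "i = Suc j" by (cases i) auto
    have "\<omega> x = x + 2 * real (Suc j) * (1 / t)"
      using x coords(2)[of "Suc j"] coords(1)[of j] unfolding j by (intro steps(3)[OF h]) auto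
    then show ?thesis by (simp add: j g)
  qed
  moreover have "x > - l 1 - g \<or> (\<exists>i\<ge>1. x \<in> {- l i .. - l i - g}) \<or>
      (\<exists>i\<ge>1. x \<in> {- l (i + 1) - g .. - l i})" for x
  proof -
    consider "x > \<rho> 0" | j where "\<rho> j - real (Suc j) * (1 / t) \<le> x" "x \<le> \<rho> j - real j * (1 / t)"
      | j where "\<rho> (Suc j) - real (Suc j) * (1 / t) \<le> x" "x \<le> \<rho> j - real (Suc j) * (1 / t)"
      using staircase_cover[OF \<rho>(1) h, of x] by blast
    then show ?thesis
    proof cases
      case 1
      then show ?thesis using coords(2)[of 0] by simp
    next
      case (2 j)
      then have "x \<in> {- l (Suc j) .. - l (Suc j) - g}" using coords[of j] by simp
      then show ?thesis by (intro disjI2 disjI1 exI[of _ "Suc j"]) simp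
    next
      case (3 j)
      then have "x \<in> {- l (Suc j + 1) - g .. - l (Suc j)}"
        using coords(2)[of "Suc j"] coords(1)[of j] by simp
      then show ?thesis by (intro disjI2 exI[of _ "Suc j"]) simp
    qed
  qed
  ultimately show ?thesis
    by (intro exI[of _ l] exI[of _ \<omega>] conjI mono range_l shape) (use rows in blast)+
qed

end
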